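(* If $(M,L)$ is a concircularly recurrent Finsler manifold of dimension $n\geq 3$ with recurrence form $A$, then: (a) $(M,L)$ is 2-concircularly recurrent ($2CF_n$) provided that $\overset{h}{\nabla}A+A\otimes A\neq 0$; (b) $(M,L)$ is generalized recurrent ($GF_n$) (resp. generalized Ricci recurrent ($GRF_n$)) provided that $\overset{h}{\nabla}r-rA\neq 0$; (c) $(M,L)$ is recurrent ($F_n$) provided that $\widehat R=0$.
   Context: Setting. $(M,L)$ is a Finsler manifold of dimension $n$; $\pi:\mathcal{T}M\to M$ is the bundle of nonzero tangent vectors; $\pi$-tensor fields are tensor fields on the pullback bundle $\pi^{-1}(TM)$, $\pi$-vector fields ($\overline X,\overline Y,\dots$) are sections of it, and $\overline\eta(u)=(u,u)$ is the fundamental $\pi$-vector field. $g$ is the Finsler metric defined by $L$. $\rho:T(\mathcal{T}M)\to\pi^{-1}(TM)$ and $\gamma:\pi^{-1}(TM)\to T(\mathcal{T}M)$ are the canonical bundle maps. $\nabla$ is the Cartan connection: the unique linear connection on $\pi^{-1}(TM)$ which is regular ($T(\mathcal{T}M)$ is the direct sum of the vertical bundle and the horizontal bundle $\{X:\nabla_X\overline\eta=0\}$), metric ($\nabla g=0$), with $\mathbf{T}(\beta\overline X,\beta\overline Y)=0$ and with $T(\overline X,\overline Y):=\mathbf{T}(\gamma\overline X,\beta\overline Y)$ satisfying $g(T(\overline X,\overline Y),\overline Z)=g(T(\overline X,\overline Z),\overline Y)$, where $\mathbf{T}(X,Y)=\nabla_X\rho Y-\nabla_Y\rho X-\rho[X,Y]$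 and $\beta$ is the inverse of $\rho$ restricted to the horizontal bundle. $\overset{h}{\nabla}$ is the $h$-covariant derivative, i.e. covariant derivative in the directions $\beta\overline X$; arguments are ordered so that the Leibniz rule reads $\overset{h}{\nabla}(A\otimes S)=\overset{h}{\nabla}A\otimes S+A\otimes\overset{h}{\nabla}S$, and $\overset{h}{\nabla}S=A\otimes S$ means $\nabla_{\beta\overline X}S=A(\overline X)S$ for all $\overline X$. Curvature. $R(\overline X,\overline Y)\overline Z=\mathbf{K}(\beta\overline X,\beta\overline Y)\overline Z$ is the $h$-curvature tensor, with $\mathbf{K}(X,Y)=-\nabla_X\nabla_Y+\nabla_Y\nabla_X+\nabla_{[X,Y]}$, and $\widehat R(\overline X,\overline Y)=R(\overline X,\overline Y)\overline\eta$. The horizontal Ricci tensor $\mathrm{Ric}(\overline X,\overline Z)$ is the trace of $\overline Y\mapsto R(\overline X,\overline Y)\overline Z$, and the horizontal scalar curvature $r$ is the $g$-trace of $\mathrm{Ric}$. $G(\overline X,\overline Y)\overline Z:=g(\overline X,\overline Z)\overline Y-g(\overline Y,\overline Z)\overline X$. $C:=R-\frac{r}{n(n-1)}G$ is the concircular curvature tensor. Definitions. In all of them $A,B$ are non-zero scalar 1-forms and $\alpha$ a non-zero scalar 2-form ($(0,1)$, resp. $(0,2)$, $\pi$-tensor fields, the latter not necessarily skew), positively homogeneous of degree zero in $y$, called recurrence forms. A Finsler manifold of dimension $n\ge 3$ with non-zero $R$ is: recurrent ($F_n$) if $\overset{h}{\nabla}R=A\otimes R$; generalized recurrent ($GF_n$)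 if $\overset{h}{\nabla}R=A\otimes R+B\otimes G$. A Finsler manifold of dimension $n\ge 3$ with non-zero $\mathrm{Ric}$ is generalized Ricci recurrent ($GRF_n$) if $\overset{h}{\nabla}\mathrm{Ric}=A\otimes\mathrm{Ric}+B\otimes g$. A Finsler manifold of dimension $n\ge 3$ with non-zero $C$ is: concircularly recurrent ($CF_n$) if $\overset{h}{\nabla}C=A\otimes C$; 2-concircularly recurrent ($2CF_n$) if $\overset{h}{\nabla}\overset{h}{\nabla}C=\alpha\otimes C$. *)

theory Defs
  imports "HOL-Analysis.Analysis"
begin

section \<open>Smooth maps on open subsets of normed spaces\<close>

fun Ck_on :: "nat \<Rightarrow> 'a::real_normed_vector set \<Rightarrow> ('a \<Rightarrow> 'b::real_normed_vector) \<Rightarrow> bool" where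
  "Ck_on 0 S f \<longleftrightarrow> continuous_on S f"
| "Ck_on (Suc k) S f \<longleftrightarrow>
     f differentiable_on S \<and> (\<forall>v. Ck_on k S (\<lambda>x. frechet_derivative f (at x) v))"

definition smooth_on :: "'a::real_normed_vector set \<Rightarrow> ('a \<Rightarrow> 'b::real_normed_vector) \<Rightarrow> bool" where
  "smooth_on S f \<longleftrightarrow> (\<forall>k. Ck_on k S f)"


section \<open>Manifolds\<close>

text \<open>
  A chart is a domain with a coordinate map. A smooth structure is presented by a family of
  pairwise smoothly compatible charts \<open>\<kappa> p\<close> indexed by points, with \<open>p\<close> in the domain of
  \<open>\<kappa> p\<close>; every atlas contains such a family, and the family determines the structure. The chart
  \<open>\<kappa> p\<close> is used to represent a tangent vector at \<open>p\<close> by its components in that chart, so that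
  the model space \<open>'e\<close> itself serves as the tangent space at \<open>p\<close>; \<open>tcomp\<close> changes the
  components to those in any other chart. The underlying set is the whole type \<open>'p\<close> (for the base
  manifold) or the union of the chart domains (for the slit tangent bundle).
\<close>

type_synonym ('p, 'e) chart = "'p set \<times> ('p \<Rightarrow> 'e)"

definition cdom :: "('p, 'e) chart \<Rightarrow> 'p set" where
  "cdom c = fst c"

definition cmap :: "('p, 'e) chart \<Rightarrow> 'p \<Rightarrow> 'e" where
  "cmap c = snd c"

definition cran :: "('p, 'e) chart \<Rightarrow> 'e set" where
  "cran c = cmap c ` cdom c"

definition cinv :: "('p, 'e) chart \<Rightarrow> 'e \<Rightarrow> 'p" where
  "cinv c = inv_into (cdom c) (cmap c)"

definition smooth_manifold ::
  "('m::{t2_space, second_countable_topology} \<Rightarrow> ('m, 'e::euclidean_space) chart) \<Rightarrow> bool" where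
  "smooth_manifold \<kappa> \<longleftrightarrow>
     (\<forall>p. p \<in> cdom (\<kappa> p) \<and> open (cdom (\<kappa> p)) \<and> open (cran (\<kappa> p)) \<and>
          homeomorphism (cdom (\<kappa> p)) (cran (\<kappa> p)) (cmap (\<kappa> p)) (cinv (\<kappa> p))) \<and>
     (\<forall>p q. smooth_on (cmap (\<kappa> p) ` (cdom (\<kappa> p) \<inter> cdom (\<kappa> q))) (cmap (\<kappa> q) \<circ> cinv (\<kappa> p)))"

definition tcomp :: "('p \<Rightarrow> ('p, 'e::euclidean_space) chart) \<Rightarrow> ('p, 'e) chart \<Rightarrow> 'p \<Rightarrow> 'e \<Rightarrow> 'e" where
  "tcomp \<kappa> c p v = frechet_derivative (cmap c \<circ> cinv (\<kappa> p)) (at (cmap (\<kappa> p) p)) v"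

text \<open>Smoothness on some neighbourhood of a point, for functions and for vector fields.\<close>

definition smooth_near ::
  "('p \<Rightarrow> ('p, 'e::euclidean_space) chart) \<Rightarrow> 'p \<Rightarrow> ('p \<Rightarrow> 'b::real_normed_vector) \<Rightarrow> bool" where
  "smooth_near \<kappa> p f \<longleftrightarrow>
     (\<exists>W. open W \<and> cmap (\<kappa> p) p \<in> W \<and> W \<subseteq> cran (\<kappa> p) \<and> smooth_on W (f \<circ> cinv (\<kappa> p)))"

definition vf_rep ::
  "('p \<Rightarrow> ('p, 'e::euclidean_space) chart) \<Rightarrow> ('p, 'e) chart \<Rightarrow> ('p \<Rightarrow> 'e) \<Rightarrow> 'e \<Rightarrow> 'e" where
  "vf_rep \<kappa> c X x = tcomp \<kappa> c (cinv c x) (X (cinv c x))"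

definition vf_smooth_near ::
  "('p \<Rightarrow> ('p, 'e::euclidean_space) chart) \<Rightarrow> 'p \<Rightarrow> ('p \<Rightarrow> 'e) \<Rightarrow> bool" where
  "vf_smooth_near \<kappa> p X \<longleftrightarrow>
     (\<exists>W. open W \<and> cmap (\<kappa> p) p \<in> W \<and> W \<subseteq> cran (\<kappa> p) \<and> smooth_on W (vf_rep \<kappa> (\<kappa> p) X))"

text \<open>\<open>dir_deriv \<kappa> p v f\<close> is the derivative \<open>v(f)\<close> of \<open>f\<close> along the tangent vector \<open>v\<close> at \<open>p\<close>.\<close>

definition dir_deriv ::
  "('p \<Rightarrow> ('p, 'e::euclidean_space) chart) \<Rightarrow> 'p \<Rightarrow> 'e \<Rightarrow> ('p \<Rightarrow> real) \<Rightarrow> real" where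
  "dir_deriv \<kappa> p v f = frechet_derivative (f \<circ> cinv (\<kappa> p)) (at (cmap (\<kappa> p) p)) v"

definition lie_bracket ::
  "('p \<Rightarrow> ('p, 'e::euclidean_space) chart) \<Rightarrow> ('p \<Rightarrow> 'e) \<Rightarrow> ('p \<Rightarrow> 'e) \<Rightarrow> 'p \<Rightarrow> 'e" where
  "lie_bracket \<kappa> X Y p =
     frechet_derivative (vf_rep \<kappa> (\<kappa> p) Y) (at (cmap (\<kappa> p) p)) (X p) -
     frechet_derivative (vf_rep \<kappa> (\<kappa> p) X) (at (cmap (\<kappa> p) p)) (Y p)"


section \<open>The slit tangent bundle and the pullback bundle\<close>

text \<open>
  A point \<open>(p, y)\<close> is the tangent vector at \<open>p\<close> with components \<open>y\<close> in the chart \<open>\<kappa> p\<close>. The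
  slit tangent bundle is a manifold under the charts \<open>tchart \<kappa> u\<close>, which are the bundle charts
  induced by the charts of the base. (Its topology is the one given by these charts, not the
  product topology of the type.)
\<close>

type_synonym ('m, 'n) tpoint = "'m \<times> (real ^ 'n)"

definition slit :: "('m, 'n::finite) tpoint set" where
  "slit = {u. snd u \<noteq> 0}"

definition tchart ::
  "('m \<Rightarrow> ('m, real ^ 'n) chart) \<Rightarrow> ('m, 'n::finite) tpoint
     \<Rightarrow> (('m, 'n) tpoint, (real ^ 'n) \<times> (real ^ 'n)) chart" where
  "tchart \<kappa> u =
     (cdom (\<kappa> (fst u)) \<times> (UNIV - {0}),
      \<lambda>(q, v). (cmap (\<kappa> (fst u)) q, tcomp \<kappa> (\<kappa> (fst u)) q v))"

text \<open>
  A \<open>\<pi>\<close>-vector field assigns to \<open>u = (p, y)\<close> a tangent vector to the base at \<open>p\<close>, hence has the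
  type \<open>('m, 'n) tpoint \<Rightarrow> real ^ 'n\<close>; a vector field on the slit tangent bundle has the type
  \<open>('m, 'n) tpoint \<Rightarrow> (real ^ 'n) \<times> (real ^ 'n)\<close>, by its components in \<open>tchart \<kappa> u\<close> at \<open>u\<close>.
\<close>

type_synonym ('m, 'n) pfield = "('m, 'n) tpoint \<Rightarrow> real ^ 'n"
type_synonym ('m, 'n) tfield = "('m, 'n) tpoint \<Rightarrow> (real ^ 'n) \<times> (real ^ 'n)"

definition pf_smooth_near ::
  "('m \<Rightarrow> ('m, real ^ 'n) chart) \<Rightarrow> ('m, 'n::finite) tpoint \<Rightarrow> ('m, 'n) pfield \<Rightarrow> bool" where
  "pf_smooth_near \<kappa> u Y \<longleftrightarrow> smooth_near (tchart \<kappa>) u (\<lambda>w. tcomp \<kappa> (\<kappa> (fst u)) (fst w) (Y w))"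

text \<open>
  The bundle maps \<open>\<rho>(X) = (u, d\<pi>(X))\<close> and \<open>\<gamma>(u, v) = d/dt (u + t v)\<close> at \<open>t = 0\<close>: in the
  charts \<open>tchart \<kappa> u\<close> and \<open>\<kappa> (fst u)\<close> in which vectors at \<open>u\<close> and at \<open>\<pi>(u)\<close> are represented,
  \<open>\<pi>\<close> is the first projection and the curve is \<open>(x, y + t v)\<close>.
\<close>

definition rho :: "(real ^ 'n::finite) \<times> (real ^ 'n) \<Rightarrow> real ^ 'n" where
  "rho X = fst X"

definition gam :: "real ^ 'n::finite \<Rightarrow> (real ^ 'n) \<times> (real ^ 'n)" where
  "gam v = (0, v)"

definition eta :: "('m, 'n::finite) pfield" where
  "eta u = snd u"

text \<open>
  The \<open>\<pi>\<close>-vector field extending a vector \<open>v\<close> at \<open>u\<close> that has constant components in the chart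
  \<open>\<kappa> (\<pi> u)\<close>. It serves to evaluate, at single vectors, expressions in vector fields that are
  tensorial and hence independent of the extension.
\<close>

definition ext ::
  "('m \<Rightarrow> ('m, real ^ 'n) chart) \<Rightarrow> ('m, 'n::finite) tpoint \<Rightarrow> real ^ 'n \<Rightarrow> ('m, 'n) pfield" where
  "ext \<kappa> u v w =
     frechet_derivative (cmap (\<kappa> (fst w)) \<circ> cinv (\<kappa> (fst u))) (at (cmap (\<kappa> (fst u)) (fst w))) v"


section \<open>Finsler manifolds\<close>

text \<open>The Finsler metric: half the second fibre derivative of \<open>L\<^sup>2\<close>.\<close>

definition fmetric :: "(('m, 'n::finite) tpoint \<Rightarrow> real) \<Rightarrow> ('m, 'n) tpoint \<Rightarrow> real ^ 'n \<Rightarrow> real ^ 'n \<Rightarrow> real" where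
  "fmetric L u v w =
     frechet_derivative
       (\<lambda>y. frechet_derivative (\<lambda>z. (L (fst u, z))\<^sup>2) (at y) w) (at (snd u)) v / 2"

definition finsler_manifold ::
  "('m::{t2_space, second_countable_topology} \<Rightarrow> ('m, real ^ 'n) chart)
     \<Rightarrow> (('m, 'n::finite) tpoint \<Rightarrow> real) \<Rightarrow> bool" where
  "finsler_manifold \<kappa> L \<longleftrightarrow>
     smooth_manifold \<kappa> \<and>
     (\<forall>u\<in>slit. smooth_near (tchart \<kappa>) u L) \<and>
     (\<forall>u\<in>slit. L u > 0) \<and>
     (\<forall>p y c. c > 0 \<longrightarrow> L (p, c *\<^sub>R y) = c * L (p, y)) \<and>
     (\<forall>u\<in>slit. \<forall>v. v \<noteq> 0 \<longrightarrow> fmetric L u v v > 0)"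


section \<open>Linear connections on the pullback bundle; the Cartan connection\<close>

text \<open>
  \<open>D u X Y\<close> is the covariant derivative at \<open>u\<close> of the \<open>\<pi>\<close>-vector field \<open>Y\<close>, defined and smooth
  near \<open>u\<close>, along the tangent vector \<open>X\<close> at \<open>u\<close> to the slit tangent bundle. Since the Leibniz rule
  is required for all functions that are smooth near \<open>u\<close>, the value depends on the germ of \<open>Y\<close>
  at \<open>u\<close> only.
\<close>

type_synonym ('m, 'n) connection =
  "('m, 'n) tpoint \<Rightarrow> (real ^ 'n) \<times> (real ^ 'n) \<Rightarrow> ('m, 'n) pfield \<Rightarrow> real ^ 'n"

definition linear_connection ::
  "('m \<Rightarrow> ('m, real ^ 'n) chart) \<Rightarrow> ('m, 'n::finite) connection \<Rightarrow> bool" where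
  "linear_connection \<kappa> D \<longleftrightarrow>
     (\<forall>u\<in>slit.
        (\<forall>Y. pf_smooth_near \<kappa> u Y \<longrightarrow> linear (\<lambda>X. D u X Y)) \<and>
        (\<forall>X Y Z. pf_smooth_near \<kappa> u Y \<longrightarrow> pf_smooth_near \<kappa> u Z \<longrightarrow>
           D u X (\<lambda>w. Y w + Z w) = D u X Y + D u X Z) \<and>
        (\<forall>X f Y. smooth_near (tchart \<kappa>) u f \<longrightarrow> pf_smooth_near \<kappa> u Y \<longrightarrow>
           D u X (\<lambda>w. f w *\<^sub>R Y w) = dir_deriv (tchart \<kappa>) u X f *\<^sub>R Y u + f u *\<^sub>R D u X Y) \<and>
        (\<forall>X Y. vf_smooth_near (tchart \<kappa>) u X \<longrightarrow> pf_smooth_near \<kappa> u Y \<longrightarrow>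
           pf_smooth_near \<kappa> u (\<lambda>w. D w (X w) Y)))"

definition horizontal :: "('m, 'n::finite) connection \<Rightarrow> ('m, 'n) tpoint \<Rightarrow> ((real ^ 'n) \<times> (real ^ 'n)) set" where
  "horizontal D u = {X. D u X eta = 0}"

definition vertical :: "((real ^ 'n::finite) \<times> (real ^ 'n)) set" where
  "vertical = {X. rho X = 0}"

definition regular_connection :: "('m, 'n::finite) connection \<Rightarrow> bool" where
  "regular_connection D \<longleftrightarrow>
     (\<forall>u\<in>slit. vertical \<inter> horizontal D u = {0} \<and>
        (\<forall>Z. \<exists>V\<in>vertical. \<exists>H\<in>horizontal D u. Z = V + H))"

definition beta :: "('m, 'n::finite) connection \<Rightarrow> ('m, 'n) tpoint \<Rightarrow> real ^ 'n \<Rightarrow> (real ^ 'n) \<times> (real ^ 'n)" where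
  "beta D u v = (THE X. X \<in> horizontal D u \<and> rho X = v)"

definition hlift :: "('m, 'n::finite) connection \<Rightarrow> ('m, 'n) pfield \<Rightarrow> ('m, 'n) tfield" where
  "hlift D X = (\<lambda>w. beta D w (X w))"

definition vlift :: "('m, 'n::finite) pfield \<Rightarrow> ('m, 'n) tfield" where
  "vlift X = (\<lambda>w. gam (X w))"

text \<open>The torsion and the curvature of a connection, for smooth vector fields.\<close>

definition torsion ::
  "('m \<Rightarrow> ('m, real ^ 'n) chart) \<Rightarrow> ('m, 'n::finite) connection \<Rightarrow> ('m, 'n) tfield \<Rightarrow> ('m, 'n) tfield \<Rightarrow> ('m, 'n) pfield" where
  "torsion \<kappa> D X Y u =
     D u (X u) (\<lambda>w. rho (Y w)) - D u (Y u) (\<lambda>w. rho (X w)) - rho (lie_bracket (tchart \<kappa>) X Y u)"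

definition curvature ::
  "('m \<Rightarrow> ('m, real ^ 'n) chart) \<Rightarrow> ('m, 'n::finite) connection \<Rightarrow> ('m, 'n) tfield \<Rightarrow> ('m, 'n) tfield
     \<Rightarrow> ('m, 'n) pfield \<Rightarrow> ('m, 'n) pfield" where
  "curvature \<kappa> D X Y Z u =
     - D u (X u) (\<lambda>w. D w (Y w) Z) + D u (Y u) (\<lambda>w. D w (X w) Z)
     + D u (lie_bracket (tchart \<kappa>) X Y u) Z"

definition cartan_connection ::
  "('m \<Rightarrow> ('m, real ^ 'n) chart) \<Rightarrow> (('m, 'n::finite) tpoint \<Rightarrow> real) \<Rightarrow> ('m, 'n) connection \<Rightarrow> bool" where
  "cartan_connection \<kappa> L D \<longleftrightarrow>
     linear_connection \<kappa> D \<and>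
     regular_connection D \<and>
     (\<forall>u\<in>slit. \<forall>X Y Z. pf_smooth_near \<kappa> u Y \<longrightarrow> pf_smooth_near \<kappa> u Z \<longrightarrow>
        dir_deriv (tchart \<kappa>) u X (\<lambda>w. fmetric L w (Y w) (Z w)) =
          fmetric L u (D u X Y) (Z u) + fmetric L u (Y u) (D u X Z)) \<and>
     (\<forall>u\<in>slit. \<forall>X Y. pf_smooth_near \<kappa> u X \<longrightarrow> pf_smooth_near \<kappa> u Y \<longrightarrow>
        torsion \<kappa> D (hlift D X) (hlift D Y) u = 0) \<and>
     (\<forall>u\<in>slit. \<forall>X Y Z. pf_smooth_near \<kappa> u X \<longrightarrow> pf_smooth_near \<kappa> u Y \<longrightarrow> pf_smooth_near \<kappa> u Z \<longrightarrow>
        fmetric L u (torsion \<kappa> D (vlift X) (hlift D Y) u) (Z u) =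
        fmetric L u (torsion \<kappa> D (vlift X) (hlift D Z) u) (Y u))"


section \<open>Curvature tensors\<close>

text \<open>
  A \<open>\<pi>\<close>-tensor field is represented by its values \<open>S u x y \<dots>\<close> on vectors at \<open>u\<close>.
\<close>

definition hcurv ::
  "('m \<Rightarrow> ('m, real ^ 'n) chart) \<Rightarrow> ('m, 'n::finite) connection
     \<Rightarrow> ('m, 'n) tpoint \<Rightarrow> real ^ 'n \<Rightarrow> real ^ 'n \<Rightarrow> real ^ 'n \<Rightarrow> real ^ 'n" where
  "hcurv \<kappa> D u x y z =
     curvature \<kappa> D (hlift D (ext \<kappa> u x)) (hlift D (ext \<kappa> u y)) (ext \<kappa> u z) u"

definition hcurv_hat ::
  "('m \<Rightarrow> ('m, real ^ 'n) chart) \<Rightarrow> ('m, 'n::finite) connection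
     \<Rightarrow> ('m, 'n) tpoint \<Rightarrow> real ^ 'n \<Rightarrow> real ^ 'n \<Rightarrow> real ^ 'n" where
  "hcurv_hat \<kappa> D u x y = hcurv \<kappa> D u x y (eta u)"

definition hRic ::
  "('m \<Rightarrow> ('m, real ^ 'n) chart) \<Rightarrow> ('m, 'n::finite) connection
     \<Rightarrow> ('m, 'n) tpoint \<Rightarrow> real ^ 'n \<Rightarrow> real ^ 'n \<Rightarrow> real" where
  "hRic \<kappa> D u x z = trace (matrix (\<lambda>y. hcurv \<kappa> D u x y z))"

definition gram :: "(real ^ 'n::finite \<Rightarrow> real ^ 'n \<Rightarrow> real) \<Rightarrow> real ^ 'n ^ 'n" where
  "gram b = (\<chi> i j. b (axis i 1) (axis j 1))"

text \<open>The \<open>g\<close>-trace \<open>g\<^sup>i\<^sup>j Ric\<^sub>i\<^sub>j\<close>.\<close>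

definition hscal ::
  "('m \<Rightarrow> ('m, real ^ 'n) chart) \<Rightarrow> (('m, 'n::finite) tpoint \<Rightarrow> real) \<Rightarrow> ('m, 'n) connection
     \<Rightarrow> ('m, 'n) tpoint \<Rightarrow> real" where
  "hscal \<kappa> L D u = trace (matrix_inv (gram (fmetric L u)) ** gram (hRic \<kappa> D u))"

definition Gtensor ::
  "(('m, 'n::finite) tpoint \<Rightarrow> real)
     \<Rightarrow> ('m, 'n) tpoint \<Rightarrow> real ^ 'n \<Rightarrow> real ^ 'n \<Rightarrow> real ^ 'n \<Rightarrow> real ^ 'n" where
  "Gtensor L u x y z = fmetric L u x z *\<^sub>R y - fmetric L u y z *\<^sub>R x"

definition concircular ::
  "('m \<Rightarrow> ('m, real ^ 'n) chart) \<Rightarrow> (('m, 'n::finite) tpoint \<Rightarrow> real) \<Rightarrow> ('m, 'n) connection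
     \<Rightarrow> ('m, 'n) tpoint \<Rightarrow> real ^ 'n \<Rightarrow> real ^ 'n \<Rightarrow> real ^ 'n \<Rightarrow> real ^ 'n" where
  "concircular \<kappa> L D u x y z =
     hcurv \<kappa> D u x y z
     - (hscal \<kappa> L D u / (real CARD('n) * (real CARD('n) - 1))) *\<^sub>R Gtensor L u x y z"


section \<open>The h-covariant derivative\<close>

text \<open>
  The direction of differentiation comes after the 1-form arguments already present and before
  the remaining ones, so that \<open>\<nabla>(A \<otimes> S) = \<nabla>A \<otimes> S + A \<otimes> \<nabla>S\<close> holds slot by slot:
  \<open>hcov1\<close> gives \<open>(\<nabla>A)(v, w) = (\<nabla>\<^bsub>\<beta>w\<^esub> A)(v)\<close>, and \<open>hcov_form13\<close>, for a 1-form \<open>T\<close> with values in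
  tensors of type (1,3) such as \<open>T = \<nabla>C\<close>, gives \<open>(\<nabla>T)(v, w, x, y, z) = (\<nabla>\<^bsub>\<beta>w\<^esub> T)(v, x, y, z)\<close>.
  In \<open>hcov2\<close> and \<open>hcov13\<close> the direction \<open>w\<close> comes first.
\<close>

definition hcov0 ::
  "('m \<Rightarrow> ('m, real ^ 'n) chart) \<Rightarrow> ('m, 'n::finite) connection \<Rightarrow> (('m, 'n) tpoint \<Rightarrow> real)
     \<Rightarrow> ('m, 'n) tpoint \<Rightarrow> real ^ 'n \<Rightarrow> real" where
  "hcov0 \<kappa> D f u w = dir_deriv (tchart \<kappa>) u (beta D u w) f"

definition hcov1 ::
  "('m \<Rightarrow> ('m, real ^ 'n) chart) \<Rightarrow> ('m, 'n::finite) connection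
     \<Rightarrow> (('m, 'n) tpoint \<Rightarrow> real ^ 'n \<Rightarrow> real)
     \<Rightarrow> ('m, 'n) tpoint \<Rightarrow> real ^ 'n \<Rightarrow> real ^ 'n \<Rightarrow> real" where
  "hcov1 \<kappa> D A u v w =
     (let V = ext \<kappa> u v; N = D u (beta D u w)
      in dir_deriv (tchart \<kappa>) u (beta D u w) (\<lambda>q. A q (V q)) - A u (N V))"

definition hcov2 ::
  "('m \<Rightarrow> ('m, real ^ 'n) chart) \<Rightarrow> ('m, 'n::finite) connection
     \<Rightarrow> (('m, 'n) tpoint \<Rightarrow> real ^ 'n \<Rightarrow> real ^ 'n \<Rightarrow> real)
     \<Rightarrow> ('m, 'n) tpoint \<Rightarrow> real ^ 'n \<Rightarrow> real ^ 'n \<Rightarrow> real ^ 'n \<Rightarrow> real" where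
  "hcov2 \<kappa> D S u w x y =
     (let X = ext \<kappa> u x; Y = ext \<kappa> u y; N = D u (beta D u w)
      in dir_deriv (tchart \<kappa>) u (beta D u w) (\<lambda>q. S q (X q) (Y q)) - S u (N X) y - S u x (N Y))"

definition hcov13 ::
  "('m \<Rightarrow> ('m, real ^ 'n) chart) \<Rightarrow> ('m, 'n::finite) connection
     \<Rightarrow> (('m, 'n) tpoint \<Rightarrow> real ^ 'n \<Rightarrow> real ^ 'n \<Rightarrow> real ^ 'n \<Rightarrow> real ^ 'n)
     \<Rightarrow> ('m, 'n) tpoint \<Rightarrow> real ^ 'n \<Rightarrow> real ^ 'n \<Rightarrow> real ^ 'n \<Rightarrow> real ^ 'n \<Rightarrow> real ^ 'n" where
  "hcov13 \<kappa> D S u w x y z =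
     (let X = ext \<kappa> u x; Y = ext \<kappa> u y; Z = ext \<kappa> u z; N = D u (beta D u w)
      in N (\<lambda>q. S q (X q) (Y q) (Z q)) - S u (N X) y z - S u x (N Y) z - S u x y (N Z))"

definition hcov_form13 ::
  "('m \<Rightarrow> ('m, real ^ 'n) chart) \<Rightarrow> ('m, 'n::finite) connection
     \<Rightarrow> (('m, 'n) tpoint \<Rightarrow> real ^ 'n \<Rightarrow> real ^ 'n \<Rightarrow> real ^ 'n \<Rightarrow> real ^ 'n \<Rightarrow> real ^ 'n)
     \<Rightarrow> ('m, 'n) tpoint \<Rightarrow> real ^ 'n \<Rightarrow> real ^ 'n \<Rightarrow> real ^ 'n \<Rightarrow> real ^ 'n \<Rightarrow> real ^ 'n \<Rightarrow> real ^ 'n" where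
  "hcov_form13 \<kappa> D T u v w x y z =
     (let V = ext \<kappa> u v; X = ext \<kappa> u x; Y = ext \<kappa> u y; Z = ext \<kappa> u z; N = D u (beta D u w)
      in N (\<lambda>q. T q (V q) (X q) (Y q) (Z q))
         - T u (N V) x y z - T u v (N X) y z - T u v x (N Y) z - T u v x y (N Z))"


section \<open>Recurrence\<close>

definition recurrence_1form ::
  "('m \<Rightarrow> ('m, real ^ 'n) chart) \<Rightarrow> (('m, 'n::finite) tpoint \<Rightarrow> real ^ 'n \<Rightarrow> real) \<Rightarrow> bool" where
  "recurrence_1form \<kappa> A \<longleftrightarrow>
     (\<forall>u\<in>slit. linear (A u)) \<and>
     (\<forall>u\<in>slit. \<forall>X. pf_smooth_near \<kappa> u X \<longrightarrow> smooth_near (tchart \<kappa>) u (\<lambda>q. A q (X q))) \<and>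
     (\<forall>p y c v. y \<noteq> 0 \<longrightarrow> c > 0 \<longrightarrow> A (p, c *\<^sub>R y) v = A (p, y) v) \<and>
     (\<exists>u\<in>slit. \<exists>v. A u v \<noteq> 0)"

definition recurrence_2form ::
  "('m \<Rightarrow> ('m, real ^ 'n) chart) \<Rightarrow> (('m, 'n::finite) tpoint \<Rightarrow> real ^ 'n \<Rightarrow> real ^ 'n \<Rightarrow> real) \<Rightarrow> bool" where
  "recurrence_2form \<kappa> \<alpha> \<longleftrightarrow>
     (\<forall>u\<in>slit. (\<forall>w. linear (\<lambda>v. \<alpha> u v w)) \<and> (\<forall>v. linear (\<lambda>w. \<alpha> u v w))) \<and>
     (\<forall>u\<in>slit. \<forall>X Y. pf_smooth_near \<kappa> u X \<longrightarrow> pf_smooth_near \<kappa> u Y \<longrightarrow>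
        smooth_near (tchart \<kappa>) u (\<lambda>q. \<alpha> q (X q) (Y q))) \<and>
     (\<forall>p y c v w. y \<noteq> 0 \<longrightarrow> c > 0 \<longrightarrow> \<alpha> (p, c *\<^sub>R y) v w = \<alpha> (p, y) v w) \<and>
     (\<exists>u\<in>slit. \<exists>v w. \<alpha> u v w \<noteq> 0)"

definition recurrent ::
  "('m \<Rightarrow> ('m, real ^ 'n) chart) \<Rightarrow> ('m, 'n::finite) connection \<Rightarrow> bool" where
  "recurrent \<kappa> D \<longleftrightarrow>
     CARD('n) \<ge> 3 \<and>
     (\<exists>u\<in>slit. \<exists>x y z. hcurv \<kappa> D u x y z \<noteq> 0) \<and>
     (\<exists>A. recurrence_1form \<kappa> A \<and>
        (\<forall>u\<in>slit. \<forall>w x y z. hcov13 \<kappa> D (hcurv \<kappa> D) u w x y z = A u w *\<^sub>R hcurv \<kappa> D u x y z))"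

definition generalized_recurrent ::
  "('m \<Rightarrow> ('m, real ^ 'n) chart) \<Rightarrow> (('m, 'n::finite) tpoint \<Rightarrow> real) \<Rightarrow> ('m, 'n) connection \<Rightarrow> bool" where
  "generalized_recurrent \<kappa> L D \<longleftrightarrow>
     CARD('n) \<ge> 3 \<and>
     (\<exists>u\<in>slit. \<exists>x y z. hcurv \<kappa> D u x y z \<noteq> 0) \<and>
     (\<exists>A B. recurrence_1form \<kappa> A \<and> recurrence_1form \<kappa> B \<and>
        (\<forall>u\<in>slit. \<forall>w x y z. hcov13 \<kappa> D (hcurv \<kappa> D) u w x y z =
           A u w *\<^sub>R hcurv \<kappa> D u x y z + B u w *\<^sub>R Gtensor L u x y z))"

definition generalized_Ricci_recurrent ::
  "('m \<Rightarrow> ('m, real ^ 'n) chart) \<Rightarrow> (('m, 'n::finite) tpoint \<Rightarrow> real) \<Rightarrow> ('m, 'n) connection \<Rightarrow> bool" where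
  "generalized_Ricci_recurrent \<kappa> L D \<longleftrightarrow>
     CARD('n) \<ge> 3 \<and>
     (\<exists>u\<in>slit. \<exists>x z. hRic \<kappa> D u x z \<noteq> 0) \<and>
     (\<exists>A B. recurrence_1form \<kappa> A \<and> recurrence_1form \<kappa> B \<and>
        (\<forall>u\<in>slit. \<forall>w x z. hcov2 \<kappa> D (hRic \<kappa> D) u w x z =
           A u w * hRic \<kappa> D u x z + B u w * fmetric L u x z))"

definition concircularly_recurrent ::
  "('m \<Rightarrow> ('m, real ^ 'n) chart) \<Rightarrow> (('m, 'n::finite) tpoint \<Rightarrow> real) \<Rightarrow> ('m, 'n) connection
     \<Rightarrow> (('m, 'n) tpoint \<Rightarrow> real ^ 'n \<Rightarrow> real) \<Rightarrow> bool" where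
  "concircularly_recurrent \<kappa> L D A \<longleftrightarrow>
     CARD('n) \<ge> 3 \<and>
     (\<exists>u\<in>slit. \<exists>x y z. concircular \<kappa> L D u x y z \<noteq> 0) \<and>
     recurrence_1form \<kappa> A \<and>
     (\<forall>u\<in>slit. \<forall>w x y z. hcov13 \<kappa> D (concircular \<kappa> L D) u w x y z =
        A u w *\<^sub>R concircular \<kappa> L D u x y z)"

definition two_concircularly_recurrent ::
  "('m \<Rightarrow> ('m, real ^ 'n) chart) \<Rightarrow> (('m, 'n::finite) tpoint \<Rightarrow> real) \<Rightarrow> ('m, 'n) connection \<Rightarrow> bool" where
  "two_concircularly_recurrent \<kappa> L D \<longleftrightarrow>
     CARD('n) \<ge> 3 \<and>
     (\<exists>u\<in>slit. \<exists>x y z. concircular \<kappa> L D u x y z \<noteq> 0) \<and>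
     (\<exists>\<alpha>. recurrence_2form \<kappa> \<alpha> \<and>
        (\<forall>u\<in>slit. \<forall>v w x y z.
           hcov_form13 \<kappa> D (hcov13 \<kappa> D (concircular \<kappa> L D)) u v w x y z =
           \<alpha> u v w *\<^sub>R concircular \<kappa> L D u x y z))"

end

theory Submission
  imports Defs
begin

text \<open>
  \<open>C = R - k r G\<close> with \<open>k = 1 / (n (n - 1))\<close>, and \<open>G\<close> is parallel because the connection is metric. So
  \<open>\<nabla>C = A \<otimes> C\<close> gives \<open>\<nabla>\<nabla>C = (\<nabla>A + A \<otimes> A) \<otimes> C\<close>, which is (a), and
  \<open>\<nabla>R = A \<otimes> R + k (\<nabla>r - r A) \<otimes> G\<close>, which together with its trace is (b). If \<open>R(\<cdot>, \<cdot>)\<eta> = 0\<close>, then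
  \<open>C(\<cdot>, \<cdot>)\<eta> = - k r G(\<cdot>, \<cdot>)\<eta>\<close>; since \<open>\<nabla>\<eta> = 0\<close> in horizontal directions, the recurrence of \<open>C\<close> evaluated on
  \<open>\<eta>\<close> forces \<open>\<nabla>r = r A\<close>, which is (c).

  The forms obtained in this way have to be smooth and positively homogeneous of degree 0. For
  the smoothness one needs that \<open>R\<close> is tensorial and that the horizontal lift, being the solution
  of a linear system with smooth coefficients, is smooth. The homogeneity holds because the
  horizontal part of the connection is determined by the metric through the Koszul identity,
  which is invariant under the dilations \<open>y \<mapsto> c y\<close> of the fibres.
\<close>

section \<open>Calculus of smooth maps\<close>

text \<open>A vector at a point is given by its components in the chart chosen for that point, and
  the charts chosen for nearby points are unrelated. So nothing defined pointwise (bracket,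
  curvature, Ricci trace, scalar curvature) is visibly smooth: each is rewritten near a fixed point
  in the chart or frame of that one point, or through its action on functions. Curvature and
  covariant derivatives are moreover defined by chart-constant extensions, so tensoriality must come
  first before they may be evaluated on other fields, such as \<eta> or an extension made at a
  neighbouring point. The Koszul identity does not give the connection at once, because the
  horizontal directions in it depend on the connection. The circle is broken by the argument y:
  first N(y), then N, then the whole connection is recovered. The recurrence classes also demand
  nonzero tensors. If Ric vanished everywhere, so would r, against the proviso of (b); if R vanished
  everywhere, then r and hence C would vanish, against the hypothesis on C.\<close>

lemma Ck_on_subset: "Ck_on k S f \<Longrightarrow> T \<subseteq> S \<Longrightarrow> Ck_on k T f"
  by (induction k arbitrary: f) (auto intro: continuous_on_subset differentiable_on_subset)

lemma Ck_on_cong_open: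
  assumes "open S" "\<And>x. x \<in> S \<Longrightarrow> f x = g x" "Ck_on k S f"
  shows "Ck_on k S g"
  using assms(2,3)
proof (induction k arbitrary: f g)
  case 0
  then show ?case using continuous_on_cong[of S S f g] by simp
next
  case (Suc k)
  have d: "(g has_derivative frechet_derivative f (at x)) (at x)" if "x \<in> S" for x
  proof (rule has_derivative_transform_within_open[OF _ \<open>open S\<close> that Suc.prems(1)])
    show "(f has_derivative frechet_derivative f (at x)) (at x)"
      using Suc.prems(2)[unfolded Ck_on.simps differentiable_on_eq_differentiable_at[OF \<open>open S\<close>]] that
      by (blast intro: frechet_derivative_works[THEN iffD1])
  qed
  have fd: "frechet_derivative g (at x) = frechet_derivative f (at x)" if "x \<in> S" for x
    using frechet_derivative_at[OF d[OF that]] by simp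
  have "Ck_on k S (\<lambda>x. frechet_derivative g (at x) v)" for v
    by (rule Suc.IH[of "\<lambda>x. frechet_derivative f (at x) v"]) (use Suc.prems(2) in \<open>simp_all add: fd\<close>)
  moreover have "g differentiable_on S"
    using d \<open>open S\<close> by (auto simp: differentiable_on_eq_differentiable_at differentiable_def)
  ultimately show ?case by simp
qed

text \<open>\<open>Ck_on\<close> mentions the derivative selected by
  \<open>frechet_derivative\<close>. Uniqueness of derivatives on an open set lets any explicit
  formula replace it, which is how the inductions below insert the sum, product and chain
  rules.\<close>

lemma Ck_on_SucI:
  assumes "open S" "\<And>x. x \<in> S \<Longrightarrow> (f has_derivative f' x) (at x)" "\<And>v. Ck_on k S (\<lambda>x. f' x v)"
  shows "Ck_on (Suc k) S f"
proof -
  have "frechet_derivative f (at x) = f' x" if "x \<in> S" for x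
    using frechet_derivative_at[OF assms(2)[OF that]] by simp
  then have "Ck_on k S (\<lambda>x. frechet_derivative f (at x) v)" for v
    by (intro Ck_on_cong_open[OF assms(1) _ assms(3)[of v]]) simp
  moreover have "f differentiable_on S"
    using assms by (auto simp: differentiable_on_eq_differentiable_at differentiable_def)
  ultimately show ?thesis by simp
qed

lemma Ck_on_SucD: "Ck_on (Suc k) S f \<Longrightarrow> Ck_on k S f"
proof (induction k arbitrary: f)
  case 0
  then show ?case by (simp add: differentiable_imp_continuous_on)
next
  case (Suc k)
  have "f differentiable_on S" "\<And>v. Ck_on (Suc k) S (\<lambda>x. frechet_derivative f (at x) v)"
    using Suc.prems by simp_all
  with Suc.IH show ?case by simp
qed

lemma Ck_on_has_derivative:
  assumes "Ck_on (Suc k) S f" "open S" "x \<in> S"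
  shows "(f has_derivative frechet_derivative f (at x)) (at x)"
  using assms(1)[unfolded Ck_on.simps differentiable_on_eq_differentiable_at[OF assms(2)]] assms(3)
  by (blast intro: frechet_derivative_works[THEN iffD1])

lemma Ck_on_const: "open S \<Longrightarrow> Ck_on k S (\<lambda>x. c)"
proof (induction k arbitrary: c)
  case (Suc k)
  show ?case
    by (rule Ck_on_SucI[where f' = "\<lambda>x v. 0"]) (use Suc in auto)
qed simp

lemma Ck_on_add:
  "open S \<Longrightarrow> Ck_on k S f \<Longrightarrow> Ck_on k S g \<Longrightarrow> Ck_on k S (\<lambda>x. f x + g x)"
proof (induction k arbitrary: f g)
  case 0
  then show ?case by (simp add: continuous_on_add)
next
  case (Suc k)
  show ?case
  proof (rule Ck_on_SucI[where f' = "\<lambda>x v. frechet_derivative f (at x) v + frechet_derivative g (at x) v"])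
    show "Ck_on k S (\<lambda>x. frechet_derivative f (at x) v + frechet_derivative g (at x) v)" for v
      using Suc by auto
  qed (use Suc.prems in \<open>auto intro!: has_derivative_add Ck_on_has_derivative\<close>)
qed

lemma Ck_on_linear:
  assumes "bounded_linear h"
  shows "open S \<Longrightarrow> Ck_on k S f \<Longrightarrow> Ck_on k S (\<lambda>x. h (f x))"
proof (induction k arbitrary: f)
  case 0
  then show ?case using bounded_linear.continuous_on[OF assms] by simp
next
  case (Suc k)
  show ?case
  proof (rule Ck_on_SucI[where f' = "\<lambda>x v. h (frechet_derivative f (at x) v)"])
    show "Ck_on k S (\<lambda>x. h (frechet_derivative f (at x) v))" for v
      using Suc by auto
  qed (use Suc.prems in \<open>auto intro!: bounded_linear.has_derivative[OF assms] Ck_on_has_derivative\<close>)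
qed

lemma Ck_on_bilinear:
  assumes "bounded_bilinear h"
  shows "open S \<Longrightarrow> Ck_on k S f \<Longrightarrow> Ck_on k S g \<Longrightarrow> Ck_on k S (\<lambda>x. h (f x) (g x))"
proof (induction k arbitrary: f g)
  case 0
  then show ?case using bounded_bilinear.continuous_on[OF assms] by simp
next
  case (Suc k)
  show ?case
  proof (rule Ck_on_SucI[where f' = "\<lambda>x v. h (f x) (frechet_derivative g (at x) v) + h (frechet_derivative f (at x) v) (g x)"])
    have "Ck_on k S f" "Ck_on k S g" using Suc.prems by (auto intro: Ck_on_SucD simp del: Ck_on.simps)+
    then show "Ck_on k S (\<lambda>x. h (f x) (frechet_derivative g (at x) v) + h (frechet_derivative f (at x) v) (g x))" for v
      using Suc by (intro Ck_on_add Suc.IH) auto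
  qed (use Suc.prems in \<open>auto intro!: bounded_bilinear.FDERIV[OF assms] Ck_on_has_derivative\<close>)
qed

lemma Ck_on_sum:
  "open S \<Longrightarrow> (\<And>i. i \<in> I \<Longrightarrow> Ck_on k S (f i)) \<Longrightarrow> Ck_on k S (\<lambda>x. \<Sum>i\<in>I. f i x)"
  by (induction I rule: infinite_finite_induct) (auto simp: Ck_on_const Ck_on_add)

lemma frechet_derivative_basis:
  fixes f :: "'a::euclidean_space \<Rightarrow> 'b::real_normed_vector"
  assumes "f differentiable (at x)"
  shows "frechet_derivative f (at x) v = (\<Sum>b\<in>Basis. (v \<bullet> b) *\<^sub>R frechet_derivative f (at x) b)"
proof -
  interpret linear "frechet_derivative f (at x)" by (rule linear_frechet_derivative[OF assms])
  have "frechet_derivative f (at x) v = frechet_derivative f (at x) (\<Sum>b\<in>Basis. (v \<bullet> b) *\<^sub>R b)"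
    by (simp add: euclidean_representation)
  also have "\<dots> = (\<Sum>b\<in>Basis. (v \<bullet> b) *\<^sub>R frechet_derivative f (at x) b)"
    unfolding sum scaleR ..
  finally show ?thesis .
qed

lemma Ck_on_compose:
  fixes f :: "'b::euclidean_space \<Rightarrow> 'c::real_normed_vector" and g :: "'a::real_normed_vector \<Rightarrow> 'b"
  assumes "open S" "open T"
  shows "Ck_on k T f \<Longrightarrow> Ck_on k S g \<Longrightarrow> g ` S \<subseteq> T \<Longrightarrow> Ck_on k S (\<lambda>x. f (g x))"
proof (induction k arbitrary: f)
  case 0
  then show ?case using continuous_on_compose2[of T f S g] by simp
next
  case (Suc k)
  let ?f = "\<lambda>y. frechet_derivative f (at y)" and ?g = "\<lambda>x. frechet_derivative g (at x)"
  have df: "(f has_derivative ?f (g x)) (at (g x))" if "x \<in> S" for x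
    using Suc.prems(3) that by (intro Ck_on_has_derivative[OF Suc.prems(1) assms(2)]) auto
  show ?case
  proof (rule Ck_on_SucI[where f' = "\<lambda>x v. ?f (g x) (?g x v)"])
    fix x assume x: "x \<in> S"
    show "((\<lambda>x. f (g x)) has_derivative (\<lambda>v. ?f (g x) (?g x v))) (at x)"
      by (rule has_derivative_compose[OF Ck_on_has_derivative[OF Suc.prems(2) assms(1) x] df[OF x]])
  next
    fix v
    have 1: "Ck_on k S g" by (rule Ck_on_SucD[OF Suc.prems(2)])
    \<comment> \<open>The direction \<open>?g x v\<close> varies with \<open>x\<close>, while the
      induction hypothesis covers fixed directions only. Expanding it in the basis leaves products
      of scalar components with derivatives in fixed directions.\<close>
    have "Ck_on k S (\<lambda>x. \<Sum>b\<in>Basis. (?g x v \<bullet> b) *\<^sub>R ?f (g x) b)"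
    proof (intro Ck_on_sum Ck_on_bilinear[OF bounded_bilinear_scaleR] assms)
      show "Ck_on k S (\<lambda>x. ?g x v \<bullet> b)" for b
        by (rule Ck_on_linear[OF bounded_linear_inner_left assms(1)]) (use Suc.prems in simp)
      show "Ck_on k S (\<lambda>x. ?f (g x) b)" for b
        by (rule Suc.IH[of "\<lambda>y. ?f y b", OF _ 1 Suc.prems(3)]) (use Suc.prems in simp)
    qed
    then show "Ck_on k S (\<lambda>x. ?f (g x) (?g x v))"
    proof (rule Ck_on_cong_open[OF assms(1), rotated])
      fix x assume "x \<in> S"
      then have "f differentiable at (g x)" using df differentiable_def by blast
      then show "(\<Sum>b\<in>Basis. (?g x v \<bullet> b) *\<^sub>R ?f (g x) b) = ?f (g x) (?g x v)"
        using frechet_derivative_basis[of f "g x" "?g x v"] by simp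
    qed
  qed (rule assms(1))
qed

lemma Ck_on_inverse:
  fixes f :: "'a::real_normed_vector \<Rightarrow> real"
  assumes "open S" "\<And>x. x \<in> S \<Longrightarrow> f x \<noteq> 0"
  shows "Ck_on k S f \<Longrightarrow> Ck_on k S (\<lambda>x. inverse (f x))"
proof (induction k)
  case 0
  then show ?case using assms by (auto intro!: continuous_intros)
next
  case (Suc k)
  let ?f = "\<lambda>y. frechet_derivative f (at y)"
  show ?case
  proof (rule Ck_on_SucI[where f' = "\<lambda>x v. - (inverse (f x) * ?f x v * inverse (f x))"])
    fix v
    \<comment> \<open>The derivative formula contains the reciprocal again, but only to order
      \<open>k\<close>, where the induction hypothesis applies.\<close>
    have 1: "Ck_on k S (\<lambda>x. inverse (f x))" by (rule Suc.IH[OF Ck_on_SucD[OF Suc.prems]])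
    show "Ck_on k S (\<lambda>x. - (inverse (f x) * ?f x v * inverse (f x)))"
      using Suc.prems 1 assms(1)
      by (intro Ck_on_linear[OF bounded_linear_minus[OF bounded_linear_ident]]
          Ck_on_bilinear[OF bounded_bilinear_mult]) auto
    show "((\<lambda>x. inverse (f x)) has_derivative (\<lambda>v. - (inverse (f x) * ?f x v * inverse (f x)))) (at x)"
      if "x \<in> S" for x
      by (rule Deriv.has_derivative_inverse[OF assms(2)[OF that] Ck_on_has_derivative[OF Suc.prems assms(1) that]])
  qed (rule assms(1))
qed

section \<open>Smoothness at a point, a property of germs\<close>

definition smooth_at :: "'a::real_normed_vector \<Rightarrow> ('a \<Rightarrow> 'b::real_normed_vector) \<Rightarrow> bool" where
  "smooth_at x f \<longleftrightarrow> (\<exists>W. open W \<and> x \<in> W \<and> smooth_on W f)"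

lemma smooth_atI: "open S \<Longrightarrow> x \<in> S \<Longrightarrow> (\<And>k. Ck_on k S f) \<Longrightarrow> smooth_at x f"
  unfolding smooth_at_def smooth_on_def by blast

lemma smooth_on_subset: "smooth_on S f \<Longrightarrow> T \<subseteq> S \<Longrightarrow> smooth_on T f"
  unfolding smooth_on_def using Ck_on_subset by blast

lemma smooth_at_common:
  assumes "smooth_at x f" "smooth_at x g"
  obtains W where "open W" "x \<in> W" "smooth_on W f" "smooth_on W g"
proof -
  obtain V W where "open V" "x \<in> V" "smooth_on V f" "open W" "x \<in> W" "smooth_on W g"
    using assms unfolding smooth_at_def by blast
  then show ?thesis by (intro that[of "V \<inter> W"]) (auto intro: smooth_on_subset)
qed

lemma smooth_at_cong:
  assumes "eventually (\<lambda>y. f y = g y) (nhds x)"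
  shows "smooth_at x f \<longleftrightarrow> smooth_at x g"
proof -
  have "smooth_at x g" if f: "smooth_at x f" and fg: "eventually (\<lambda>y. f y = g y) (nhds x)" for f g :: "'a \<Rightarrow> 'b"
  proof -
    obtain U where U: "open U" "x \<in> U" "\<And>y. y \<in> U \<Longrightarrow> f y = g y"
      using fg unfolding eventually_nhds by auto
    obtain W where W: "open W" "x \<in> W" "smooth_on W f"
      using f unfolding smooth_at_def by auto
    have "smooth_on (U \<inter> W) g"
      unfolding smooth_on_def
    proof
      fix k
      have "Ck_on k (U \<inter> W) f" using W Ck_on_subset[of k W f "U \<inter> W"] unfolding smooth_on_def by auto
      then show "Ck_on k (U \<inter> W) g"
        by (rule Ck_on_cong_open[rotated -1]) (use U W in auto)
    qed
    with U W show ?thesis unfolding smooth_at_def by (intro exI[of _ "U \<inter> W"]) auto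
  qed
  with assms show ?thesis by (metis (mono_tags, lifting) eventually_mono)
qed

lemmas smooth_at_eq = smooth_at_cong[THEN iffD1]

lemma smooth_at_eventually: "smooth_at x f \<Longrightarrow> eventually (\<lambda>y. smooth_at y f) (nhds x)"
  unfolding smooth_at_def eventually_nhds by blast

lemma smooth_at_differentiable: "smooth_at x f \<Longrightarrow> f differentiable (at x)"
  unfolding smooth_at_def smooth_on_def
  by (metis Ck_on.simps(2) differentiable_on_eq_differentiable_at)

lemma smooth_at_has_derivative:
  "smooth_at x f \<Longrightarrow> (f has_derivative frechet_derivative f (at x)) (at x)"
  using smooth_at_differentiable frechet_derivative_works by blast

lemma smooth_at_isCont: "smooth_at x f \<Longrightarrow> isCont f x"
  using smooth_at_differentiable differentiable_imp_continuous_within by blast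

lemma continuous_at_nhds_iff: "isCont f x \<longleftrightarrow> (f \<longlongrightarrow> f x) (nhds x)"
  unfolding isCont_def by (simp add: tendsto_at_iff_tendsto_nhds)

lemma smooth_at_const [simp, intro]: "smooth_at x (\<lambda>y. c)"
  unfolding smooth_at_def smooth_on_def by (intro exI[of _ UNIV]) (auto simp: Ck_on_const)

lemma smooth_at_linear:
  assumes "bounded_linear h" "smooth_at x f"
  shows "smooth_at x (\<lambda>y. h (f y))"
  using assms(2) Ck_on_linear[OF assms(1)] unfolding smooth_at_def smooth_on_def by blast

lemma smooth_at_ident [simp, intro]: "smooth_at x (\<lambda>y. y)"
proof -
  have "Ck_on k UNIV (\<lambda>y::'a. y)" for k
    by (cases k) (auto simp: Ck_on_const)
  then show ?thesis unfolding smooth_at_def smooth_on_def by (intro exI[of _ UNIV]) auto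
qed

lemma smooth_at_bounded_linear: "bounded_linear h \<Longrightarrow> smooth_at x h"
  using smooth_at_linear[of h x "\<lambda>y. y"] by simp

lemma smooth_at_bilinear:
  assumes "bounded_bilinear h" "smooth_at x f" "smooth_at x g"
  shows "smooth_at x (\<lambda>y. h (f y) (g y))"
proof (rule smooth_at_common[OF assms(2,3)])
  fix W assume "open W" "x \<in> W" "smooth_on W f" "smooth_on W g"
  then show ?thesis using Ck_on_bilinear[OF assms(1), of W _ f g] by (auto intro!: smooth_atI simp: smooth_on_def)
qed

lemma smooth_at_add: 
  assumes "smooth_at x f" "smooth_at x g" shows "smooth_at x (\<lambda>y. f y + g y)"
proof (rule smooth_at_common[OF assms])
  fix W assume "open W" "x \<in> W" "smooth_on W f" "smooth_on W g"
  then show ?thesis using Ck_on_add[of W _ f g] by (auto intro!: smooth_atI simp: smooth_on_def)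
qed

lemma smooth_at_minus: "smooth_at x f \<Longrightarrow> smooth_at x (\<lambda>y. - f y)"
  using smooth_at_linear[OF bounded_linear_minus[OF bounded_linear_ident]] .

lemma smooth_at_diff: "smooth_at x f \<Longrightarrow> smooth_at x g \<Longrightarrow> smooth_at x (\<lambda>y. f y - g y)"
  using smooth_at_add[OF _ smooth_at_minus, of x f g] by simp

lemmas smooth_at_scaleR = smooth_at_bilinear[OF bounded_bilinear_scaleR]
lemmas smooth_at_mult = smooth_at_bilinear[OF bounded_bilinear_mult]

lemma smooth_at_sum:
  "(\<And>i. i \<in> I \<Longrightarrow> smooth_at x (f i)) \<Longrightarrow> smooth_at x (\<lambda>y. \<Sum>i\<in>I. f i y)"
  by (induction I rule: infinite_finite_induct) (auto intro: smooth_at_add)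

lemma smooth_at_prod:
  fixes f :: "'i \<Rightarrow> 'a::real_normed_vector \<Rightarrow> real"
  shows "(\<And>i. i \<in> I \<Longrightarrow> smooth_at x (f i)) \<Longrightarrow> smooth_at x (\<lambda>y. \<Prod>i\<in>I. f i y)"
  by (induction I rule: infinite_finite_induct) (auto intro: smooth_at_mult)

lemma smooth_at_compose:
  fixes f :: "'b::euclidean_space \<Rightarrow> 'c::real_normed_vector" and g :: "'a::real_normed_vector \<Rightarrow> 'b"
  assumes "smooth_at (g x) f" "smooth_at x g"
  shows "smooth_at x (\<lambda>y. f (g y))"
proof -
  obtain T where T: "open T" "g x \<in> T" "smooth_on T f"
    using assms(1) unfolding smooth_at_def by auto
  obtain S where S: "open S" "x \<in> S" "smooth_on S g"
    using assms(2) unfolding smooth_at_def by auto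
  have c: "continuous_on S g" using S unfolding smooth_on_def by (metis Ck_on.simps(1))
  let ?V = "S \<inter> g -` T"
  have o: "open ?V" using continuous_open_preimage[OF c] S T by blast
  have "Ck_on k ?V (\<lambda>y. f (g y))" for k
  proof (rule Ck_on_compose[OF o \<open>open T\<close>])
    show "Ck_on k T f" using T unfolding smooth_on_def by blast
    show "Ck_on k ?V g" using S Ck_on_subset[of k S g ?V] unfolding smooth_on_def by blast
  qed auto
  then show ?thesis using S T by (intro smooth_atI[OF o]) auto
qed

lemma smooth_at_inverse:
  fixes f :: "'a::real_normed_vector \<Rightarrow> real"
  assumes "smooth_at x f" "f x \<noteq> 0"
  shows "smooth_at x (\<lambda>y. inverse (f y))"
proof -
  obtain S where S: "open S" "x \<in> S" "smooth_on S f"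
    using assms(1) unfolding smooth_at_def by auto
  have c: "continuous_on S f" using S unfolding smooth_on_def by (metis Ck_on.simps(1))
  let ?V = "S \<inter> f -` (- {0})"
  have o: "open ?V" using continuous_open_preimage[OF c] S by blast
  have "Ck_on k ?V (\<lambda>y. inverse (f y))" for k
  proof (rule Ck_on_inverse[OF o])
    show "Ck_on k ?V f" using S Ck_on_subset[of k S f ?V] unfolding smooth_on_def by blast
  qed auto
  then show ?thesis using S assms(2) by (intro smooth_atI[OF o]) auto
qed

lemma smooth_at_euclidean:
  fixes f :: "'a::real_normed_vector \<Rightarrow> 'b::euclidean_space"
  assumes "\<And>b. b \<in> Basis \<Longrightarrow> smooth_at x (\<lambda>y. f y \<bullet> b)"
  shows "smooth_at x f"
proof -
  have "smooth_at x (\<lambda>y. \<Sum>b\<in>Basis. (f y \<bullet> b) *\<^sub>R b)"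
    using assms by (intro smooth_at_sum smooth_at_scaleR) auto
  then show ?thesis by (simp add: euclidean_representation)
qed

lemma smooth_at_nth: "smooth_at x f \<Longrightarrow> smooth_at x (\<lambda>y. f y $ i)"
  using smooth_at_linear[OF bounded_linear_vec_nth] .

lemma smooth_at_vec:
  fixes f :: "'a::real_normed_vector \<Rightarrow> 'b::euclidean_space ^ 'n"
  assumes "\<And>i. smooth_at x (\<lambda>y. f y $ i)"
  shows "smooth_at x f"
proof (rule smooth_at_euclidean)
  fix b :: "'b ^ 'n" assume "b \<in> Basis"
  then obtain i u where "b = axis i u" unfolding Basis_vec_def by auto
  then show "smooth_at x (\<lambda>y. f y \<bullet> b)"
    using smooth_at_linear[OF bounded_linear_inner_left assms[of i], of u] by (simp add: inner_axis)
qed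

lemma smooth_at_Pair:
  fixes f :: "'a::real_normed_vector \<Rightarrow> 'b::real_normed_vector" and g :: "'a \<Rightarrow> 'c::real_normed_vector"
  assumes "smooth_at x f" "smooth_at x g"
  shows "smooth_at x (\<lambda>y. (f y, g y))"
proof -
  have "smooth_at x (\<lambda>y. (f y, 0) + (0, g y))"
    using assms
    by (intro smooth_at_add smooth_at_linear[of "\<lambda>z. (z, 0)"] smooth_at_linear[of "\<lambda>z. (0, z)"])
       (auto intro!: bounded_linear_Pair bounded_linear_zero bounded_linear_ident)
  then show ?thesis by simp
qed

text \<open>The direction must be allowed to vary, since a vector field acting on a function has
  this form in a chart. The basis expansion again reduces the claim to fixed directions.\<close>

lemma smooth_at_frechet_derivative:
  fixes f :: "'a::euclidean_space \<Rightarrow> 'b::real_normed_vector"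
  assumes "smooth_at x f" "smooth_at x V"
  shows "smooth_at x (\<lambda>y. frechet_derivative f (at y) (V y))"
proof -
  obtain W where W: "open W" "x \<in> W" "smooth_on W f" using assms unfolding smooth_at_def by auto
  have "smooth_at x (\<lambda>y. frechet_derivative f (at y) v)" for v
  proof (rule smooth_atI[OF W(1,2)])
    have "Ck_on (Suc k) W f" for k using W(3) unfolding smooth_on_def by blast
    then show "Ck_on k W (\<lambda>y. frechet_derivative f (at y) v)" for k by simp
  qed
  then have "smooth_at x (\<lambda>y. \<Sum>b\<in>Basis. (V y \<bullet> b) *\<^sub>R frechet_derivative f (at y) b)"
    by (intro smooth_at_sum smooth_at_scaleR smooth_at_linear[OF bounded_linear_inner_left assms(2)])
  moreover have "eventually (\<lambda>y. (\<Sum>b\<in>Basis. (V y \<bullet> b) *\<^sub>R frechet_derivative f (at y) b)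
      = frechet_derivative f (at y) (V y)) (nhds x)"
    using smooth_at_eventually[OF assms(1)]
  proof eventually_elim
    case (elim y)
    show ?case by (simp add: frechet_derivative_basis[OF smooth_at_differentiable[OF elim], symmetric])
  qed
  ultimately show ?thesis by (rule smooth_at_eq[rotated])
qed

lemma smooth_at_det:
  fixes A :: "'a::real_normed_vector \<Rightarrow> real ^ 'n ^ 'n"
  assumes "\<And>i j. smooth_at x (\<lambda>y. A y $ i $ j)"
  shows "smooth_at x (\<lambda>y. det (A y))"
  unfolding det_def using assms
  by (intro smooth_at_sum smooth_at_mult smooth_at_prod) auto

lemma matrix_inv_left_right:
  fixes A :: "real ^ 'n ^ 'n"
  assumes "det A \<noteq> 0"
  shows "A ** matrix_inv A = mat 1" "matrix_inv A ** A = mat 1"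
proof -
  have "\<exists>B. A ** B = mat 1 \<and> B ** A = mat 1"
    using assms invertible_det_nz[of A] unfolding invertible_def by blast
  then show "A ** matrix_inv A = mat 1" "matrix_inv A ** A = mat 1"
    unfolding matrix_inv_def by (metis (mono_tags, lifting) someI_ex)+
qed

text \<open>Cramer's rule, applied to the equation solved by column \<open>l\<close> of the inverse,
  writes each entry as a quotient of determinants with smooth entries. The determinant stays nonzero
  near \<open>x\<close> by continuity.\<close>

lemma smooth_at_matrix_inv:
  fixes A :: "'a::real_normed_vector \<Rightarrow> real ^ 'n ^ 'n"
  assumes "smooth_at x A" "det (A x) \<noteq> 0"
  shows "smooth_at x (\<lambda>y. matrix_inv (A y))"
proof -
  have e: "smooth_at x (\<lambda>y. A y $ i $ j)" for i j
    by (intro smooth_at_nth assms)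
  have d: "smooth_at x (\<lambda>y. det (A y))" by (rule smooth_at_det[OF e])
  have "eventually (\<lambda>y. det (A y) \<noteq> 0) (nhds x)"
    using topological_tendstoD[OF smooth_at_isCont[OF d, unfolded continuous_at_nhds_iff], of "- {0}"] assms(2)
    by auto
  note ev = this
  have "smooth_at x (\<lambda>y. matrix_inv (A y) $ k $ l)" for k l
  proof -
    let ?c = "\<lambda>y. det (\<chi> i j. if j = k then axis l 1 $ i else A y $ i $ j) * inverse (det (A y))"
    have "smooth_at x (\<lambda>y. if j = k then axis l 1 $ i else A y $ i $ j)" for i j
      by (cases "j = k") (simp_all add: e)
    note e' = this
    have "smooth_at x ?c"
      by (intro smooth_at_mult smooth_at_inverse smooth_at_det d assms) (simp_all add: e')
    moreover have "eventually (\<lambda>y. ?c y = matrix_inv (A y) $ k $ l) (nhds x)"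
      using ev
    proof eventually_elim
      case (elim y)
      have "A y *v (matrix_inv (A y) *v axis l 1) = axis l 1"
        by (simp add: matrix_vector_mul_assoc matrix_inv_left_right[OF elim])
      from this[unfolded cramer[OF elim]]
      have "(matrix_inv (A y) *v axis l 1) $ k = ?c y" by (simp add: divide_inverse)
      then show ?case by (simp add: matrix_vector_mul_component inner_axis' row_def inner_axis)
    qed
    ultimately show ?thesis by (rule smooth_at_eq[rotated])
  qed
  then show ?thesis by (intro smooth_at_vec) auto
qed

text \<open>Both mixed derivatives are the limit of the same second difference quotient.\<close>

lemma second_difference_limit:
  fixes f :: "'a::euclidean_space \<Rightarrow> real"
  assumes "smooth_at x f"
  shows "((\<lambda>t. (f (x + t *\<^sub>R v + t *\<^sub>R w) - f (x + t *\<^sub>R v) - f (x + t *\<^sub>R w) + f x) / t\<^sup>2)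
    \<longlongrightarrow> frechet_derivative (\<lambda>y. frechet_derivative f (at y) v) (at x) w) (at_right 0)"
proof -
  let ?f = "\<lambda>y. frechet_derivative f (at y) v"
  let ?ff = "\<lambda>y. frechet_derivative ?f (at y) w"
  have sm1: "smooth_at y ?f" if "smooth_at y f" for y
    using that by (intro smooth_at_frechet_derivative) auto
  have "isCont ?ff x"
    by (rule smooth_at_isCont[OF smooth_at_frechet_derivative[OF sm1[OF assms] smooth_at_const]])
  show ?thesis
  proof (rule tendstoI)
    fix e :: real assume "e > 0"
    have "eventually (\<lambda>y. dist (?ff y) (?ff x) < e) (nhds x)"
      using tendstoD[OF \<open>isCont ?ff x\<close>[unfolded continuous_at_nhds_iff] \<open>e > 0\<close>] .
    with smooth_at_eventually[OF assms]
    have "eventually (\<lambda>y. smooth_at y f \<and> dist (?ff y) (?ff x) < e) (nhds x)"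
      by eventually_elim auto
    then obtain d where d: "d > 0" "\<And>y. dist y x < d \<Longrightarrow> smooth_at y f \<and> dist (?ff y) (?ff x) < e"
      unfolding eventually_nhds_metric by auto
    \<comment> \<open>The summand 1 keeps \<open>K\<close> positive even if \<open>v\<close> and
      \<open>w\<close> both vanish. For \<open>t < d / K\<close> the whole parallelogram spanned by
      \<open>t *\<^sub>R v\<close> and \<open>t *\<^sub>R w\<close> at \<open>x\<close> lies in the
      ball of radius \<open>d\<close>.\<close>
    define K where "K = norm v + norm w + 1"
    have K: "K > 0" unfolding K_def by (smt (verit) norm_ge_zero)
    have "eventually (\<lambda>t::real. t < d / K) (at_right 0)"
      using d K by (intro eventually_at_rightI[of 0 "d / K"]) auto
    moreover have "eventually (\<lambda>t::real. t > 0) (at_right 0)" by (rule eventually_at_right_less)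
    ultimately show "eventually (\<lambda>t. dist ((f (x + t *\<^sub>R v + t *\<^sub>R w) - f (x + t *\<^sub>R v) - f (x + t *\<^sub>R w) + f x) / t\<^sup>2) (?ff x) < e) (at_right 0)"
    proof eventually_elim
      case (elim t)
      have near: "smooth_at (x + a *\<^sub>R v + b *\<^sub>R w) f \<and> dist (?ff (x + a *\<^sub>R v + b *\<^sub>R w)) (?ff x) < e"
        if "0 \<le> a" "a \<le> t" "0 \<le> b" "b \<le> t" for a b
      proof (rule d)
        have "norm (a *\<^sub>R v + b *\<^sub>R w) \<le> a * norm v + b * norm w"
          using norm_triangle_ineq[of "a *\<^sub>R v" "b *\<^sub>R w"] that by simp
        also have "\<dots> \<le> t * norm v + t * norm w" using that by (intro add_mono mult_right_mono) auto
        also have "\<dots> < t * K" using elim unfolding K_def by (simp add: algebra_simps)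
        also have "\<dots> < d" using elim K by (simp add: field_simps)
        finally show "dist (x + a *\<^sub>R v + b *\<^sub>R w) x < d" by (simp add: dist_norm algebra_simps)
      qed
      have D: "((\<lambda>a. g (y + a *\<^sub>R z)) has_real_derivative frechet_derivative g (at (y + a *\<^sub>R z)) z) (at a)"
        if "smooth_at (y + a *\<^sub>R z) g" for g :: "'a \<Rightarrow> real" and y z a
      proof -
        have 1: "(g has_derivative frechet_derivative g (at (y + a *\<^sub>R z))) (at (y + a *\<^sub>R z))"
          using smooth_at_has_derivative[OF that] .
        have "((\<lambda>a. g (y + a *\<^sub>R z)) has_derivative (\<lambda>h. frechet_derivative g (at (y + a *\<^sub>R z)) (h *\<^sub>R z))) (at a)"
        proof (rule has_derivative_compose[of "\<lambda>a. y + a *\<^sub>R z" "\<lambda>h. h *\<^sub>R z" a UNIV g, OF _ 1])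
          show "((\<lambda>a. y + a *\<^sub>R z) has_derivative (\<lambda>h. h *\<^sub>R z)) (at a)"
            by (auto intro!: derivative_eq_intros)
        qed
        moreover have "linear (frechet_derivative g (at (y + a *\<^sub>R z)))"
          using 1 by (simp add: has_derivative_linear)
        ultimately show ?thesis
          by (simp add: has_field_derivative_def linear.scaleR mult_commute_abs)
      qed
      \<comment> \<open>\<open>?p\<close> is the difference of \<open>f\<close> across the side
        \<open>t *\<^sub>R w\<close>. The mean value theorem along \<open>v\<close>, then along
        \<open>w\<close>, turns the second difference into exactly \<open>t\<^sup>2\<close> times
        the mixed derivative at an interior point.\<close>
      let ?p = "\<lambda>a. f (x + t *\<^sub>R w + a *\<^sub>R v) - f (x + a *\<^sub>R v)"
      have "\<exists>a>0. a < t \<and> ?p t - ?p 0 = (t - 0) * (?f (x + t *\<^sub>R w + a *\<^sub>R v) - ?f (x + a *\<^sub>R v))"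
      proof (rule MVT2)
        fix a assume "0 \<le> a" "a \<le> t"
        then show "(?p has_real_derivative ?f (x + t *\<^sub>R w + a *\<^sub>R v) - ?f (x + a *\<^sub>R v)) (at a)"
          using near[of a t] near[of a 0] elim
          by (intro DERIV_diff D) (auto simp: algebra_simps)
      qed (use elim in auto)
      then obtain a where a: "0 < a" "a < t" "?p t - ?p 0 = t * (?f (x + t *\<^sub>R w + a *\<^sub>R v) - ?f (x + a *\<^sub>R v))"
        by auto
      let ?q = "\<lambda>b. ?f (x + a *\<^sub>R v + b *\<^sub>R w)"
      have "\<exists>b>0. b < t \<and> ?q t - ?q 0 = (t - 0) * ?ff (x + a *\<^sub>R v + b *\<^sub>R w)"
      proof (rule MVT2)
        fix b assume "0 \<le> b" "b \<le> t"
        then show "(?q has_real_derivative ?ff (x + a *\<^sub>R v + b *\<^sub>R w)) (at b)"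
          using near[of a b] a by (intro D[of "x + a *\<^sub>R v" b w ?f] sm1) auto
      qed (use elim in auto)
      then obtain b where b: "0 < b" "b < t" "?q t - ?q 0 = t * ?ff (x + a *\<^sub>R v + b *\<^sub>R w)" by auto
      have "f (x + t *\<^sub>R v + t *\<^sub>R w) - f (x + t *\<^sub>R v) - f (x + t *\<^sub>R w) + f x = ?p t - ?p 0"
        by (simp add: algebra_simps)
      also have "\<dots> = t * (?q t - ?q 0)" unfolding a(3) by (simp add: algebra_simps)
      also have "\<dots> = t\<^sup>2 * ?ff (x + a *\<^sub>R v + b *\<^sub>R w)" unfolding b(3) by (simp add: power2_eq_square)
      finally show ?case using near[of a b] a b elim by simp
    qed
  qed
qed

lemma symmetric_second_derivative:
  fixes f :: "'a::euclidean_space \<Rightarrow> real"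
  assumes "smooth_at x f"
  shows "frechet_derivative (\<lambda>y. frechet_derivative f (at y) v) (at x) w
       = frechet_derivative (\<lambda>y. frechet_derivative f (at y) w) (at x) v"
proof (rule tendsto_unique[OF _ second_difference_limit[OF assms]])
  show "((\<lambda>t. (f (x + t *\<^sub>R v + t *\<^sub>R w) - f (x + t *\<^sub>R v) - f (x + t *\<^sub>R w) + f x) / t\<^sup>2)
    \<longlongrightarrow> frechet_derivative (\<lambda>y. frechet_derivative f (at y) w) (at x) v) (at_right 0)"
    using second_difference_limit[OF assms, of w v] by (simp add: algebra_simps)
qed simp

section \<open>Differentiation rules for maps smooth at a point\<close>

lemma frechet_derivative_cong:
  assumes "eventually (\<lambda>y. f y = g y) (nhds x)"
  shows "frechet_derivative f (at x) = frechet_derivative g (at x)"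
proof -
  obtain U where U: "open U" "x \<in> U" "\<And>y. y \<in> U \<Longrightarrow> f y = g y"
    using assms unfolding eventually_nhds by auto
  have "(f has_derivative f') (at x) \<longleftrightarrow> (g has_derivative f') (at x)" for f'
    using U has_derivative_transform_within_open[of f f' x UNIV U g]
      has_derivative_transform_within_open[of g f' x UNIV U f] by auto
  then show ?thesis unfolding frechet_derivative_def by simp
qed

lemma frechet_derivative_eqI: "(f has_derivative f') (at x) \<Longrightarrow> frechet_derivative f (at x) = f'"
  using frechet_derivative_at by metis

lemma frechet_derivative_chain:
  assumes "smooth_at (g x) f" "smooth_at x g"
  shows "frechet_derivative (\<lambda>y. f (g y)) (at x) v
    = frechet_derivative f (at (g x)) (frechet_derivative g (at x) v)"
  using frechet_derivative_compose[OF smooth_at_differentiable[OF assms(2)] smooth_at_differentiable[OF assms(1)]]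
  by (simp add: o_def fun_eq_iff)

lemma frechet_derivative_plus:
  assumes "smooth_at x f" "smooth_at x g"
  shows "frechet_derivative (\<lambda>y. f y + g y) (at x) v
    = frechet_derivative f (at x) v + frechet_derivative g (at x) v"
  using frechet_derivative_eqI[OF has_derivative_add[OF assms[THEN smooth_at_has_derivative]]] by simp

lemma frechet_derivative_lin:
  assumes "bounded_linear h" "smooth_at x f"
  shows "frechet_derivative (\<lambda>y. h (f y)) (at x) v = h (frechet_derivative f (at x) v)"
  using frechet_derivative_eqI[OF bounded_linear.has_derivative[OF assms(1) smooth_at_has_derivative[OF assms(2)]]]
  by simp

lemma frechet_derivative_bounded_linear: "bounded_linear h \<Longrightarrow> frechet_derivative h (at x) v = h v"
  using frechet_derivative_lin[of h x "\<lambda>y. y" v] by simp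

lemma frechet_derivative_bilin:
  assumes "bounded_bilinear h" "smooth_at x f" "smooth_at x g"
  shows "frechet_derivative (\<lambda>y. h (f y) (g y)) (at x) v
    = h (f x) (frechet_derivative g (at x) v) + h (frechet_derivative f (at x) v) (g x)"
  using frechet_derivative_eqI[OF bounded_bilinear.FDERIV[OF assms(1) assms(2,3)[THEN smooth_at_has_derivative]]]
  by simp

lemma frechet_derivative_sum:
  assumes "\<And>i. i \<in> I \<Longrightarrow> smooth_at x (f i)"
  shows "frechet_derivative (\<lambda>y. \<Sum>i\<in>I. f i y) (at x) v = (\<Sum>i\<in>I. frechet_derivative (f i) (at x) v)"
  using assms
  by (induction I rule: infinite_finite_induct)
     (simp_all add: frechet_derivative_plus smooth_at_sum)

lemma linear_frechet_smooth_at: "smooth_at x f \<Longrightarrow> linear (frechet_derivative f (at x))"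
  by (rule linear_frechet_derivative[OF smooth_at_differentiable])

text \<open>The product rule separates a second derivative with frozen direction from the derivative
  of the direction. The first part is symmetric and cancels in a commutator; the second is what the
  Lie bracket consists of.\<close>

lemma frechet_derivative_along:
  fixes f :: "'a::euclidean_space \<Rightarrow> 'b::real_normed_vector"
  assumes f: "smooth_at x f" and V: "smooth_at x V"
  shows "frechet_derivative (\<lambda>y. frechet_derivative f (at y) (V y)) (at x) w
    = frechet_derivative (\<lambda>y. frechet_derivative f (at y) (V x)) (at x) w
      + frechet_derivative f (at x) (frechet_derivative V (at x) w)"
proof -
  have s: "smooth_at x (\<lambda>y. frechet_derivative f (at y) b)" for b
    by (rule smooth_at_frechet_derivative[OF f smooth_at_const])
  have Vb: "smooth_at x (\<lambda>y. V y \<bullet> b)" for b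
    by (rule smooth_at_linear[OF bounded_linear_inner_left V])
  \<comment> \<open>Stated for every field \<open>U\<close> so that it serves both \<open>V\<close>
    and the constant field \<open>V x\<close>: the first sums agree, and the second one vanishes for
    the constant field.\<close>
  have key: "frechet_derivative (\<lambda>y. frechet_derivative f (at y) (U y)) (at x) w
    = (\<Sum>b\<in>Basis. (U x \<bullet> b) *\<^sub>R frechet_derivative (\<lambda>y. frechet_derivative f (at y) b) (at x) w)
      + (\<Sum>b\<in>Basis. (frechet_derivative U (at x) w \<bullet> b) *\<^sub>R frechet_derivative f (at x) b)"
    if U: "smooth_at x U" for U
  proof -
    have Ub: "smooth_at x (\<lambda>y. U y \<bullet> b)" for b
      by (rule smooth_at_linear[OF bounded_linear_inner_left U])
    have "eventually (\<lambda>y. frechet_derivative f (at y) (U y)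
        = (\<Sum>b\<in>Basis. (U y \<bullet> b) *\<^sub>R frechet_derivative f (at y) b)) (nhds x)"
      using smooth_at_eventually[OF f]
      by eventually_elim (rule frechet_derivative_basis[OF smooth_at_differentiable])
    note e = frechet_derivative_cong[OF this]
    have "frechet_derivative (\<lambda>y. \<Sum>b\<in>Basis. (U y \<bullet> b) *\<^sub>R frechet_derivative f (at y) b) (at x) w
      = (\<Sum>b\<in>Basis. frechet_derivative (\<lambda>y. (U y \<bullet> b) *\<^sub>R frechet_derivative f (at y) b) (at x) w)"
      by (rule frechet_derivative_sum[OF smooth_at_scaleR[OF Ub s]])
    also have "\<dots> = (\<Sum>b\<in>Basis. (U x \<bullet> b) *\<^sub>R frechet_derivative (\<lambda>y. frechet_derivative f (at y) b) (at x) w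
        + (frechet_derivative U (at x) w \<bullet> b) *\<^sub>R frechet_derivative f (at x) b)"
      by (simp add: frechet_derivative_bilin[OF bounded_bilinear_scaleR Ub s]
          frechet_derivative_lin[OF bounded_linear_inner_left U])
    finally show ?thesis by (simp add: e sum.distrib)
  qed
  show ?thesis
    unfolding key[OF V] key[OF smooth_at_const[of x "V x"]]
    by (simp add: frechet_derivative_basis[OF smooth_at_differentiable[OF f], of "frechet_derivative V (at x) w", symmetric])
qed

section \<open>Manifolds presented by a family of charts\<close>

text \<open>The carrier \<open>S\<close> is \<open>UNIV\<close> for the base manifold and \<open>slit\<close> for the slit tangent bundle.\<close>

locale atlas =
  fixes S :: "'p set" and \<kappa> :: "'p \<Rightarrow> ('p, 'e::euclidean_space) chart"
  assumes mem: "p \<in> S \<Longrightarrow> p \<in> cdom (\<kappa> p)"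
    and sub: "p \<in> S \<Longrightarrow> cdom (\<kappa> p) \<subseteq> S"
    and inj: "p \<in> S \<Longrightarrow> inj_on (cmap (\<kappa> p)) (cdom (\<kappa> p))"
    and open_overlap: "p \<in> S \<Longrightarrow> q \<in> S \<Longrightarrow> open (cmap (\<kappa> p) ` (cdom (\<kappa> p) \<inter> cdom (\<kappa> q)))"
    and smooth_overlap: "p \<in> S \<Longrightarrow> q \<in> S \<Longrightarrow>
      smooth_on (cmap (\<kappa> p) ` (cdom (\<kappa> p) \<inter> cdom (\<kappa> q))) (cmap (\<kappa> q) \<circ> cinv (\<kappa> p))"
begin

abbreviation co :: "'p \<Rightarrow> 'p \<Rightarrow> 'e" where "co p \<equiv> cmap (\<kappa> p)"
abbreviation ci :: "'p \<Rightarrow> 'e \<Rightarrow> 'p" where "ci p \<equiv> cinv (\<kappa> p)"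
abbreviation dom :: "'p \<Rightarrow> 'p set" where "dom p \<equiv> cdom (\<kappa> p)"
abbreviation tr :: "'p \<Rightarrow> 'p \<Rightarrow> 'e \<Rightarrow> 'e" where "tr p q \<equiv> (\<lambda>x. co q (ci p x))"
abbreviation tc :: "'p \<Rightarrow> 'p \<Rightarrow> 'e \<Rightarrow> 'e" where "tc p q \<equiv> tcomp \<kappa> (\<kappa> p) q"
abbreviation smn :: "'p \<Rightarrow> ('p \<Rightarrow> 'b::real_normed_vector) \<Rightarrow> bool" where "smn \<equiv> smooth_near \<kappa>"

text \<open>Neighbourhoods are transported from the model space because the topology meant is that
  of the charts; on the slit tangent bundle it is not the topology carried by the type.\<close>

definition nb :: "'p \<Rightarrow> 'p filter" where
  "nb p = filtermap (ci p) (nhds (co p p))"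

lemma dom_S: "p \<in> S \<Longrightarrow> q \<in> dom p \<Longrightarrow> q \<in> S"
  using sub by blast

lemma ci_co: "p \<in> S \<Longrightarrow> q \<in> dom p \<Longrightarrow> ci p (co p q) = q"
  unfolding cinv_def by (rule inv_into_f_f[OF inj])

lemma co_ci: "x \<in> cran (\<kappa> p) \<Longrightarrow> co p (ci p x) = x"
  and ci_dom: "x \<in> cran (\<kappa> p) \<Longrightarrow> ci p x \<in> dom p"
  unfolding cinv_def cran_def by (auto intro: f_inv_into_f inv_into_into)

lemma open_cran: "p \<in> S \<Longrightarrow> open (cran (\<kappa> p))"
  using open_overlap[of p p] unfolding cran_def by simp

lemma co_cran: "q \<in> dom p \<Longrightarrow> co p q \<in> cran (\<kappa> p)"
  unfolding cran_def by blast

lemma ev_chart: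
  assumes "p \<in> S" "q \<in> dom p"
  shows "eventually (\<lambda>x. x \<in> cran (\<kappa> p) \<and> ci p x \<in> dom p \<and> co p (ci p x) = x) (nhds (co p q))"
  using open_cran[OF assms(1)] co_cran[OF assms(2)] co_ci ci_dom
  unfolding eventually_nhds by blast

lemma tr_smooth:
  assumes "p \<in> S" "q \<in> S" "r \<in> dom p" "r \<in> dom q"
  shows "smooth_at (co p r) (tr p q)"
  unfolding smooth_at_def
  using open_overlap[OF assms(1,2)] smooth_overlap[OF assms(1,2)] assms(3,4)
  by (intro exI[of _ "cmap (\<kappa> p) ` (cdom (\<kappa> p) \<inter> cdom (\<kappa> q))"]) (auto simp: o_def)

lemma tr_tendsto:
  assumes "p \<in> S" "q \<in> S" "r \<in> dom p" "r \<in> dom q"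
  shows "filterlim (tr p q) (nhds (co q r)) (nhds (co p r))"
  using smooth_at_isCont[OF tr_smooth[OF assms]] ci_co[OF assms(1,3)]
  unfolding continuous_at_nhds_iff by simp

lemma ev_overlap:
  assumes "p \<in> S" "q \<in> S" "r \<in> dom p" "r \<in> dom q"
  shows "eventually (\<lambda>x. ci p x \<in> dom p \<and> ci p x \<in> dom q \<and> ci q (tr p q x) = ci p x) (nhds (co p r))"
proof -
  have "ci p x \<in> dom p \<and> ci p x \<in> dom q \<and> ci q (tr p q x) = ci p x" if "x \<in> co p ` (dom p \<inter> dom q)" for x
    using that ci_co[OF assms(1)] ci_co[OF assms(2)] by auto
  then show ?thesis
    using open_overlap[OF assms(1,2)] assms(3,4) unfolding eventually_nhds by blast
qed

lemma nb_le:
  assumes "p \<in> S" "p' \<in> S" "q \<in> dom p" "q \<in> dom p'"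
  shows "filtermap (ci p) (nhds (co p q)) \<le> filtermap (ci p') (nhds (co p' q))"
proof (rule filter_leI)
  fix P assume "eventually P (filtermap (ci p') (nhds (co p' q)))"
  then have "eventually (\<lambda>x. P (ci p' x)) (nhds (co p' q))" by (simp add: eventually_filtermap)
  then have "eventually (\<lambda>x. P (ci p' (tr p p' x))) (nhds (co p q))"
    by (rule eventually_compose_filterlim[OF _ tr_tendsto[OF assms]])
  with ev_overlap[OF assms] have "eventually (\<lambda>x. P (ci p x)) (nhds (co p q))"
    by eventually_elim auto
  then show "eventually P (filtermap (ci p) (nhds (co p q)))" by (simp add: eventually_filtermap)
qed

lemma nb_chart:
  assumes "p \<in> S" "q \<in> dom p"
  shows "nb q = filtermap (ci p) (nhds (co p q))"
  using nb_le[of p q q] nb_le[of q p q] dom_S[OF assms] mem[OF dom_S[OF assms]] assms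
  unfolding nb_def by (auto intro: antisym)

lemma ev_nb:
  assumes "p \<in> S" "q \<in> dom p"
  shows "eventually P (nb q) \<longleftrightarrow> eventually (\<lambda>x. P (ci p x)) (nhds (co p q))"
  unfolding nb_chart[OF assms] eventually_filtermap ..

lemma ev_nbD: "q \<in> S \<Longrightarrow> eventually P (nb q) \<Longrightarrow> eventually (\<lambda>x. P (ci q x)) (nhds (co q q))"
  using ev_nb[OF _ mem] by blast

lemma ev_nb_at: "q \<in> S \<Longrightarrow> eventually P (nb q) \<Longrightarrow> P q"
  using ev_nb[of q q P] mem[of q] ci_co[of q q] eventually_nhds_x_imp_x by fastforce

lemma ev_nb_dom:
  assumes "p \<in> S" "q \<in> dom p"
  shows "eventually (\<lambda>w. w \<in> dom p) (nb q)"
  unfolding ev_nb[OF assms] using ev_chart[OF assms] by eventually_elim auto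

lemma ev_nb_self: "q \<in> S \<Longrightarrow> eventually (\<lambda>w. w \<in> dom q) (nb q)"
  using ev_nb_dom[OF _ mem] by blast

lemma ev_nb_S: "q \<in> S \<Longrightarrow> eventually (\<lambda>w. w \<in> S) (nb q)"
  by (rule eventually_mono[OF ev_nb_self]) (auto intro: dom_S)

text \<open>An iterated operator such as \<nabla>\<nabla>Z applies the inner derivative at every
  nearby point, so two sections equal near \<open>q\<close> must also be known to be equal near each
  of these points.\<close>

lemma ev_nb_nb:
  assumes "q \<in> S" "eventually P (nb q)"
  shows "eventually (\<lambda>w. eventually P (nb w)) (nb q)"
proof -
  have "eventually (\<lambda>x. P (ci q x)) (nhds (co q q))"
    using assms ev_nb mem by blast
  then have "eventually (\<lambda>y. eventually (\<lambda>x. P (ci q x)) (nhds y)) (nhds (co q q))"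
    by (simp add: eventually_eventually)
  with ev_chart[OF assms(1) mem[OF assms(1)]]
  have "eventually (\<lambda>y. eventually P (nb (ci q y))) (nhds (co q q))"
  proof eventually_elim
    case (elim y)
    then show ?case using ev_nb[OF assms(1), of "ci q y" P] by simp
  qed
  then show ?thesis using ev_nb[OF assms(1) mem[OF assms(1)]] by blast
qed

lemma smooth_at_change:
  assumes "p \<in> S" "p' \<in> S" "q \<in> dom p" "q \<in> dom p'" "smooth_at (co p' q) (\<lambda>x. f (ci p' x))"
  shows "smooth_at (co p q) (\<lambda>x. f (ci p x))"
proof -
  have "smooth_at (co p q) (\<lambda>x. f (ci p' (tr p p' x)))"
    using smooth_at_compose[of "tr p p'" "co p q" "\<lambda>x. f (ci p' x)"] assms tr_smooth[OF assms(1-4)]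
    by (simp add: ci_co)
  moreover have "eventually (\<lambda>x. f (ci p' (tr p p' x)) = f (ci p x)) (nhds (co p q))"
    using ev_overlap[OF assms(1-4)] by eventually_elim auto
  ultimately show ?thesis by (rule smooth_at_eq[rotated])
qed

lemma smn_self: "q \<in> S \<Longrightarrow> smn q f \<longleftrightarrow> smooth_at (co q q) (\<lambda>x. f (ci q x))"
proof
  assume "q \<in> S" "smooth_at (co q q) (\<lambda>x. f (ci q x))"
  then obtain W where W: "open W" "co q q \<in> W" "smooth_on W (\<lambda>x. f (ci q x))"
    unfolding smooth_at_def by auto
  then have "smooth_on (W \<inter> cran (\<kappa> q)) (f \<circ> ci q)"
    by (auto intro: smooth_on_subset simp: o_def)
  then show "smn q f"
    unfolding smooth_near_def using W open_cran[OF \<open>q \<in> S\<close>] co_cran[OF mem[OF \<open>q \<in> S\<close>]]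
    by (intro exI[of _ "W \<inter> cran (\<kappa> q)"]) auto
qed (auto simp: smooth_near_def smooth_at_def o_def)

lemma smn_chart:
  assumes "p \<in> S" "q \<in> dom p"
  shows "smn q f \<longleftrightarrow> smooth_at (co p q) (\<lambda>x. f (ci p x))"
  unfolding smn_self[OF dom_S[OF assms]]
  using smooth_at_change[of p q q f] smooth_at_change[of q p q f] assms dom_S[OF assms] mem[OF dom_S[OF assms]]
  by blast

lemma smn_cong:
  assumes "q \<in> S" "eventually (\<lambda>w. f w = g w) (nb q)"
  shows "smn q f \<longleftrightarrow> smn q g"
  unfolding smn_self[OF assms(1)]
  by (rule smooth_at_cong[OF ev_nbD[OF assms]])

lemmas smn_eq = smn_cong[THEN iffD1]

lemma smn_ev:
  assumes "q \<in> S" "smn q f"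
  shows "eventually (\<lambda>w. smn w f) (nb q)"
proof -
  have "eventually (\<lambda>x. smooth_at x (\<lambda>x. f (ci q x))) (nhds (co q q))"
    using assms smn_self smooth_at_eventually by blast
  with ev_chart[OF assms(1) mem[OF assms(1)]]
  have "eventually (\<lambda>x. smn (ci q x) f) (nhds (co q q))"
  proof eventually_elim
    case (elim x)
    then show ?case using smn_chart[OF assms(1), of "ci q x" f] by simp
  qed
  then show ?thesis using ev_nb[OF assms(1) mem[OF assms(1)]] by blast
qed

context
  fixes q assumes q: "q \<in> S"
begin

lemma smn_const [simp]: "smn q (\<lambda>w. c)"
  unfolding smn_self[OF q] by simp

lemma smn_linear: "bounded_linear h \<Longrightarrow> smn q f \<Longrightarrow> smn q (\<lambda>w. h (f w))"
  unfolding smn_self[OF q] by (rule smooth_at_linear)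

lemma smn_bilinear: "bounded_bilinear h \<Longrightarrow> smn q f \<Longrightarrow> smn q g \<Longrightarrow> smn q (\<lambda>w. h (f w) (g w))"
  unfolding smn_self[OF q] by (rule smooth_at_bilinear)

lemma smn_add: "smn q f \<Longrightarrow> smn q g \<Longrightarrow> smn q (\<lambda>w. f w + g w)"
  unfolding smn_self[OF q] by (rule smooth_at_add)

lemma smn_diff: "smn q f \<Longrightarrow> smn q g \<Longrightarrow> smn q (\<lambda>w. f w - g w)"
  unfolding smn_self[OF q] by (rule smooth_at_diff)

lemma smn_minus: "smn q f \<Longrightarrow> smn q (\<lambda>w. - f w)"
  unfolding smn_self[OF q] by (rule smooth_at_minus)

lemmas smn_scaleR = smn_bilinear[OF bounded_bilinear_scaleR]
lemmas smn_mult = smn_bilinear[OF bounded_bilinear_mult]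

lemma smn_sum: "(\<And>i. i \<in> I \<Longrightarrow> smn q (f i)) \<Longrightarrow> smn q (\<lambda>w. \<Sum>i\<in>I. f i w)"
  unfolding smn_self[OF q] by (rule smooth_at_sum)

lemma smn_nth: "smn q f \<Longrightarrow> smn q (\<lambda>w. f w $ i)"
  unfolding smn_self[OF q] by (rule smooth_at_nth)

lemma smn_inner: "smn q f \<Longrightarrow> smn q (\<lambda>w. f w \<bullet> b)"
  by (rule smn_linear[OF bounded_linear_inner_left])

lemma smn_vec:
  fixes f :: "'p \<Rightarrow> 'b::euclidean_space ^ 'n"
  shows "(\<And>i. smn q (\<lambda>w. f w $ i)) \<Longrightarrow> smn q f"
  unfolding smn_self[OF q] by (rule smooth_at_vec)

lemma smn_euclidean:
  fixes f :: "'p \<Rightarrow> 'b::euclidean_space"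
  shows "(\<And>b. b \<in> Basis \<Longrightarrow> smn q (\<lambda>w. f w \<bullet> b)) \<Longrightarrow> smn q f"
  unfolding smn_self[OF q] by (rule smooth_at_euclidean)

lemma smn_Pair: "smn q f \<Longrightarrow> smn q g \<Longrightarrow> smn q (\<lambda>w. (f w, g w))"
  unfolding smn_self[OF q] by (rule smooth_at_Pair)

lemma smn_compose:
  fixes h :: "'b::euclidean_space \<Rightarrow> 'c::real_normed_vector"
  shows "smooth_at (f q) h \<Longrightarrow> smn q f \<Longrightarrow> smn q (\<lambda>w. h (f w))"
  unfolding smn_self[OF q] using smooth_at_compose[of "\<lambda>x. f (ci q x)" "co q q" h] ci_co[OF q mem[OF q]] by simp

lemma smn_matrix_inv:
  fixes A :: "'p \<Rightarrow> real ^ 'n ^ 'n"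
  shows "smn q A \<Longrightarrow> det (A q) \<noteq> 0 \<Longrightarrow> smn q (\<lambda>w. matrix_inv (A w))"
  unfolding smn_self[OF q]
  using smooth_at_matrix_inv[of "co q q" "\<lambda>x. A (ci q x)"] ci_co[OF q mem[OF q]] by simp

end

lemma smn_co: "p \<in> S \<Longrightarrow> q \<in> dom p \<Longrightarrow> smn q (co p)"
proof -
  assume pq: "p \<in> S" "q \<in> dom p"
  have "eventually (\<lambda>x. x = co p (ci p x)) (nhds (co p q))"
    using ev_chart[OF pq] by eventually_elim simp
  from smooth_at_eq[OF this] show ?thesis unfolding smn_chart[OF pq] by simp
qed


subsection \<open>Tangent vectors in different charts\<close>

lemma tc_alt: "tc p q v = frechet_derivative (tr q p) (at (co q q)) v"
  unfolding tcomp_def o_def ..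

lemma tc_linear: "p \<in> S \<Longrightarrow> q \<in> dom p \<Longrightarrow> linear (tc p q)"
  unfolding tc_alt[abs_def] eta_contract_eq
  by (intro linear_frechet_smooth_at tr_smooth) (auto intro: mem dom_S)

lemma tr_self:
  assumes "p \<in> S" "q \<in> dom p"
  shows "frechet_derivative (tr p p) (at (co p q)) v = v"
proof -
  have "eventually (\<lambda>x. tr p p x = x) (nhds (co p q))"
    using ev_chart[OF assms] by eventually_elim auto
  from frechet_derivative_cong[OF this] show ?thesis by simp
qed

lemma tc_self [simp]: "p \<in> S \<Longrightarrow> tc p p v = v"
  unfolding tc_alt by (rule tr_self[OF _ mem])

lemma tr_tr:
  assumes "p \<in> S" "p' \<in> S" "r \<in> S" "q \<in> dom p" "q \<in> dom p'" "q \<in> dom r"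
  shows "frechet_derivative (tr p p') (at (co p q)) (frechet_derivative (tr r p) (at (co r q)) v)
    = frechet_derivative (tr r p') (at (co r q)) v"
proof -
  have s: "smooth_at (co r q) (tr r p)" "smooth_at (co p q) (tr p p')"
    using assms by (auto intro!: tr_smooth)
  have "frechet_derivative (\<lambda>x. tr p p' (tr r p x)) (at (co r q)) v
    = frechet_derivative (tr p p') (at (co p q)) (frechet_derivative (tr r p) (at (co r q)) v)"
    using frechet_derivative_chain[of "tr r p" "co r q" "tr p p'" v] s ci_co[OF assms(3,6)] by simp
  moreover have "eventually (\<lambda>x. tr p p' (tr r p x) = tr r p' x) (nhds (co r q))"
    using ev_overlap[OF assms(3,1,6,4)] by eventually_elim auto
  ultimately show ?thesis using frechet_derivative_cong by metis
qed

lemma tr_tc: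
  assumes "p \<in> S" "p' \<in> S" "q \<in> dom p" "q \<in> dom p'"
  shows "frechet_derivative (tr p p') (at (co p q)) (tc p q v) = tc p' q v"
  unfolding tc_alt using assms by (intro tr_tr) (auto intro: mem dom_S)

text \<open>Chain rule for two transition maps that undo each other. On the base, the inverse of
  \<open>tc p q\<close> found here is the map later called \<open>ext\<close>.\<close>

lemma tr_tc_inverse:
  assumes "p \<in> S" "q \<in> dom p"
  shows "frechet_derivative (tr p q) (at (co p q)) (tc p q v) = v"
    and "tc p q (frechet_derivative (tr p q) (at (co p q)) v) = v"
proof -
  note q = dom_S[OF assms]
  show "frechet_derivative (tr p q) (at (co p q)) (tc p q v) = v"
    using tr_tc[OF assms(1) q assms(2) mem[OF q]] tc_self[OF q] by simp
  show "tc p q (frechet_derivative (tr p q) (at (co p q)) v) = v"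
    unfolding tc_alt tr_tr[OF q assms(1,1) mem[OF q] assms(2,2)] by (rule tr_self[OF assms])
qed


subsection \<open>Derivatives of functions\<close>

lemma dd_self: "dir_deriv \<kappa> q v f = frechet_derivative (\<lambda>x. f (ci q x)) (at (co q q)) v"
  unfolding dir_deriv_def o_def ..

lemma dd_chart:
  assumes "p \<in> S" "q \<in> dom p" "smn q f"
  shows "dir_deriv \<kappa> q v f = frechet_derivative (\<lambda>x. f (ci p x)) (at (co p q)) (tc p q v)"
proof -
  note q = dom_S[OF assms(1,2)]
  have "frechet_derivative (\<lambda>x. f (ci p (tr q p x))) (at (co q q)) v
    = frechet_derivative (\<lambda>x. f (ci p x)) (at (co p q)) (tc p q v)"
    using frechet_derivative_chain[of "tr q p" "co q q" "\<lambda>x. f (ci p x)" v]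
      tr_smooth[OF q assms(1) mem[OF q] assms(2)] assms(3)[unfolded smn_chart[OF assms(1,2)]]
      ci_co[OF q mem[OF q]]
    by (simp add: tc_alt)
  moreover have "eventually (\<lambda>x. f (ci p (tr q p x)) = f (ci q x)) (nhds (co q q))"
    using ev_overlap[OF q assms(1) mem[OF q] assms(2)] by eventually_elim auto
  ultimately show ?thesis unfolding dd_self using frechet_derivative_cong by metis
qed

lemma dd_cong:
  assumes "q \<in> S" "eventually (\<lambda>w. f w = g w) (nb q)"
  shows "dir_deriv \<kappa> q v f = dir_deriv \<kappa> q v g"
proof -
  have "eventually (\<lambda>x. f (ci q x) = g (ci q x)) (nhds (co q q))"
    using ev_nbD[OF assms] .
  then show ?thesis unfolding dd_self using frechet_derivative_cong by metis
qed

context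
  fixes q assumes q: "q \<in> S"
begin

lemma dd_linear: "smn q f \<Longrightarrow> linear (\<lambda>v. dir_deriv \<kappa> q v f)"
  unfolding dd_self[abs_def] smn_self[OF q] eta_contract_eq by (rule linear_frechet_smooth_at)

lemma dd_const [simp]: "dir_deriv \<kappa> q v (\<lambda>w. c) = 0"
  unfolding dd_self by simp

lemma dd_add: "smn q f \<Longrightarrow> smn q g \<Longrightarrow>
    dir_deriv \<kappa> q v (\<lambda>w. f w + g w) = dir_deriv \<kappa> q v f + dir_deriv \<kappa> q v g"
  unfolding dd_self smn_self[OF q] by (rule frechet_derivative_plus)

lemma dd_mult: "smn q f \<Longrightarrow> smn q g \<Longrightarrow>
    dir_deriv \<kappa> q v (\<lambda>w. f w * g w) = f q * dir_deriv \<kappa> q v g + dir_deriv \<kappa> q v f * g q"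
  unfolding dd_self smn_self[OF q]
  using frechet_derivative_bilin[OF bounded_bilinear_mult, of "co q q" "\<lambda>x. f (ci q x)" "\<lambda>x. g (ci q x)" v]
  by (simp add: ci_co[OF q mem[OF q]])

lemma dd_cmult: "smn q f \<Longrightarrow> dir_deriv \<kappa> q v (\<lambda>w. c * f w) = c * dir_deriv \<kappa> q v f"
  using dd_mult[OF smn_const[OF q], of f v c] dd_const by simp

lemma dd_sum: "(\<And>i. i \<in> I \<Longrightarrow> smn q (f i)) \<Longrightarrow>
    dir_deriv \<kappa> q v (\<lambda>w. \<Sum>i\<in>I. f i w) = (\<Sum>i\<in>I. dir_deriv \<kappa> q v (f i))"
  unfolding dd_self smn_self[OF q] by (rule frechet_derivative_sum)

end

lemma dd_co:
  assumes "p \<in> S" "q \<in> dom p"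
  shows "dir_deriv \<kappa> q v (\<lambda>w. co p w \<bullet> b) = tc p q v \<bullet> b"
  unfolding dd_self tc_alt
  by (rule frechet_derivative_lin[OF bounded_linear_inner_left tr_smooth])
     (use assms in \<open>auto intro: dom_S mem\<close>)


subsection \<open>Vector fields and their brackets\<close>

abbreviation vfs :: "'p \<Rightarrow> ('p \<Rightarrow> 'e) \<Rightarrow> bool" where "vfs \<equiv> vf_smooth_near \<kappa>"

lemma vfs_alt: "vfs q X \<longleftrightarrow> smn q (\<lambda>w. tc q w (X w))"
  unfolding vf_smooth_near_def smooth_near_def vf_rep_def[abs_def] o_def ..

text \<open>Components in two fixed charts differ by the derivative of their transition map, taken
  at a smoothly moving point and applied to a smoothly moving vector.\<close>

lemma tc_change_smn:
  assumes "p \<in> S" "p' \<in> S" "q \<in> dom p" "q \<in> dom p'" "smn q (\<lambda>w. tc p w (X w))"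
  shows "smn q (\<lambda>w. tc p' w (X w))"
proof -
  have "smooth_at (co p q) (\<lambda>x. frechet_derivative (tr p p') (at x) (tc p (ci p x) (X (ci p x))))"
    using assms(5)[unfolded smn_chart[OF assms(1,3)]] tr_smooth[OF assms(1-4)]
    by (intro smooth_at_frechet_derivative)
  moreover have "eventually (\<lambda>x. frechet_derivative (tr p p') (at x) (tc p (ci p x) (X (ci p x)))
      = tc p' (ci p x) (X (ci p x))) (nhds (co p q))"
    using ev_overlap[OF assms(1-4)] ev_chart[OF assms(1,3)]
  proof eventually_elim
    case (elim x)
    then show ?case using tr_tc[OF assms(1,2), of "ci p x" "X (ci p x)"] by simp
  qed
  ultimately show ?thesis unfolding smn_chart[OF assms(1,3)] by (rule smooth_at_eq[rotated])
qed

lemma vfs_chart: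
  assumes "p \<in> S" "q \<in> dom p"
  shows "vfs q X \<longleftrightarrow> smn q (\<lambda>w. tc p w (X w))"
  unfolding vfs_alt
  using tc_change_smn[OF assms(1) dom_S[OF assms] assms(2) mem[OF dom_S[OF assms]], of X]
    tc_change_smn[OF dom_S[OF assms] assms(1) mem[OF dom_S[OF assms]] assms(2), of X]
  by blast

lemma vfs_ev:
  assumes "q \<in> S" "vfs q X"
  shows "eventually (\<lambda>w. vfs w X) (nb q)"
proof -
  have "eventually (\<lambda>w. smn w (\<lambda>w. tc q w (X w))) (nb q)"
    using assms unfolding vfs_alt by (rule smn_ev)
  with ev_nb_self[OF assms(1)] show ?thesis
    by eventually_elim (use vfs_chart[OF assms(1)] in blast)
qed

lemma vfs_cong:
  assumes "q \<in> S" "eventually (\<lambda>w. X w = Y w) (nb q)" "vfs q X"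
  shows "vfs q Y"
  using assms(3) unfolding vfs_alt
  by (rule smn_eq[OF assms(1), rotated]) (use assms(2) in \<open>eventually_elim, simp\<close>)

lemma vfs_add:
  assumes "q \<in> S" "vfs q X" "vfs q Y"
  shows "vfs q (\<lambda>w. X w + Y w)"
proof -
  have "eventually (\<lambda>w. tc q w (X w) + tc q w (Y w) = tc q w (X w + Y w)) (nb q)"
    using ev_nb_self[OF assms(1)]
    by eventually_elim (simp add: linear_add[OF tc_linear[OF assms(1)]])
  then show ?thesis
    unfolding vfs_alt
    by (rule smn_eq[OF assms(1) _ smn_add[OF assms(1) assms(2,3)[unfolded vfs_alt]]])
qed

lemma vfs_scaleR:
  assumes "q \<in> S" "smn q f" "vfs q X"
  shows "vfs q (\<lambda>w. f w *\<^sub>R X w)"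
proof -
  have "eventually (\<lambda>w. f w *\<^sub>R tc q w (X w) = tc q w (f w *\<^sub>R X w)) (nb q)"
    using ev_nb_self[OF assms(1)]
    by eventually_elim (simp add: linear_scale[OF tc_linear[OF assms(1)]])
  then show ?thesis
    unfolding vfs_alt
    by (rule smn_eq[OF assms(1) _ smn_scaleR[OF assms(1,2) assms(3)[unfolded vfs_alt]]])
qed

text \<open>The chart expression is recorded along with smoothness because a second derivation has
  to differentiate it.\<close>

lemma dd_field:
  assumes "q \<in> S" "vfs q X" "smn q f"
  shows "smn q (\<lambda>w. dir_deriv \<kappa> w (X w) f)"
    and "eventually (\<lambda>x. dir_deriv \<kappa> (ci q x) (X (ci q x)) f
      = frechet_derivative (\<lambda>x. f (ci q x)) (at x) (vf_rep \<kappa> (\<kappa> q) X x)) (nhds (co q q))"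
proof -
  show e: "eventually (\<lambda>x. dir_deriv \<kappa> (ci q x) (X (ci q x)) f
      = frechet_derivative (\<lambda>x. f (ci q x)) (at x) (vf_rep \<kappa> (\<kappa> q) X x)) (nhds (co q q))"
    using ev_chart[OF assms(1) mem[OF assms(1)]] smn_ev[OF assms(1,3), unfolded ev_nb[OF assms(1) mem[OF assms(1)]]]
    by eventually_elim (use assms(1) in \<open>auto simp: dd_chart[of q] vf_rep_def\<close>)
  have "smooth_at (co q q) (\<lambda>x. frechet_derivative (\<lambda>x. f (ci q x)) (at x) (vf_rep \<kappa> (\<kappa> q) X x))"
    using assms(2,3)[unfolded vfs_alt smn_self[OF assms(1)]] unfolding vf_rep_def
    by (intro smooth_at_frechet_derivative)
  then show "smn q (\<lambda>w. dir_deriv \<kappa> w (X w) f)"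
    unfolding smn_self[OF assms(1)]
    by (rule smooth_at_eq[rotated]) (use e in \<open>eventually_elim, simp\<close>)
qed

text \<open>Both iterated derivatives contain the second derivative of \<open>f\<close> on
  \<open>X q\<close> and \<open>Y q\<close>. By its symmetry these terms cancel, and the derivatives
  of the component functions remain. The result describes the bracket without any chart.\<close>

lemma lie_bracket_commutator:
  fixes f :: "'p \<Rightarrow> real"
  assumes "q \<in> S" "vfs q X" "vfs q Y" "smn q f"
  shows "dir_deriv \<kappa> q (lie_bracket \<kappa> X Y q) f
    = dir_deriv \<kappa> q (X q) (\<lambda>w. dir_deriv \<kappa> w (Y w) f) - dir_deriv \<kappa> q (Y q) (\<lambda>w. dir_deriv \<kappa> w (X w) f)"
proof -
  let ?F = "\<lambda>x. f (ci q x)" and ?X = "vf_rep \<kappa> (\<kappa> q) X" and ?Y = "vf_rep \<kappa> (\<kappa> q) Y" and ?x = "co q q"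
  have sX: "smooth_at ?x ?X" "smooth_at ?x ?Y" and sF: "smooth_at ?x ?F"
    using assms(2-4)[unfolded vfs_alt smn_self[OF assms(1)]] unfolding vf_rep_def by auto
  have at: "?X ?x = X q" "?Y ?x = Y q"
    using assms(1) mem[OF assms(1)] by (auto simp: vf_rep_def ci_co)
  have dd: "dir_deriv \<kappa> q v (\<lambda>w. dir_deriv \<kappa> w (Z w) f)
      = frechet_derivative (\<lambda>x. frechet_derivative ?F (at x) (vf_rep \<kappa> (\<kappa> q) Z x)) (at ?x) v"
    if "vfs q Z" for Z v
    unfolding dd_self[of q] frechet_derivative_cong[OF dd_field(2)[OF assms(1) that assms(4)]] ..
  have "dir_deriv \<kappa> q (lie_bracket \<kappa> X Y q) f
    = frechet_derivative ?F (at ?x) (frechet_derivative ?Y (at ?x) (X q))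
      - frechet_derivative ?F (at ?x) (frechet_derivative ?X (at ?x) (Y q))"
    unfolding dd_self[of q] lie_bracket_def linear_diff[OF linear_frechet_smooth_at[OF sF]] ..
  then show ?thesis
    unfolding dd[OF assms(2)] dd[OF assms(3)] frechet_derivative_along[OF sF sX(1)]
      frechet_derivative_along[OF sF sX(2)] at
    by (simp add: symmetric_second_derivative[OF sF, of "X q"])
qed

text \<open>At each point the bracket is computed in the chart belonging to that point, so
  smoothness cannot be read off its definition. Its components in the one chart of \<open>q\<close>
  are its values on coordinate functions, which the commutator formula expresses by smooth
  functions.\<close>

lemma vfs_lie_bracket:
  assumes "q \<in> S" "vfs q X" "vfs q Y"
  shows "vfs q (lie_bracket \<kappa> X Y)"
  unfolding vfs_alt
proof (rule smn_euclidean[OF assms(1)])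
  fix b :: 'e
  let ?f = "\<lambda>w. co q w \<bullet> b"
  have sf: "smn q ?f" by (rule smn_inner[OF assms(1) smn_co[OF assms(1) mem[OF assms(1)]]])
  have "smn q (\<lambda>w. dir_deriv \<kappa> w (X w) (\<lambda>w. dir_deriv \<kappa> w (Y w) ?f) - dir_deriv \<kappa> w (Y w) (\<lambda>w. dir_deriv \<kappa> w (X w) ?f))"
    using assms sf by (intro smn_diff dd_field(1))
  moreover have "eventually (\<lambda>w. dir_deriv \<kappa> w (X w) (\<lambda>w. dir_deriv \<kappa> w (Y w) ?f)
      - dir_deriv \<kappa> w (Y w) (\<lambda>w. dir_deriv \<kappa> w (X w) ?f) = tc q w (lie_bracket \<kappa> X Y w) \<bullet> b) (nb q)"
    using ev_nb_self[OF assms(1)] vfs_ev[OF assms(1,2)] vfs_ev[OF assms(1,3)] smn_ev[OF assms(1) sf]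
  proof eventually_elim
    case (elim w)
    then show ?case
      using lie_bracket_commutator[OF dom_S[OF assms(1) elim(1)] elim(2-4)] dd_co[OF assms(1) elim(1)]
      by simp
  qed
  ultimately show "smn q (\<lambda>w. tc q w (lie_bracket \<kappa> X Y w) \<bullet> b)"
    by (rule smn_eq[OF assms(1), rotated])
qed

lemma vf_rep_cong:
  assumes "q \<in> S" "eventually (\<lambda>w. X w = Y w) (nb q)"
  shows "frechet_derivative (vf_rep \<kappa> (\<kappa> q) X) (at (co q q)) = frechet_derivative (vf_rep \<kappa> (\<kappa> q) Y) (at (co q q))"
  by (rule frechet_derivative_cong)
     (use assms(2)[unfolded ev_nb[OF assms(1) mem[OF assms(1)]]] in \<open>eventually_elim, simp add: vf_rep_def\<close>)

lemma lie_bracket_cong: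
  assumes "q \<in> S" "eventually (\<lambda>w. X w = X' w) (nb q)" "eventually (\<lambda>w. Y w = Y' w) (nb q)"
  shows "lie_bracket \<kappa> X Y q = lie_bracket \<kappa> X' Y' q"
  unfolding lie_bracket_def
  using vf_rep_cong[OF assms(1,2)] vf_rep_cong[OF assms(1,3)] ev_nb_at[OF assms(1,2)] ev_nb_at[OF assms(1,3)]
  by simp

lemma lie_bracket_swap: "lie_bracket \<kappa> X Y q = - lie_bracket \<kappa> Y X q"
  unfolding lie_bracket_def by simp

lemma lie_bracket_add:
  assumes "q \<in> S" "vfs q X" "vfs q Y" "vfs q Z"
  shows "lie_bracket \<kappa> X (\<lambda>w. Y w + Z w) q = lie_bracket \<kappa> X Y q + lie_bracket \<kappa> X Z q"
proof -
  have s: "smooth_at (co q q) (vf_rep \<kappa> (\<kappa> q) X)" "smooth_at (co q q) (vf_rep \<kappa> (\<kappa> q) Y)"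
    "smooth_at (co q q) (vf_rep \<kappa> (\<kappa> q) Z)"
    using assms(2-4)[unfolded vfs_alt smn_self[OF assms(1)]] unfolding vf_rep_def by auto
  have "eventually (\<lambda>x. vf_rep \<kappa> (\<kappa> q) (\<lambda>w. Y w + Z w) x = vf_rep \<kappa> (\<kappa> q) Y x + vf_rep \<kappa> (\<kappa> q) Z x) (nhds (co q q))"
    using ev_chart[OF assms(1) mem[OF assms(1)]]
    by eventually_elim (simp add: vf_rep_def linear_add[OF tc_linear[OF assms(1)]])
  from frechet_derivative_cong[OF this] show ?thesis
    unfolding lie_bracket_def
    by (simp add: frechet_derivative_plus s linear_add[OF linear_frechet_smooth_at[OF s(1)]])
qed

lemma lie_bracket_scaleR:
  assumes "q \<in> S" "vfs q X" "vfs q Y" "smn q f"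
  shows "lie_bracket \<kappa> X (\<lambda>w. f w *\<^sub>R Y w) q = dir_deriv \<kappa> q (X q) f *\<^sub>R Y q + f q *\<^sub>R lie_bracket \<kappa> X Y q"
proof -
  have s: "smooth_at (co q q) (vf_rep \<kappa> (\<kappa> q) X)" "smooth_at (co q q) (vf_rep \<kappa> (\<kappa> q) Y)"
    "smooth_at (co q q) (\<lambda>x. f (ci q x))"
    using assms(2-4)[unfolded vfs_alt smn_self[OF assms(1)]] unfolding vf_rep_def by auto
  have at: "vf_rep \<kappa> (\<kappa> q) Y (co q q) = Y q"
    using assms(1) mem[OF assms(1)] by (auto simp: vf_rep_def ci_co)
  have "eventually (\<lambda>x. vf_rep \<kappa> (\<kappa> q) (\<lambda>w. f w *\<^sub>R Y w) x = f (ci q x) *\<^sub>R vf_rep \<kappa> (\<kappa> q) Y x) (nhds (co q q))"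
    using ev_chart[OF assms(1) mem[OF assms(1)]]
    by eventually_elim (simp add: vf_rep_def linear_scale[OF tc_linear[OF assms(1)]])
  from frechet_derivative_cong[OF this] show ?thesis
    unfolding lie_bracket_def dd_self
    by (simp add: frechet_derivative_bilin[OF bounded_bilinear_scaleR s(3,2)] at
        ci_co[OF assms(1) mem[OF assms(1)]] linear_scale[OF linear_frechet_smooth_at[OF s(1)]]
        algebra_simps)
qed

end

section \<open>The slit tangent bundle\<close>

lemma smooth_onI:
  assumes "open S" "\<And>x. x \<in> S \<Longrightarrow> smooth_at x f"
  shows "smooth_on S f"
  unfolding smooth_on_def
proof
  fix k
  have "\<forall>x\<in>S. \<exists>W. open W \<and> x \<in> W \<and> Ck_on k W f"
    using assms(2) unfolding smooth_at_def smooth_on_def by meson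
  then show "Ck_on k S f"
  proof (induction k arbitrary: f)
    case 0
    then show ?case
      by (auto simp: continuous_on_eq_continuous_at[OF assms(1)])
         (metis continuous_on_eq_continuous_at)
  next
    case (Suc k)
    have "f differentiable_on S"
      unfolding differentiable_on_eq_differentiable_at[OF assms(1)]
    proof
      fix x assume "x \<in> S"
      then obtain W where "open W" "x \<in> W" "Ck_on (Suc k) W f" using Suc.prems by blast
      then show "f differentiable at x"
        using differentiable_on_eq_differentiable_at[of W f] by simp
    qed
    moreover have "Ck_on k S (\<lambda>x. frechet_derivative f (at x) v)" for v
    proof (rule Suc.IH, rule ballI)
      fix x assume "x \<in> S"
      then obtain W where "open W" "x \<in> W" "Ck_on (Suc k) W f" using Suc.prems by blast
      then show "\<exists>W. open W \<and> x \<in> W \<and> Ck_on k W (\<lambda>x. frechet_derivative f (at x) v)"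
        by (intro exI[of _ W]) simp
    qed
    ultimately show ?case by simp
  qed
qed

lemma smooth_at_fst: "smooth_at z fst" and smooth_at_snd: "smooth_at z snd"
  by (rule smooth_at_bounded_linear[OF bounded_linear_fst] smooth_at_bounded_linear[OF bounded_linear_snd])+

lemma smooth_at_compose_fst:
  fixes \<phi> :: "'a::euclidean_space \<Rightarrow> 'b::real_normed_vector"
  shows "smooth_at (fst z) \<phi> \<Longrightarrow> smooth_at (z::'a \<times> 'c::real_normed_vector) (\<lambda>z. \<phi> (fst z))"
  by (rule smooth_at_compose[OF _ smooth_at_fst])

lemma frechet_derivative_compose_fst:
  fixes \<phi> :: "'a::euclidean_space \<Rightarrow> 'b::real_normed_vector" and z :: "'a \<times> 'c::real_normed_vector"
  assumes "smooth_at (fst z) \<phi>"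
  shows "frechet_derivative (\<lambda>z. \<phi> (fst z)) (at z) v = frechet_derivative \<phi> (at (fst z)) (fst v)"
  using frechet_derivative_chain[OF assms smooth_at_fst]
  by (simp add: frechet_derivative_bounded_linear[OF bounded_linear_fst])

lemma eventually_fst:
  assumes "eventually P (nhds (fst z))"
  shows "eventually (\<lambda>z. P (fst z)) (nhds z)"
  by (rule eventually_compose_filterlim[OF assms]) (intro tendsto_intros filterlim_ident)

text \<open>Base point and direction vary together. Regarded as the derivative of
  \<open>\<phi>\<close> composed with \<open>fst\<close>, taken in the direction
  \<open>(snd z, 0)\<close>, the map is covered by the rule for varying directions.\<close>

lemma smooth_at_tangent_map:
  fixes \<phi> :: "'a::euclidean_space \<Rightarrow> 'b::real_normed_vector"
  assumes "smooth_at (fst z) \<phi>"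
  shows "smooth_at z (\<lambda>z. frechet_derivative \<phi> (at (fst z)) (snd z))"
proof (rule smooth_at_eq)
  show "eventually (\<lambda>z. frechet_derivative (\<lambda>z::'a \<times> 'a. \<phi> (fst z)) (at z) (snd z, 0)
      = frechet_derivative \<phi> (at (fst z)) (snd z)) (nhds z)"
    using eventually_fst[OF smooth_at_eventually[OF assms]]
    by eventually_elim (simp add: frechet_derivative_compose_fst)
  show "smooth_at z (\<lambda>z. frechet_derivative (\<lambda>z::'a \<times> 'a. \<phi> (fst z)) (at z) (snd z, 0))"
    by (intro smooth_at_frechet_derivative smooth_at_compose_fst assms smooth_at_Pair smooth_at_snd smooth_at_const)
qed

locale tangent =
  fixes \<kappa> :: "'m::{t2_space, second_countable_topology} \<Rightarrow> ('m, real ^ 'n::finite) chart"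
  assumes manifold: "smooth_manifold \<kappa>"
begin

sublocale base: atlas UNIV \<kappa>
proof
  have h: "p \<in> cdom (\<kappa> p)" "open (cdom (\<kappa> p))" "open (cran (\<kappa> p))"
      "homeomorphism (cdom (\<kappa> p)) (cran (\<kappa> p)) (cmap (\<kappa> p)) (cinv (\<kappa> p))" for p
    using manifold unfolding smooth_manifold_def by auto
  fix p q :: 'm
  show "p \<in> cdom (\<kappa> p)" "cdom (\<kappa> p) \<subseteq> UNIV" using h by auto
  show "inj_on (cmap (\<kappa> p)) (cdom (\<kappa> p))"
    using h(4)[of p] unfolding homeomorphism_def by (metis inj_on_inverseI)
  show "open (cmap (\<kappa> p) ` (cdom (\<kappa> p) \<inter> cdom (\<kappa> q)))"
  proof -
    have "openin (top_of_set (cdom (\<kappa> p))) (cdom (\<kappa> p) \<inter> cdom (\<kappa> q))"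
      using h(2) by (simp add: openin_open_Int)
    from homeomorphism_imp_open_map[OF h(4) this] show ?thesis
      using h(3)[of p] openin_open_eq by blast
  qed
  show "smooth_on (cmap (\<kappa> p) ` (cdom (\<kappa> p) \<inter> cdom (\<kappa> q))) (cmap (\<kappa> q) \<circ> cinv (\<kappa> p))"
    using manifold unfolding smooth_manifold_def by auto
qed

lemma base_mem [simp]: "p \<in> cdom (\<kappa> p)"
  using base.mem by simp

lemma tchart_dom: "cdom (tchart \<kappa> u) = cdom (\<kappa> (fst u)) \<times> (UNIV - {0})"
  and tchart_map: "cmap (tchart \<kappa> u) w = (base.co (fst u) (fst w), base.tc (fst u) (fst w) (snd w))"
  unfolding tchart_def cdom_def cmap_def by (auto simp: case_prod_beta)

lemma tc_eq_0_iff: "q \<in> base.dom p \<Longrightarrow> base.tc p q v = 0 \<longleftrightarrow> v = 0"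
  using base.tr_tc_inverse(1)[of p q v] linear_0[OF base.tc_linear[of p q]]
    linear_0[OF linear_frechet_smooth_at[OF base.tr_smooth[of p q q]]]
  by auto

lemma frame_eq_0_iff:
  "q \<in> base.dom p \<Longrightarrow> frechet_derivative (base.tr p q) (at (base.co p q)) v = 0 \<longleftrightarrow> v = 0"
  using base.tr_tc_inverse(2)[of p q v] linear_0[OF base.tc_linear[of p q]]
    linear_0[OF linear_frechet_smooth_at[OF base.tr_smooth[of p q q]]]
  by auto

lemma tchart_inj: "inj_on (cmap (tchart \<kappa> u)) (cdom (tchart \<kappa> u))"
proof (rule inj_onI)
  fix w w' assume a: "w \<in> cdom (tchart \<kappa> u)" "w' \<in> cdom (tchart \<kappa> u)"
    "cmap (tchart \<kappa> u) w = cmap (tchart \<kappa> u) w'"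
  then have f: "fst w = fst w'"
    using inj_onD[OF base.inj[of "fst u"], of "fst w" "fst w'"] by (auto simp: tchart_dom tchart_map)
  moreover have "snd w = snd w'"
    using a f base.tr_tc_inverse(1)[of "fst u" "fst w"] unfolding tchart_dom tchart_map
    by (metis Pair_inject SigmaE UNIV_I fst_conv)
  ultimately show "w = w'" by (simp add: prod_eq_iff)
qed

lemma tchart_inv:
  assumes "q \<in> base.dom (fst u)" "y \<noteq> 0"
  shows "cinv (tchart \<kappa> u) (base.co (fst u) q, y)
    = (q, frechet_derivative (base.tr (fst u) q) (at (base.co (fst u) q)) y)"
  unfolding cinv_def[of "tchart \<kappa> u"]
  by (rule inv_into_f_eq[OF tchart_inj])
     (use assms in \<open>auto simp: tchart_dom tchart_map frame_eq_0_iff base.tr_tc_inverse\<close>)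

text \<open>The fibre part of a bundle chart is a linear isomorphism, so over each base point it
  reaches precisely the nonzero vectors. Openness of the overlaps is then inherited from the
  base.\<close>

lemma tchart_overlap:
  "cmap (tchart \<kappa> u) ` (cdom (tchart \<kappa> u) \<inter> cdom (tchart \<kappa> u'))
    = (base.co (fst u) ` (base.dom (fst u) \<inter> base.dom (fst u'))) \<times> (UNIV - {0})"
  (is "?l = ?r")
proof
  show "?l \<subseteq> ?r" by (auto simp: tchart_dom tchart_map tc_eq_0_iff)
  show "?r \<subseteq> ?l"
  proof
    fix z assume "z \<in> ?r"
    then obtain q y where q: "q \<in> base.dom (fst u)" "q \<in> base.dom (fst u')" "y \<noteq> 0"
      and z: "z = (base.co (fst u) q, y)" by auto
    let ?w = "(q, frechet_derivative (base.tr (fst u) q) (at (base.co (fst u) q)) y)"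
    have "z = cmap (tchart \<kappa> u) ?w" "?w \<in> cdom (tchart \<kappa> u) \<inter> cdom (tchart \<kappa> u')"
      using q z by (auto simp: tchart_dom tchart_map frame_eq_0_iff base.tr_tc_inverse)
    then show "z \<in> ?l" by blast
  qed
qed

lemma tchart_tr:
  assumes "q \<in> base.dom (fst u)" "q \<in> base.dom (fst u')" "y \<noteq> 0"
  shows "cmap (tchart \<kappa> u') (cinv (tchart \<kappa> u) (base.co (fst u) q, y))
    = (base.tr (fst u) (fst u') (base.co (fst u) q),
       frechet_derivative (base.tr (fst u) (fst u')) (at (base.co (fst u) q)) y)"
proof -
  let ?v = "frechet_derivative (base.tr (fst u) q) (at (base.co (fst u) q)) y"
  have "base.tc (fst u') q ?v = frechet_derivative (base.tr (fst u) (fst u')) (at (base.co (fst u) q)) (base.tc (fst u) q ?v)"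
    using base.tr_tc[of "fst u" "fst u'" q ?v] assms by simp
  then show ?thesis
    unfolding tchart_inv[OF assms(1,3)] tchart_map using assms by (simp add: base.tr_tc_inverse base.ci_co)
qed

sublocale tm: atlas slit "tchart \<kappa>"
proof
  fix u u' :: "('m, 'n) tpoint" assume u: "u \<in> slit"
  show "u \<in> cdom (tchart \<kappa> u)" using u by (cases u) (auto simp: tchart_dom slit_def)
  show "cdom (tchart \<kappa> u) \<subseteq> slit" by (auto simp: tchart_dom slit_def)
  show "inj_on (cmap (tchart \<kappa> u)) (cdom (tchart \<kappa> u))" by (rule tchart_inj)
  show o: "open (cmap (tchart \<kappa> u) ` (cdom (tchart \<kappa> u) \<inter> cdom (tchart \<kappa> u')))"
    unfolding tchart_overlap by (intro open_Times base.open_overlap) auto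
  show "smooth_on (cmap (tchart \<kappa> u) ` (cdom (tchart \<kappa> u) \<inter> cdom (tchart \<kappa> u')))
      (cmap (tchart \<kappa> u') \<circ> cinv (tchart \<kappa> u))"
  proof (rule smooth_onI[OF o])
    fix z assume z: "z \<in> cmap (tchart \<kappa> u) ` (cdom (tchart \<kappa> u) \<inter> cdom (tchart \<kappa> u'))"
    then obtain q y where q: "q \<in> base.dom (fst u)" "q \<in> base.dom (fst u')" "y \<noteq> 0"
      and zq: "z = (base.co (fst u) q, y)" unfolding tchart_overlap by auto
    let ?t = "base.tr (fst u) (fst u')"
    have s: "smooth_at (fst z) ?t" unfolding zq using q by (auto intro!: base.tr_smooth)
    show "smooth_at z (cmap (tchart \<kappa> u') \<circ> cinv (tchart \<kappa> u))"
    proof (rule smooth_at_eq)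
      \<comment> \<open>The transition between two bundle charts is the tangent map of the
        transition \<open>?t\<close> of the base.\<close>
      show "smooth_at z (\<lambda>z. (?t (fst z), frechet_derivative ?t (at (fst z)) (snd z)))"
        by (intro smooth_at_Pair smooth_at_compose_fst smooth_at_tangent_map s)
      have "(?t (fst z), frechet_derivative ?t (at (fst z)) (snd z)) = (cmap (tchart \<kappa> u') \<circ> cinv (tchart \<kappa> u)) z"
        if zW: "z \<in> cmap (tchart \<kappa> u) ` (cdom (tchart \<kappa> u) \<inter> cdom (tchart \<kappa> u'))" for z
      proof -
        obtain q y where "q \<in> base.dom (fst u)" "q \<in> base.dom (fst u')" "y \<noteq> 0" "z = (base.co (fst u) q, y)"
          using zW unfolding tchart_overlap by auto
        then show ?thesis using tchart_tr[of q u u' y] by simp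
      qed
      then show "eventually (\<lambda>z. (?t (fst z), frechet_derivative ?t (at (fst z)) (snd z)) = (cmap (tchart \<kappa> u') \<circ> cinv (tchart \<kappa> u)) z) (nhds z)"
        using o z unfolding eventually_nhds by blast
    qed
  qed
qed

lemma slit_dom: "w \<in> tm.dom u \<longleftrightarrow> fst w \<in> base.dom (fst u) \<and> w \<in> slit"
  by (auto simp: tchart_dom slit_def mem_Times_iff)

lemma tm_mem [simp]: "u \<in> slit \<Longrightarrow> u \<in> tm.dom u"
  by (rule tm.mem)

lemma tm_tr_ev:
  assumes "u \<in> slit" "w \<in> tm.dom u" "w \<in> tm.dom u'"
  shows "eventually (\<lambda>z. tm.tr u u' z = (base.tr (fst u) (fst u') (fst z),
      frechet_derivative (base.tr (fst u) (fst u')) (at (fst z)) (snd z))) (nhds (tm.co u w))"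
proof -
  let ?W = "cmap (tchart \<kappa> u) ` (cdom (tchart \<kappa> u) \<inter> cdom (tchart \<kappa> u'))"
  have "open ?W" unfolding tchart_overlap by (intro open_Times base.open_overlap) auto
  moreover have "tm.tr u u' z = (base.tr (fst u) (fst u') (fst z),
      frechet_derivative (base.tr (fst u) (fst u')) (at (fst z)) (snd z))" if zW: "z \<in> ?W" for z
  proof -
    obtain q y where "q \<in> base.dom (fst u)" "q \<in> base.dom (fst u')" "y \<noteq> 0" "z = (base.co (fst u) q, y)"
      using zW unfolding tchart_overlap by auto
    then show ?thesis using tchart_tr[of q u u' y] by simp
  qed
  moreover have "tm.co u w \<in> ?W" using assms by blast
  ultimately show ?thesis unfolding eventually_nhds by blast
qed

text \<open>The first component of a bundle transition depends on the base point alone; hence the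
  projection \<rho> respects changes of chart.\<close>

lemma tm_tc_fst:
  assumes "u \<in> slit" "w \<in> tm.dom u"
  shows "fst (tm.tc u w X) = base.tc (fst u) (fst w) (fst X)"
proof -
  have w: "w \<in> slit" "w \<in> tm.dom w" "fst w \<in> base.dom (fst u)" using assms slit_dom by auto
  have s: "smooth_at (fst (tm.co w w)) (base.tr (fst w) (fst u))"
    using w by (auto simp: tchart_map intro!: base.tr_smooth)
  have "fst (tm.tc u w X) = frechet_derivative (\<lambda>z. fst (tm.tr w u z)) (at (tm.co w w)) X"
    unfolding tm.tc_alt
    using frechet_derivative_lin[OF bounded_linear_fst tm.tr_smooth[OF w(1) assms(1) w(2) assms(2)]] by simp
  also have "\<dots> = frechet_derivative (\<lambda>z. base.tr (fst w) (fst u) (fst z)) (at (tm.co w w)) X"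
    by (rule fun_cong[OF frechet_derivative_cong])
       (use tm_tr_ev[OF w(1,2) assms(2)] in \<open>eventually_elim, simp\<close>)
  also have "\<dots> = base.tc (fst u) (fst w) (fst X)"
    unfolding frechet_derivative_compose_fst[OF s] by (simp add: base.tc_alt tchart_map)
  finally show ?thesis .
qed

text \<open>Over a fixed base point a bundle transition is linear in the fibre variable and so is
  its own derivative there; hence \<gamma> respects changes of chart.\<close>

lemma tm_tc_gam:
  assumes "u \<in> slit" "w \<in> tm.dom u"
  shows "tm.tc u w (0, v) = (0, base.tc (fst u) (fst w) v)"
proof -
  have w: "w \<in> slit" "w \<in> tm.dom w" "fst w \<in> base.dom (fst u)" using assms slit_dom by auto
  let ?x = "base.co (fst w) (fst w)" and ?t = "base.tr (fst w) (fst u)"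
  have co: "tm.co w w = (?x, snd w)" by (simp add: tchart_map)
  have st: "smooth_at ?x ?t" using w by (auto intro!: base.tr_smooth)
  have s: "smooth_at (tm.co w w) (tm.tr w u)" by (rule tm.tr_smooth[OF w(1) assms(1) w(2) assms(2)])
  have l: "bounded_linear (\<lambda>y. (0::real ^ 'n, y::real ^ 'n))"
    by (intro bounded_linear_Pair bounded_linear_zero bounded_linear_ident)
  have sP: "smooth_at (snd w) (\<lambda>y. (?x, y))" by (intro smooth_at_Pair smooth_at_const smooth_at_ident)
  have dP: "frechet_derivative (\<lambda>y. (?x, y)) (at (snd w)) v = (0, v)"
    by (rule fun_cong[OF frechet_derivative_eqI]) (auto intro!: derivative_eq_intros)
  have "frechet_derivative (\<lambda>y. tm.tr w u (?x, y)) (at (snd w)) v = tm.tc u w (0, v)"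
    unfolding tm.tc_alt using frechet_derivative_chain[of "\<lambda>y. (?x, y)" "snd w" "tm.tr w u" v] s sP dP by (simp add: co)
  moreover have "frechet_derivative (\<lambda>y. tm.tr w u (?x, y)) (at (snd w))
    = frechet_derivative (\<lambda>y. (?t ?x, frechet_derivative ?t (at ?x) y)) (at (snd w))"
  proof (rule frechet_derivative_cong)
    have "filterlim (\<lambda>y. (?x, y)) (nhds (tm.co w w)) (nhds (snd w))"
      unfolding co by (intro tendsto_intros filterlim_ident)
    from eventually_compose_filterlim[OF tm_tr_ev[OF w(1,2) assms(2)] this]
    show "\<forall>\<^sub>F y in nhds (snd w). tm.tr w u (?x, y) = (?t ?x, frechet_derivative ?t (at ?x) y)" by simp
  qed
  moreover have "frechet_derivative (\<lambda>y. (?t ?x, frechet_derivative ?t (at ?x) y)) (at (snd w)) v = (0, frechet_derivative ?t (at ?x) v)"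
    by (rule fun_cong[OF frechet_derivative_eqI[OF has_derivative_Pair[OF has_derivative_const
          bounded_linear_imp_has_derivative[OF linear_conv_bounded_linear[THEN iffD1, OF linear_frechet_smooth_at[OF st]]]]]])
  ultimately show ?thesis by (simp add: base.tc_alt)
qed


subsection \<open>Sections of the pullback bundle\<close>

abbreviation dirT :: "('m, 'n) tpoint \<Rightarrow> (real ^ 'n) \<times> (real ^ 'n) \<Rightarrow> (('m, 'n) tpoint \<Rightarrow> real) \<Rightarrow> real" where
  "dirT \<equiv> dir_deriv (tchart \<kappa>)"

abbreviation pfs :: "('m, 'n) tpoint \<Rightarrow> ('m, 'n) pfield \<Rightarrow> bool" where "pfs \<equiv> pf_smooth_near \<kappa>"

text \<open>The components of a section in the chart of the base point of \<open>u\<close>.\<close>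

definition hat :: "('m, 'n) tpoint \<Rightarrow> ('m, 'n) pfield \<Rightarrow> ('m, 'n) pfield" where
  "hat u Y w = base.tc (fst u) (fst w) (Y w)"

lemma pfs_alt: "pfs u Y \<longleftrightarrow> tm.smn u (hat u Y)"
  unfolding pf_smooth_near_def hat_def[abs_def] ..

lemma ext_alt: "ext \<kappa> u v w = frechet_derivative (base.tr (fst u) (fst w)) (at (base.co (fst u) (fst w))) v"
  unfolding ext_def o_def ..

lemma ext_cong_fst: "fst u = fst u' \<Longrightarrow> fst w = fst w' \<Longrightarrow> ext \<kappa> u v w = ext \<kappa> u' v w'"
  unfolding ext_def by simp

lemma hat_ext: "fst w \<in> base.dom (fst u) \<Longrightarrow> hat u (ext \<kappa> u v) w = v"
  unfolding hat_def ext_alt by (rule base.tr_tc_inverse) auto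

lemma ext_hat: "fst w \<in> base.dom (fst u) \<Longrightarrow> ext \<kappa> u (hat u Y w) w = Y w"
  unfolding hat_def ext_alt by (rule base.tr_tc_inverse) auto

lemma hat_self [simp]: "fst w = fst u \<Longrightarrow> hat u Y w = Y w"
  unfolding hat_def by simp

lemma ext_self [simp]: "ext \<kappa> u v u = v"
  using ext_hat[of u u "\<lambda>_. v"] by simp

lemma ext_linear: "fst w \<in> base.dom (fst u) \<Longrightarrow> linear (\<lambda>v. ext \<kappa> u v w)"
  unfolding ext_alt eta_contract_eq by (intro linear_frechet_smooth_at base.tr_smooth) auto

lemma hat_linear: "fst w \<in> base.dom (fst u) \<Longrightarrow> linear (base.tc (fst u) (fst w))"
  by (rule base.tc_linear) auto

lemma smn_co_fst:
  assumes "u \<in> slit" "w \<in> tm.dom u"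
  shows "tm.smn w (\<lambda>z. base.co (fst u) (fst z))"
  using tm.smn_linear[OF _ bounded_linear_fst tm.smn_co[OF assms]] tm.dom_S[OF assms]
  by (simp add: tchart_map)

lemma hat_change:
  assumes "u \<in> slit" "u' \<in> slit" "w \<in> tm.dom u" "w \<in> tm.dom u'" "tm.smn w (hat u Y)"
  shows "tm.smn w (hat u' Y)"
proof -
  note w = tm.dom_S[OF assms(1,3)]
  let ?t = "base.tr (fst u) (fst u')"
  have "tm.smn w (\<lambda>z. (base.co (fst u) (fst z), hat u Y z))"
    by (intro tm.smn_Pair w smn_co_fst assms)
  then have "tm.smn w (\<lambda>z. frechet_derivative ?t (at (fst (base.co (fst u) (fst z), hat u Y z))) (snd (base.co (fst u) (fst z), hat u Y z)))"
    using assms(3,4)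
    by (intro tm.smn_compose[OF w smooth_at_tangent_map]) (auto simp: slit_dom intro!: base.tr_smooth)
  moreover have "eventually (\<lambda>z. frechet_derivative ?t (at (fst (base.co (fst u) (fst z), hat u Y z))) (snd (base.co (fst u) (fst z), hat u Y z))
      = hat u' Y z) (tm.nb w)"
    using tm.ev_nb_dom[OF assms(1,3)] tm.ev_nb_dom[OF assms(2,4)]
  proof eventually_elim
    case (elim z)
    then show ?case using base.tr_tc[of "fst u" "fst u'" "fst z" "Y z"] by (simp add: hat_def slit_dom)
  qed
  ultimately show ?thesis by (rule tm.smn_eq[OF w, rotated])
qed

lemma pfs_chart:
  assumes "u \<in> slit" "w \<in> tm.dom u"
  shows "pfs w Y \<longleftrightarrow> tm.smn w (hat u Y)"
  unfolding pfs_alt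
  using hat_change[of u w w Y] hat_change[of w u w Y] tm.dom_S[OF assms] assms by auto

lemma pfs_ev:
  assumes "u \<in> slit" "pfs u Y"
  shows "eventually (\<lambda>w. pfs w Y) (tm.nb u)"
  using tm.smn_ev[OF assms(1) assms(2)[unfolded pfs_alt]] tm.ev_nb_self[OF assms(1)]
  by eventually_elim (simp add: pfs_chart[OF assms(1)])

lemma pfs_cong:
  assumes "u \<in> slit" "eventually (\<lambda>w. X w = Y w) (tm.nb u)" "pfs u X"
  shows "pfs u Y"
  using assms(3) unfolding pfs_alt
  by (rule tm.smn_eq[OF assms(1), rotated]) (use assms(2) in \<open>eventually_elim, simp add: hat_def\<close>)

lemma pfs_add:
  assumes "u \<in> slit" "pfs u X" "pfs u Y"
  shows "pfs u (\<lambda>w. X w + Y w)"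
proof -
  have "eventually (\<lambda>w. hat u X w + hat u Y w = hat u (\<lambda>w. X w + Y w) w) (tm.nb u)"
    using tm.ev_nb_self[OF assms(1)]
    by eventually_elim (simp add: slit_dom hat_def linear_add[OF hat_linear])
  then show ?thesis unfolding pfs_alt
    by (rule tm.smn_eq[OF assms(1) _ tm.smn_add[OF assms(1) assms(2,3)[unfolded pfs_alt]]])
qed

lemma pfs_scaleR:
  assumes "u \<in> slit" "tm.smn u f" "pfs u Y"
  shows "pfs u (\<lambda>w. f w *\<^sub>R Y w)"
proof -
  have "eventually (\<lambda>w. f w *\<^sub>R hat u Y w = hat u (\<lambda>w. f w *\<^sub>R Y w) w) (tm.nb u)"
    using tm.ev_nb_self[OF assms(1)]
    by eventually_elim (simp add: slit_dom hat_def linear_scale[OF hat_linear])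
  then show ?thesis unfolding pfs_alt
    by (rule tm.smn_eq[OF assms(1) _ tm.smn_scaleR[OF assms(1,2) assms(3)[unfolded pfs_alt]]])
qed

lemma pfs_zero: "u \<in> slit \<Longrightarrow> pfs u (\<lambda>w. 0)"
proof -
  assume u: "u \<in> slit"
  have "eventually (\<lambda>w. 0 = hat u (\<lambda>w. 0) w) (tm.nb u)"
    using tm.ev_nb_self[OF u] by eventually_elim (simp add: slit_dom hat_def linear_0[OF hat_linear])
  then show ?thesis unfolding pfs_alt by (rule tm.smn_eq[OF u _ tm.smn_const[OF u]])
qed

lemma pfs_minus: "u \<in> slit \<Longrightarrow> pfs u Y \<Longrightarrow> pfs u (\<lambda>w. - Y w)"
  using pfs_scaleR[of u "\<lambda>w. -1" Y] by simp

lemma pfs_diff: "u \<in> slit \<Longrightarrow> pfs u X \<Longrightarrow> pfs u Y \<Longrightarrow> pfs u (\<lambda>w. X w - Y w)"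
  using pfs_add[OF _ _ pfs_minus, of u X Y] by simp

lemma pfs_sum: "u \<in> slit \<Longrightarrow> (\<And>i. i \<in> I \<Longrightarrow> pfs u (Y i)) \<Longrightarrow> pfs u (\<lambda>w. \<Sum>i\<in>I. Y i w)"
  by (induction I rule: infinite_finite_induct) (auto intro: pfs_zero pfs_add)

lemma pfs_ext:
  assumes "u \<in> slit" "w \<in> tm.dom u"
  shows "pfs w (ext \<kappa> u v)"
proof -
  note w = tm.dom_S[OF assms]
  have "eventually (\<lambda>z. v = hat u (ext \<kappa> u v) z) (tm.nb w)"
    using tm.ev_nb_dom[OF assms] by eventually_elim (simp add: slit_dom hat_ext)
  then show ?thesis unfolding pfs_chart[OF assms] by (rule tm.smn_eq[OF w _ tm.smn_const[OF w]])
qed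

lemma hat_eta: "hat u eta w = snd (tm.co u w)"
  unfolding hat_def eta_def tchart_map by simp

lemma pfs_eta: "u \<in> slit \<Longrightarrow> pfs u eta"
  unfolding pfs_alt hat_eta[abs_def]
  by (intro tm.smn_linear[OF _ bounded_linear_snd] tm.smn_co) auto

text \<open>The fields \<open>ext \<kappa> u (axis i 1)\<close> form a frame over the whole domain
  of the chart of \<open>u\<close>, with the entries of \<open>hat u Y\<close> as coefficients.
  Unlike the standard basis at each point, this frame is smooth.\<close>

lemma frame_expand:
  assumes "fst w \<in> base.dom (fst u)"
  shows "(\<Sum>i\<in>UNIV. (hat u Y w $ i) *\<^sub>R ext \<kappa> u (axis i 1) w) = Y w"
proof -
  have "Y w = ext \<kappa> u (\<Sum>i\<in>UNIV. (hat u Y w $ i) *\<^sub>R axis i 1) w"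
    using ext_hat[OF assms] basis_expansion[of "hat u Y w"] by (simp add: scalar_mult_eq_scaleR)
  then show ?thesis
    by (simp add: linear_sum[OF ext_linear[OF assms]] linear_scale[OF ext_linear[OF assms]])
qed

lemma vfs_gam:
  assumes "u \<in> slit" "pfs u Y"
  shows "tm.vfs u (\<lambda>w. gam (Y w))"
  unfolding tm.vfs_alt
proof (rule tm.smn_eq[OF assms(1)])
  show "tm.smn u (\<lambda>w. (0, hat u Y w))"
    using assms by (intro tm.smn_Pair tm.smn_const) (auto simp: pfs_alt)
  show "\<forall>\<^sub>F w in tm.nb u. (0, hat u Y w) = tm.tc u w (gam (Y w))"
    using tm.ev_nb_self[OF assms(1)]
    by eventually_elim (simp add: gam_def tm_tc_gam[OF assms(1)] hat_def)
qed

end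

section \<open>Linear connections\<close>

context tangent
begin

text \<open>Near \<open>w\<close> the field is a combination of frame fields with smooth
  coefficients, and function-linearity takes these coefficients out at \<open>w\<close>. The
  hypothesis \<open>cong\<close> is needed since the expansion is an identity of germs. The target
  space is arbitrary so that vector-valued and scalar expressions are both covered.\<close>

lemma tensorial_eval:
  fixes F :: "('m, 'n) pfield \<Rightarrow> 'b::real_vector"
  assumes w: "w \<in> slit"
    and add: "\<And>X Y. pfs w X \<Longrightarrow> pfs w Y \<Longrightarrow> F (\<lambda>z. X z + Y z) = F X + F Y"
    and scale: "\<And>f X. tm.smn w f \<Longrightarrow> pfs w X \<Longrightarrow> F (\<lambda>z. f z *\<^sub>R X z) = f w *\<^sub>R F X"
    and cong: "\<And>X Y. pfs w X \<Longrightarrow> pfs w Y \<Longrightarrow> eventually (\<lambda>z. X z = Y z) (tm.nb w) \<Longrightarrow> F X = F Y"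
  shows "pfs w X \<Longrightarrow> F X = F (ext \<kappa> w (X w))"
    and "linear (\<lambda>x. F (ext \<kappa> w x))"
proof -
  have E: "pfs w (ext \<kappa> w v)" for v by (rule pfs_ext[OF w tm_mem[OF w]])
  have zero: "F (\<lambda>z. 0) = 0"
    using scale[OF tm.smn_const[OF w, of 0] pfs_zero[OF w]] by simp
  have sum: "F (\<lambda>z. \<Sum>i\<in>I. Y i z) = (\<Sum>i\<in>I. F (Y i))" if "\<And>i. pfs w (Y i)" for I :: "'n set" and Y
  proof -
    have "finite I" by simp
    then show ?thesis
      by (induction I) (use that zero in \<open>auto simp: add pfs_sum w\<close>)
  qed
  have key: "F X = (\<Sum>i\<in>UNIV. (X w $ i) *\<^sub>R F (ext \<kappa> w (axis i 1)))" if "pfs w X" for X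
  proof -
    have c: "tm.smn w (\<lambda>z. hat w X z $ i)" for i
      using tm.smn_nth[OF w] that unfolding pfs_alt by blast
    have s: "pfs w (\<lambda>z. (hat w X z $ i) *\<^sub>R ext \<kappa> w (axis i 1) z)" for i
      by (intro pfs_scaleR w c E)
    have "eventually (\<lambda>z. X z = (\<Sum>i\<in>UNIV. (hat w X z $ i) *\<^sub>R ext \<kappa> w (axis i 1) z)) (tm.nb w)"
      using tm.ev_nb_self[OF w] by eventually_elim (simp add: slit_dom frame_expand)
    then have "F X = F (\<lambda>z. \<Sum>i\<in>UNIV. (hat w X z $ i) *\<^sub>R ext \<kappa> w (axis i 1) z)"
      by (rule cong[OF that pfs_sum[OF w s]])
    then show ?thesis by (simp add: sum[OF s] scale[OF c E])
  qed
  define G where "G v = (\<Sum>i\<in>UNIV. (v $ i) *\<^sub>R F (ext \<kappa> w (axis i 1)))" for v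
  have G: "F (ext \<kappa> w v) = G v" for v using key[OF E, of v] unfolding G_def by simp
  show "F X = F (ext \<kappa> w (X w))" if "pfs w X" using key[OF that] G[of "X w"] unfolding G_def by simp
  show "linear (\<lambda>x. F (ext \<kappa> w x))"
    by (rule linearI) (simp_all add: G, simp_all add: G_def scaleR_add_left sum.distrib scaleR_sum_right)
qed

end

locale connection = tangent \<kappa>
  for \<kappa> :: "'m::{t2_space, second_countable_topology} \<Rightarrow> ('m, real ^ 'n::finite) chart" +
  fixes D :: "('m, 'n) connection"
  assumes linear_conn: "linear_connection \<kappa> D"
begin

context
  fixes u :: "('m, 'n) tpoint" assumes u: "u \<in> slit"
begin

lemma D_linear: "pfs u Y \<Longrightarrow> linear (\<lambda>X. D u X Y)"
  and D_add: "pfs u Y \<Longrightarrow> pfs u Z \<Longrightarrow> D u X (\<lambda>w. Y w + Z w) = D u X Y + D u X Z"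
  and D_scaleR: "tm.smn u f \<Longrightarrow> pfs u Y \<Longrightarrow>
    D u X (\<lambda>w. f w *\<^sub>R Y w) = dirT u X f *\<^sub>R Y u + f u *\<^sub>R D u X Y"
  and pfs_D: "tm.vfs u V \<Longrightarrow> pfs u Y \<Longrightarrow> pfs u (\<lambda>w. D w (V w) Y)"
  using linear_conn u unfolding linear_connection_def by blast+

text \<open>The Leibniz rule is assumed for all functions that are smooth near the point. Hence the
  indicator function of the set where the sections agree takes the place of a bump function.\<close>

lemma D_cong:
  assumes "pfs u Y" "eventually (\<lambda>w. Y w = Y' w) (tm.nb u)"
  shows "D u X Y = D u X Y'"
proof -
  let ?f = "\<lambda>w. if Y w = Y' w then 1 else 0 :: real"
  have f1: "eventually (\<lambda>w. ?f w = 1) (tm.nb u)" using assms(2) by eventually_elim simp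
  have f: "tm.smn u ?f" using tm.smn_cong[OF u f1] u by simp
  have "dirT u X ?f = 0" using tm.dd_cong[OF u f1] u by simp
  moreover have "?f u = 1" using tm.ev_nb_at[OF u assms(2)] by simp
  ultimately have Z: "D u X (\<lambda>w. ?f w *\<^sub>R Z w) = D u X Z" if "pfs u Z" for Z
    unfolding D_scaleR[OF f that, of X] by simp
  have "(\<lambda>w. ?f w *\<^sub>R Y w) = (\<lambda>w. ?f w *\<^sub>R Y' w)" by auto
  then show ?thesis using Z[OF assms(1)] Z[OF pfs_cong[OF u assms(2,1)]] by simp
qed

lemma D_zero [simp]: "D u X (\<lambda>w. 0) = 0"
  using D_scaleR[OF tm.smn_const[OF u, of 0] pfs_zero[OF u]] tm.dd_const[OF u] by simp

lemma D_cmult: "pfs u Y \<Longrightarrow> D u X (\<lambda>w. c *\<^sub>R Y w) = c *\<^sub>R D u X Y"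
  using D_scaleR[OF tm.smn_const[OF u, of c], of Y] tm.dd_const[OF u] by simp

lemma D_diff: "pfs u Y \<Longrightarrow> pfs u Z \<Longrightarrow> D u X (\<lambda>w. Y w - Z w) = D u X Y - D u X Z"
  using D_add[OF _ pfs_minus[OF u], of Y Z X] D_cmult[of Z X "-1"] by simp

lemma D_sum: "(\<And>i. i \<in> I \<Longrightarrow> pfs u (Y i)) \<Longrightarrow> D u X (\<lambda>w. \<Sum>i\<in>I. Y i w) = (\<Sum>i\<in>I. D u X (Y i))"
  by (induction I rule: infinite_finite_induct) (simp_all add: D_add pfs_sum u)

end

text \<open>The Leibniz rule in the frame of \<open>u\<close>, used at points \<open>w\<close> other
  than \<open>u\<close> as well. It reduces statements on \<open>D\<close> to derivatives of
  coefficients and to the values on frame fields, the connection coefficients.\<close>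

lemma D_expand:
  assumes "u \<in> slit" "w \<in> tm.dom u" "pfs w Y"
  shows "D w X Y = (\<Sum>i\<in>UNIV. dirT w X (\<lambda>z. hat u Y z $ i) *\<^sub>R ext \<kappa> u (axis i 1) w
    + (hat u Y w $ i) *\<^sub>R D w X (ext \<kappa> u (axis i 1)))"
proof -
  note w = tm.dom_S[OF assms(1,2)]
  have c: "tm.smn w (\<lambda>z. hat u Y z $ i)" for i
    using tm.smn_nth[OF w] assms(3) unfolding pfs_chart[OF assms(1,2)] by blast
  note E = pfs_ext[OF assms(1,2)]
  have s: "pfs w (\<lambda>z. (hat u Y z $ i) *\<^sub>R ext \<kappa> u (axis i 1) z)" for i
    by (intro pfs_scaleR w c E)
  have "eventually (\<lambda>z. Y z = (\<Sum>i\<in>UNIV. (hat u Y z $ i) *\<^sub>R ext \<kappa> u (axis i 1) z)) (tm.nb w)"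
    using tm.ev_nb_dom[OF assms(1,2)] by eventually_elim (simp add: slit_dom frame_expand)
  then have "D w X Y = D w X (\<lambda>z. \<Sum>i\<in>UNIV. (hat u Y z $ i) *\<^sub>R ext \<kappa> u (axis i 1) z)"
    by (rule D_cong[OF w assms(3)])
  then show ?thesis by (simp add: D_sum[OF w s] D_scaleR[OF w c E])
qed

end

section \<open>Regular connections and the horizontal lift\<close>

locale regular = connection \<kappa> D
  for \<kappa> :: "'m::{t2_space, second_countable_topology} \<Rightarrow> ('m, real ^ 'n::finite) chart" and D +
  assumes regular_conn: "regular_connection D"
begin

context
  fixes u :: "('m, 'n) tpoint" assumes u: "u \<in> slit"
begin

lemma vertical_horizontal:
  assumes "D u X eta = 0" "fst X = 0"
  shows "X = 0"
  using regular_conn u assms unfolding regular_connection_def vertical_def horizontal_def rho_def by blast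

lemma beta_unique:
  assumes "D u X eta = 0" "D u Y eta = 0" "fst X = fst Y"
  shows "X = Y"
  using vertical_horizontal[of "X - Y"] assms linear_diff[OF D_linear[OF u pfs_eta[OF u]], of X Y] by simp

lemma beta_props: "D u (beta D u v) eta = 0 \<and> fst (beta D u v) = v"
proof -
  obtain V H where "V \<in> vertical" "H \<in> horizontal D u" "(v, 0) = V + H"
    using regular_conn u unfolding regular_connection_def by blast
  then have H: "D u H eta = 0 \<and> fst H = v"
    unfolding vertical_def horizontal_def rho_def by (auto simp: plus_prod_def)
  have "\<exists>!X. X \<in> horizontal D u \<and> rho X = v"
    unfolding horizontal_def rho_def using H beta_unique by blast
  from theI'[OF this] show ?thesis unfolding beta_def horizontal_def rho_def by blast
qed

lemma D_beta_eta [simp]: "D u (beta D u v) eta = 0" and fst_beta [simp]: "fst (beta D u v) = v"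
  using beta_props by auto

lemma beta_eqI: "D u X eta = 0 \<Longrightarrow> fst X = v \<Longrightarrow> beta D u v = X"
  by (rule beta_unique) auto

lemma beta_linear: "linear (beta D u)"
proof (rule linearI)
  note l = D_linear[OF u pfs_eta[OF u]]
  show "beta D u (x + y) = beta D u x + beta D u y" for x y
    by (rule beta_eqI) (simp_all add: linear_add[OF l])
  show "beta D u (c *\<^sub>R x) = c *\<^sub>R beta D u x" for c x
    by (rule beta_eqI) (simp_all add: linear_scale[OF l])
qed

lemma D_gam_eta_0:
  assumes "D u (gam v) eta = 0" shows "v = 0"
  using vertical_horizontal[of "gam v"] assms unfolding gam_def by (simp add: zero_prod_def)

end

lemma vfs_hlift:
  assumes u: "u \<in> slit" and X: "pfs u X"
  shows "tm.vfs u (hlift D X)"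
proof -
  \<comment> \<open>A first smooth lift of \<open>X\<close>, with zero fibre components in the chart
    of \<open>u\<close>. Only a vertical correction is missing for it to become horizontal.\<close>
  define Z where "Z = (\<lambda>w. frechet_derivative (tm.tr u w) (at (tm.co u w)) (hat u X w, 0))"
  have tcZ: "tm.tc u w (Z w) = (hat u X w, 0)" if "w \<in> tm.dom u" for w
    unfolding Z_def by (rule tm.tr_tc_inverse(2)[OF u that])
  have Z: "tm.vfs u Z" unfolding tm.vfs_alt
  proof (rule tm.smn_eq[OF u])
    show "tm.smn u (\<lambda>w. (hat u X w, 0))"
      using X by (intro tm.smn_Pair u tm.smn_const) (simp_all add: pfs_alt)
    show "\<forall>\<^sub>F w in tm.nb u. (hat u X w, 0) = tm.tc u w (Z w)"
      using tm.ev_nb_self[OF u] by eventually_elim (simp add: tcZ)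
  qed
  have fstZ: "fst (Z w) = X w" if "w \<in> tm.dom u" for w
  proof -
    have "hat u (\<lambda>w. fst (Z w)) w = hat u X w"
      using tm_tc_fst[OF u that, of "Z w"] tcZ[OF that] by (simp add: hat_def)
    then show ?thesis
      using ext_hat[of w u "\<lambda>w. fst (Z w)"] ext_hat[of w u X] that by (simp add: slit_dom)
  qed
  \<comment> \<open>\<open>M w\<close> is the matrix, in the frame of \<open>u\<close>, of the map
    sending \<open>v\<close> to the derivative of \<eta> along \<gamma>v. The correction
    \<open>V\<close> solves the linear system with this matrix and right-hand side the derivative of
    \<eta> along \<open>Z\<close>.\<close>
  define M :: "('m, 'n) tpoint \<Rightarrow> real ^ 'n ^ 'n"
    where "M w = (\<chi> i j. hat u (\<lambda>w. D w (gam (ext \<kappa> u (axis j 1) w)) eta) w $ i)" for w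
  define b where "b = hat u (\<lambda>w. D w (Z w) eta)"
  define V where "V w = ext \<kappa> u (matrix_inv (M w) *v b w) w" for w
  have E: "pfs u (ext \<kappa> u v)" for v by (rule pfs_ext[OF u tm_mem[OF u]])
  have sD: "pfs u (\<lambda>w. D w (gam (ext \<kappa> u v w)) eta)" for v
    by (rule pfs_D[OF u vfs_gam[OF u E] pfs_eta[OF u]])
  have sM: "tm.smn u M"
    by (intro tm.smn_vec u) (simp add: M_def tm.smn_nth[OF u sD[unfolded pfs_alt]])
  have sb: "tm.smn u b"
    using pfs_D[OF u Z pfs_eta[OF u]] unfolding b_def pfs_alt .
  have M_mult: "hat u (\<lambda>w. D w (gam (ext \<kappa> u c w)) eta) w = M w *v c" if "w \<in> tm.dom u" for w c
  proof -
    have w: "w \<in> slit" "fst w \<in> base.dom (fst u)" using that slit_dom by auto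
    have "linear (\<lambda>v. gam v :: (real ^ 'n) \<times> (real ^ 'n))"
      by (rule linearI) (simp_all add: gam_def)
    from linear_compose[OF linear_compose[OF linear_compose[OF ext_linear[OF w(2)] this]
        D_linear[OF w(1) pfs_eta[OF w(1)]]] hat_linear[OF w(2)]]
    have l: "linear (\<lambda>c. hat u (\<lambda>w. D w (gam (ext \<kappa> u c w)) eta) w)"
      by (simp add: o_def hat_def)
    have "M w = matrix (\<lambda>c. hat u (\<lambda>w. D w (gam (ext \<kappa> u c w)) eta) w)"
      by (simp add: M_def matrix_def)
    then show ?thesis using matrix_works[OF l[folded linear_matrix_vector_mul_eq], of c] by simp
  qed
  \<comment> \<open>Regularity enters here: a vector in the kernel would be vertical and horizontal
    at once.\<close>
  have det: "det (M w) \<noteq> 0" if "w \<in> tm.dom u" for w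
  proof -
    have w: "w \<in> slit" "fst w \<in> base.dom (fst u)" using that slit_dom by auto
    have "c = 0" if "M w *v c = 0" for c
    proof -
      have "base.tc (fst u) (fst w) (D w (gam (ext \<kappa> u c w)) eta) = 0"
        using M_mult[OF \<open>w \<in> tm.dom u\<close>, of c] that unfolding hat_def by simp
      then have "ext \<kappa> u c w = 0" using tc_eq_0_iff[OF w(2)] D_gam_eta_0[OF w(1)] by blast
      then show ?thesis using frame_eq_0_iff[OF w(2)] unfolding ext_alt by blast
    qed
    then show ?thesis
      using matrix_left_invertible_ker[of "M w"] invertible_left_inverse[of "M w"] invertible_det_nz[of "M w"] by blast
  qed
  have hatV: "hat u V w = matrix_inv (M w) *v b w" if "w \<in> tm.dom u" for w
    unfolding V_def hat_def using hat_ext[of w u "matrix_inv (M w) *v b w"] that by (simp add: slit_dom hat_def)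
  have V: "pfs u V" unfolding pfs_alt
  proof (rule tm.smn_eq[OF u])
    show "\<forall>\<^sub>F w in tm.nb u. matrix_inv (M w) *v b w = hat u V w"
      using tm.ev_nb_self[OF u] by eventually_elim (simp add: hatV)
    have "tm.smn u (\<lambda>w. matrix_inv (M w))"
      by (rule tm.smn_matrix_inv[OF u sM det[OF tm_mem[OF u]]])
    then show "tm.smn u (\<lambda>w. matrix_inv (M w) *v b w)"
      unfolding matrix_vector_mult_def
      by (intro tm.smn_vec u) (simp, intro tm.smn_sum tm.smn_mult tm.smn_nth u sb)
  qed
  have main: "hlift D X w = Z w + (-1) *\<^sub>R gam (V w)" if "w \<in> tm.dom u" for w
  proof -
    have w: "w \<in> slit" "fst w \<in> base.dom (fst u)" using that slit_dom by auto
    note l = D_linear[OF w(1) pfs_eta[OF w(1)]]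
    have "hat u (\<lambda>w. D w (gam (V w)) eta) w = M w *v (matrix_inv (M w) *v b w)"
      using M_mult[OF that, of "matrix_inv (M w) *v b w"] by (simp add: V_def hat_def)
    also have "\<dots> = b w"
      by (simp add: matrix_vector_mul_assoc matrix_inv_left_right[OF det[OF that]])
    finally have "D w (gam (V w)) eta = D w (Z w) eta"
      using ext_hat[OF w(2), of "\<lambda>w. D w (gam (V w)) eta"] ext_hat[OF w(2), of "\<lambda>w. D w (Z w) eta"]
      by (simp add: b_def)
    then show ?thesis
      unfolding hlift_def
      by (intro beta_eqI w) (simp_all add: linear_diff[OF l] fstZ[OF that], simp add: gam_def)
  qed
  have "tm.vfs u (\<lambda>w. Z w + (-1) *\<^sub>R gam (V w))"
    by (intro tm.vfs_add tm.vfs_scaleR vfs_gam V Z u tm.smn_const)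
  then show ?thesis
    by (rule tm.vfs_cong[OF u, rotated]) (use tm.ev_nb_self[OF u] in \<open>eventually_elim, simp add: main\<close>)
qed

lemma pfs_D_hlift: "u \<in> slit \<Longrightarrow> pfs u X \<Longrightarrow> pfs u Y \<Longrightarrow> pfs u (\<lambda>w. D w (hlift D X w) Y)"
  by (rule pfs_D[OF _ vfs_hlift])

subsection \<open>The h-curvature is a smooth tensor field\<close>

abbreviation hK :: "('m, 'n) pfield \<Rightarrow> ('m, 'n) pfield \<Rightarrow> ('m, 'n) pfield \<Rightarrow> ('m, 'n) pfield" where
  "hK X Y Z \<equiv> curvature \<kappa> D (hlift D X) (hlift D Y) Z"

context
  fixes u :: "('m, 'n) tpoint" assumes u: "u \<in> slit"
begin

lemma hK_swap:
  assumes "pfs u X" "pfs u Y" "pfs u Z"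
  shows "hK X Y Z u = - hK Y X Z u"
  unfolding curvature_def tm.lie_bracket_swap[of "hlift D X"]
  by (simp add: linear_neg[OF D_linear[OF u assms(3)]])

lemma pfs_hK:
  assumes "pfs u X" "pfs u Y" "pfs u Z"
  shows "pfs u (hK X Y Z)"
  unfolding curvature_def[abs_def]
  by (intro pfs_add pfs_minus u pfs_D tm.vfs_lie_bracket vfs_hlift assms)

lemma hK_add2:
  assumes "pfs u X" "pfs u Y" "pfs u Y'" "pfs u Z"
  shows "hK X (\<lambda>w. Y w + Y' w) Z u = hK X Y Z u + hK X Y' Z u"
proof -
  note l = D_linear[OF u assms(4)]
  note v = vfs_hlift[OF u assms(1)] vfs_hlift[OF u assms(2)] vfs_hlift[OF u assms(3)]
  have e: "eventually (\<lambda>w. hlift D (\<lambda>w. Y w + Y' w) w = hlift D Y w + hlift D Y' w) (tm.nb u)"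
    using tm.ev_nb_S[OF u] by eventually_elim (simp add: hlift_def linear_add[OF beta_linear])
  have b: "lie_bracket (tchart \<kappa>) (hlift D X) (hlift D (\<lambda>w. Y w + Y' w)) u
    = lie_bracket (tchart \<kappa>) (hlift D X) (hlift D Y) u + lie_bracket (tchart \<kappa>) (hlift D X) (hlift D Y') u"
    using tm.lie_bracket_cong[OF u _ e, of "hlift D X" "hlift D X"] tm.lie_bracket_add[OF u v] by simp
  have "eventually (\<lambda>w. D w (hlift D Y w) Z + D w (hlift D Y' w) Z = D w (hlift D (\<lambda>w. Y w + Y' w) w) Z) (tm.nb u)"
    using e pfs_ev[OF u assms(4)] tm.ev_nb_S[OF u]
    by eventually_elim (simp add: linear_add[OF D_linear])
  from D_cong[OF u pfs_add[OF u pfs_D_hlift[OF u assms(2,4)] pfs_D_hlift[OF u assms(3,4)]] this, of "hlift D X u"]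
  have d: "D u (hlift D X u) (\<lambda>w. D w (hlift D (\<lambda>w. Y w + Y' w) w) Z)
    = D u (hlift D X u) (\<lambda>w. D w (hlift D Y w) Z) + D u (hlift D X u) (\<lambda>w. D w (hlift D Y' w) Z)"
    using D_add[OF u pfs_D_hlift[OF u assms(2,4)] pfs_D_hlift[OF u assms(3,4)]] by simp
  show ?thesis
    unfolding curvature_def b d tm.ev_nb_at[OF u e] linear_add[OF l]
      linear_add[OF D_linear[OF u pfs_D_hlift[OF u assms(1,4)]]] by simp
qed

text \<open>The derivative of \<open>f\<close> arising from the outer derivative of \<open>f\<close>
  times \<nabla>Z cancels the one arising from the bracket with \<open>f\<close> times the second
  field.\<close>

lemma hK_scaleR2:
  assumes "pfs u X" "tm.smn u f" "pfs u Y" "pfs u Z"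
  shows "hK X (\<lambda>w. f w *\<^sub>R Y w) Z u = f u *\<^sub>R hK X Y Z u"
proof -
  note l = D_linear[OF u assms(4)]
  note v = vfs_hlift[OF u assms(1)] vfs_hlift[OF u assms(3)]
  have e: "eventually (\<lambda>w. hlift D (\<lambda>w. f w *\<^sub>R Y w) w = f w *\<^sub>R hlift D Y w) (tm.nb u)"
    using tm.ev_nb_S[OF u] by eventually_elim (simp add: hlift_def linear_scale[OF beta_linear])
  have b: "lie_bracket (tchart \<kappa>) (hlift D X) (hlift D (\<lambda>w. f w *\<^sub>R Y w)) u
    = dirT u (hlift D X u) f *\<^sub>R hlift D Y u + f u *\<^sub>R lie_bracket (tchart \<kappa>) (hlift D X) (hlift D Y) u"
    using tm.lie_bracket_cong[OF u _ e, of "hlift D X" "hlift D X"] tm.lie_bracket_scaleR[OF u v assms(2)] by simp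
  have "eventually (\<lambda>w. f w *\<^sub>R D w (hlift D Y w) Z = D w (hlift D (\<lambda>w. f w *\<^sub>R Y w) w) Z) (tm.nb u)"
    using e pfs_ev[OF u assms(4)] tm.ev_nb_S[OF u]
    by eventually_elim (simp add: linear_scale[OF D_linear])
  from D_cong[OF u pfs_scaleR[OF u assms(2) pfs_D_hlift[OF u assms(3,4)]] this, of "hlift D X u"]
  have d: "D u (hlift D X u) (\<lambda>w. D w (hlift D (\<lambda>w. f w *\<^sub>R Y w) w) Z)
    = dirT u (hlift D X u) f *\<^sub>R D u (hlift D Y u) Z + f u *\<^sub>R D u (hlift D X u) (\<lambda>w. D w (hlift D Y w) Z)"
    using D_scaleR[OF u assms(2) pfs_D_hlift[OF u assms(3,4)]] by simp
  show ?thesis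
    unfolding curvature_def b d tm.ev_nb_at[OF u e] linear_add[OF l] linear_scale[OF l]
      linear_scale[OF D_linear[OF u pfs_D_hlift[OF u assms(1,4)]]] by (simp add: algebra_simps)
qed

lemma hK_cong2:
  assumes "pfs u X" "pfs u Y" "pfs u Y'" "pfs u Z" "eventually (\<lambda>w. Y w = Y' w) (tm.nb u)"
  shows "hK X Y Z u = hK X Y' Z u"
proof -
  have e: "eventually (\<lambda>w. hlift D Y w = hlift D Y' w) (tm.nb u)"
    using assms(5) by eventually_elim (simp add: hlift_def)
  then have "eventually (\<lambda>w. D w (hlift D Y w) Z = D w (hlift D Y' w) Z) (tm.nb u)"
    by eventually_elim simp
  from D_cong[OF u pfs_D_hlift[OF u assms(2,4)] this, of "hlift D X u"]
  show ?thesis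
    unfolding curvature_def tm.ev_nb_at[OF u e]
    using tm.lie_bracket_cong[OF u _ e, of "hlift D X" "hlift D X"] by simp
qed

lemma hK_add3:
  assumes "pfs u X" "pfs u Y" "pfs u Z" "pfs u Z'"
  shows "hK X Y (\<lambda>w. Z w + Z' w) u = hK X Y Z u + hK X Y Z' u"
proof -
  have d: "D u V (\<lambda>w. D w (hlift D Y w) (\<lambda>w. Z w + Z' w))
    = D u V (\<lambda>w. D w (hlift D Y w) Z) + D u V (\<lambda>w. D w (hlift D Y w) Z')" if "pfs u Y" for V Y
  proof -
    have "eventually (\<lambda>w. D w (hlift D Y w) Z + D w (hlift D Y w) Z' = D w (hlift D Y w) (\<lambda>w. Z w + Z' w)) (tm.nb u)"
      using pfs_ev[OF u assms(3)] pfs_ev[OF u assms(4)] tm.ev_nb_S[OF u]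
      by eventually_elim (simp add: D_add)
    from D_cong[OF u pfs_add[OF u pfs_D_hlift[OF u that assms(3)] pfs_D_hlift[OF u that assms(4)]] this, of V]
    show ?thesis using D_add[OF u pfs_D_hlift[OF u that assms(3)] pfs_D_hlift[OF u that assms(4)]] by simp
  qed
  show ?thesis unfolding curvature_def d[OF assms(1)] d[OF assms(2)] D_add[OF u assms(3,4)] by simp
qed

text \<open>First derivatives of \<open>f\<close> cancel between the two orders of differentiation.
  The commutator of its second derivatives is the derivative along the bracket, which the last term
  of the curvature removes.\<close>

lemma hK_scaleR3:
  assumes "pfs u X" "pfs u Y" "tm.smn u f" "pfs u Z"
  shows "hK X Y (\<lambda>w. f w *\<^sub>R Z w) u = f u *\<^sub>R hK X Y Z u"
proof -
  have d: "D u V (\<lambda>w. D w (hlift D Y w) (\<lambda>w. f w *\<^sub>R Z w))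
    = dirT u V (\<lambda>w. dirT w (hlift D Y w) f) *\<^sub>R Z u
      + dirT u (hlift D Y u) f *\<^sub>R D u V Z
      + (dirT u V f *\<^sub>R D u (hlift D Y u) Z + f u *\<^sub>R D u V (\<lambda>w. D w (hlift D Y w) Z))"
    if "pfs u Y" for V Y
  proof -
    note Yf = tm.dd_field(1)[OF u vfs_hlift[OF u that] assms(3)]
    note DZ = pfs_D_hlift[OF u that assms(4)]
    have "eventually (\<lambda>w. dirT w (hlift D Y w) f *\<^sub>R Z w + f w *\<^sub>R D w (hlift D Y w) Z
        = D w (hlift D Y w) (\<lambda>w. f w *\<^sub>R Z w)) (tm.nb u)"
      using pfs_ev[OF u assms(4)] tm.smn_ev[OF u assms(3)] tm.ev_nb_S[OF u]
      by eventually_elim (simp add: D_scaleR)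
    from D_cong[OF u pfs_add[OF u pfs_scaleR[OF u Yf assms(4)] pfs_scaleR[OF u assms(3) DZ]] this, of V]
    show ?thesis
      using D_add[OF u pfs_scaleR[OF u Yf assms(4)] pfs_scaleR[OF u assms(3) DZ], of V]
        D_scaleR[OF u Yf assms(4)] D_scaleR[OF u assms(3) DZ] by simp
  qed
  note c = tm.lie_bracket_commutator[OF u vfs_hlift[OF u assms(1)] vfs_hlift[OF u assms(2)] assms(3)]
  show ?thesis
    unfolding curvature_def d[OF assms(1)] d[OF assms(2)] D_scaleR[OF u assms(3,4)] c
    by (simp add: algebra_simps)
qed

lemma hK_cong3:
  assumes "pfs u X" "pfs u Y" "pfs u Z" "pfs u Z'" "eventually (\<lambda>w. Z w = Z' w) (tm.nb u)"
  shows "hK X Y Z u = hK X Y Z' u"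
proof -
  have d: "D u V (\<lambda>w. D w (hlift D Y w) Z) = D u V (\<lambda>w. D w (hlift D Y w) Z')" if "pfs u Y" for V Y
  proof (rule D_cong[OF u pfs_D_hlift[OF u that assms(3)]])
    show "\<forall>\<^sub>F w in tm.nb u. D w (hlift D Y w) Z = D w (hlift D Y w) Z'"
      using tm.ev_nb_nb[OF u assms(5)] pfs_ev[OF u assms(3)] tm.ev_nb_S[OF u]
      by eventually_elim (rule D_cong)
  qed
  show ?thesis
    unfolding curvature_def d[OF assms(1)] d[OF assms(2)] D_cong[OF u assms(3,5)] by simp
qed

text \<open>Tensoriality was shown in the second and third arguments only; the first is exchanged
  with the second by antisymmetry, replaced, and exchanged back.\<close>

lemma hK_eval:
  assumes X: "pfs u X" and Y: "pfs u Y" and Z: "pfs u Z"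
  shows "hK X Y Z u = hcurv \<kappa> D u (X u) (Y u) (Z u)"
proof -
  have E: "pfs u (ext \<kappa> u v)" for v by (rule pfs_ext[OF u tm_mem[OF u]])
  have 2: "hK X Y Z u = hK X (ext \<kappa> u (Y u)) Z u" if "pfs u X" "pfs u Y" "pfs u Z" for X Y Z
    by (rule tensorial_eval(1)[of u "\<lambda>Y. hK X Y Z u"], rule u,
        rule hK_add2[OF that(1) _ _ that(3)], assumption+,
        rule hK_scaleR2[OF that(1) _ _ that(3)], assumption+,
        rule hK_cong2[OF that(1) _ _ that(3)], assumption+, rule that(2))
  have 3: "hK X Y Z u = hK X Y (ext \<kappa> u (Z u)) u" if "pfs u X" "pfs u Y" "pfs u Z" for X Y Z
    by (rule tensorial_eval(1)[of u "\<lambda>Z. hK X Y Z u"], rule u,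
        rule hK_add3[OF that(1,2)], assumption+,
        rule hK_scaleR3[OF that(1,2)], assumption+,
        rule hK_cong3[OF that(1,2)], assumption+, rule that(3))
  have "hK X Y Z u = - hK Y X Z u" by (rule hK_swap[OF X Y Z])
  also have "\<dots> = - hK Y (ext \<kappa> u (X u)) Z u" using 2[OF Y X Z] by simp
  also have "\<dots> = hK (ext \<kappa> u (X u)) Y Z u" using hK_swap[OF E Y Z] by simp
  also have "\<dots> = hK (ext \<kappa> u (X u)) (ext \<kappa> u (Y u)) Z u" by (rule 2[OF E Y Z])
  also have "\<dots> = hK (ext \<kappa> u (X u)) (ext \<kappa> u (Y u)) (ext \<kappa> u (Z u)) u" by (rule 3[OF E E Z])
  finally show ?thesis unfolding hcurv_def .
qed

lemma pfs_ext_self: "pfs u (ext \<kappa> u v)"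
  by (rule pfs_ext[OF u tm_mem[OF u]])

lemma hcurv_swap: "hcurv \<kappa> D u x y z = - hcurv \<kappa> D u y x z"
  unfolding hcurv_def by (rule hK_swap; rule pfs_ext[OF u tm_mem[OF u]])

lemma hcurv_linear2: "linear (\<lambda>y. hcurv \<kappa> D u x y z)"
  unfolding hcurv_def
  by (rule tensorial_eval(2)[of u "\<lambda>Y. hK (ext \<kappa> u x) Y (ext \<kappa> u z) u"], rule u,
      rule hK_add2[OF pfs_ext_self _ _ pfs_ext_self], assumption+,
      rule hK_scaleR2[OF pfs_ext_self _ _ pfs_ext_self], assumption+,
      rule hK_cong2[OF pfs_ext_self _ _ pfs_ext_self], assumption+)

lemma hcurv_linear3: "linear (\<lambda>z. hcurv \<kappa> D u x y z)"
  unfolding hcurv_def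
  by (rule tensorial_eval(2)[of u "\<lambda>Z. hK (ext \<kappa> u x) (ext \<kappa> u y) Z u"], rule u,
      rule hK_add3[OF pfs_ext_self pfs_ext_self], assumption+,
      rule hK_scaleR3[OF pfs_ext_self pfs_ext_self], assumption+,
      rule hK_cong3[OF pfs_ext_self pfs_ext_self], assumption+)

lemma hcurv_linear1: "linear (\<lambda>x. hcurv \<kappa> D u x y z)"
  unfolding hcurv_swap[of _ y z] by (intro linear_compose_neg hcurv_linear2)

end

text \<open>At each nearby point \<open>hcurv\<close> uses extensions belonging to that point.
  Tensoriality identifies its value with the curvature of the fixed fields \<open>X\<close>,
  \<open>Y\<close>, \<open>Z\<close>, which is smooth.\<close>

lemma pfs_hcurv:
  assumes u: "u \<in> slit" and "pfs u X" "pfs u Y" "pfs u Z"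
  shows "pfs u (\<lambda>w. hcurv \<kappa> D w (X w) (Y w) (Z w))"
proof (rule pfs_cong[OF u _ pfs_hK[OF assms]])
  show "\<forall>\<^sub>F w in tm.nb u. hK X Y Z w = hcurv \<kappa> D w (X w) (Y w) (Z w)"
    using tm.ev_nb_S[OF u] pfs_ev[OF u assms(2)] pfs_ev[OF u assms(3)] pfs_ev[OF u assms(4)]
    by eventually_elim (rule hK_eval)
qed

end

section \<open>The Finsler metric\<close>

text \<open>One map plays three roles: the dilation on points, its expression in a bundle chart,
  and, being linear there, its differential on tangent vectors.\<close>

abbreviation sc :: "real \<Rightarrow> 'a \<times> (real ^ 'n) \<Rightarrow> 'a \<times> (real ^ 'n)" where
  "sc c z \<equiv> (fst z, c *\<^sub>R snd z)"

lemma bounded_linear_sc: "bounded_linear (sc c :: (real ^ 'n) \<times> (real ^ 'n) \<Rightarrow> (real ^ 'n) \<times> (real ^ 'n))"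
  by (intro bounded_linear_Pair bounded_linear_fst bounded_linear_scaleR_right[THEN bounded_linear_compose] bounded_linear_snd)

context tangent
begin

lemma tm_ci_fibre: "y \<noteq> 0 \<Longrightarrow> tm.ci (p, y') (base.co p p, y) = (p, y)"
  using tchart_inv[of p "(p, y')" y] by (simp add: base.tr_self)

lemma eventually_nonzero: "y \<noteq> (0::real ^ 'n) \<Longrightarrow> eventually (\<lambda>z. z \<noteq> 0) (nhds y)"
  using t1_space_nhds[of y 0] by simp

lemma fibre_chain:
  assumes "smooth_at (x, J y) \<Psi>" "bounded_linear J"
  shows "frechet_derivative (\<lambda>z. \<Psi> (x :: real ^ 'n, J z :: real ^ 'n)) (at (y :: real ^ 'n)) v
      = frechet_derivative \<Psi> (at (x, J y)) (0, J v)"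
    and "smooth_at y (\<lambda>z. \<Psi> (x, J z))"
proof -
  have s: "smooth_at y (\<lambda>z. (x, J z))"
    by (intro smooth_at_Pair smooth_at_const smooth_at_bounded_linear assms)
  show "smooth_at y (\<lambda>z. \<Psi> (x, J z))"
    by (rule smooth_at_compose[OF assms(1) s])
  have "((\<lambda>z. (x, J z)) has_derivative (\<lambda>v. (0, J v))) (at y)"
    by (intro has_derivative_Pair has_derivative_const bounded_linear_imp_has_derivative assms)
  from frechet_derivative_eqI[OF this]
  show "frechet_derivative (\<lambda>z. \<Psi> (x, J z)) (at y) v = frechet_derivative \<Psi> (at (x, J y)) (0, J v)"
    using frechet_derivative_chain[OF assms(1) s] by simp
qed

text \<open>A bundle chart at \<open>(p, y)\<close> is the identity on the fibre over
  \<open>p\<close>, up to the base coordinate. This links vertical derivatives on the manifold to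
  the fibre derivatives by which the metric is defined.\<close>

lemma fibre_derivative:
  assumes y: "y \<noteq> 0" and f: "tm.smn (p, y) f"
  shows "smooth_at y (\<lambda>z. f (p, z))"
    and "dirT (p, y) (gam v) f = frechet_derivative (\<lambda>z. f (p, z)) (at y) v"
proof -
  have u: "(p, y) \<in> slit" using y by (simp add: slit_def)
  have co: "tm.co (p, y) (p, y) = (base.co p p, y)" by (simp add: tchart_map)
  have s: "smooth_at (base.co p p, y) (\<lambda>\<xi>. f (tm.ci (p, y) \<xi>))"
    using f[unfolded tm.smn_self[OF u]] by (simp add: co)
  have e: "eventually (\<lambda>z. f (tm.ci (p, y) (base.co p p, z)) = f (p, z)) (nhds y)"
    using eventually_nonzero[OF y] by eventually_elim (simp add: tm_ci_fibre)
  show "smooth_at y (\<lambda>z. f (p, z))"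
    by (rule smooth_at_eq[OF e fibre_chain(2)[OF s bounded_linear_ident]])
  show "dirT (p, y) (gam v) f = frechet_derivative (\<lambda>z. f (p, z)) (at y) v"
    using fibre_chain(1)[OF s bounded_linear_ident, of v] frechet_derivative_cong[OF e]
    by (simp add: tm.dd_self co gam_def)
qed


subsection \<open>Fibre dilations\<close>

lemma sc_slit: "u \<in> slit \<Longrightarrow> c > 0 \<Longrightarrow> sc c u \<in> slit"
  by (simp add: slit_def)

text \<open>Bundle charts depend on the base point only, so a point and its dilate use the same
  chart and their tangent vectors can be compared component by component.\<close>

lemma tchart_sc: "tchart \<kappa> (sc c u) = tchart \<kappa> u"
  unfolding tchart_def by simp

lemma sc_dom: "w \<in> tm.dom u \<Longrightarrow> c > 0 \<Longrightarrow> sc c w \<in> tm.dom u"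
  by (auto simp: slit_dom slit_def)

lemma ext_sc: "ext \<kappa> (sc c u) = ext \<kappa> u" "ext \<kappa> u v (sc c w) = ext \<kappa> u v w"
  unfolding ext_def by (simp_all add: fun_eq_iff)

lemma co_sc: "w \<in> tm.dom u \<Longrightarrow> tm.co u (sc c w) = sc c (tm.co u w)"
  by (simp add: tchart_map slit_dom linear_scale[OF hat_linear])

lemma ci_sc:
  assumes "u \<in> slit" "c > 0" "\<xi> \<in> cran (tchart \<kappa> u)"
  shows "tm.ci u (sc c \<xi>) = sc c (tm.ci u \<xi>)"
proof -
  have d: "tm.ci u \<xi> \<in> tm.dom u" using tm.ci_dom[OF assms(3)] .
  have "sc c \<xi> = tm.co u (sc c (tm.ci u \<xi>))"
    using co_sc[OF d] tm.co_ci[OF assms(3)] by simp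
  then show ?thesis using tm.ci_co[OF assms(1) sc_dom[OF d assms(2)]] by simp
qed

context
  fixes u :: "('m, 'n) tpoint" and c :: real
  assumes u: "u \<in> slit" and c: "c > 0"
begin

lemma ev_ci_sc: "eventually (\<lambda>\<xi>. tm.ci u (sc c \<xi>) = sc c (tm.ci u \<xi>)) (nhds (tm.co u u))"
  using tm.ev_chart[OF u tm_mem[OF u]] by eventually_elim (simp add: ci_sc[OF u c])

lemma co_sc_self: "tm.co u (sc c u) = sc c (tm.co u u)"
  by (rule co_sc[OF tm_mem[OF u]])

lemma smn_sc:
  assumes "tm.smn (sc c u) f"
  shows "tm.smn u (\<lambda>w. f (sc c w))"
proof -
  have "smooth_at (sc c (tm.co u u)) (\<lambda>\<xi>. f (tm.ci u \<xi>))"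
    using assms[unfolded tm.smn_self[OF sc_slit[OF u c]] tchart_sc co_sc_self] .
  from smooth_at_compose[OF this smooth_at_bounded_linear[OF bounded_linear_sc]]
  have "smooth_at (tm.co u u) (\<lambda>\<xi>. f (tm.ci u (sc c \<xi>)))" .
  then show ?thesis unfolding tm.smn_self[OF u]
    by (rule smooth_at_eq[rotated]) (use ev_ci_sc in \<open>eventually_elim, simp\<close>)
qed

lemma dd_sc:
  assumes "tm.smn (sc c u) f"
  shows "dirT (sc c u) (sc c X) f = dirT u X (\<lambda>w. f (sc c w))"
proof -
  have s: "smooth_at (sc c (tm.co u u)) (\<lambda>\<xi>. f (tm.ci u \<xi>))"
    using assms[unfolded tm.smn_self[OF sc_slit[OF u c]] tchart_sc co_sc_self] .
  have "frechet_derivative (\<lambda>\<xi>. f (tm.ci u (sc c \<xi>))) (at (tm.co u u)) X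
    = frechet_derivative (\<lambda>\<xi>. f (tm.ci u \<xi>)) (at (sc c (tm.co u u))) (sc c X)"
    using frechet_derivative_chain[OF s smooth_at_bounded_linear[OF bounded_linear_sc]]
    by (simp add: frechet_derivative_bounded_linear[OF bounded_linear_sc])
  moreover have "frechet_derivative (\<lambda>\<xi>. f (tm.ci u (sc c \<xi>))) (at (tm.co u u))
    = frechet_derivative (\<lambda>\<xi>. f (sc c (tm.ci u \<xi>))) (at (tm.co u u))"
    by (rule frechet_derivative_cong) (use ev_ci_sc in \<open>eventually_elim, simp\<close>)
  ultimately show ?thesis unfolding tm.dd_self tchart_sc co_sc_self by simp
qed

lemma ev_sc:
  assumes "eventually P (tm.nb (sc c u))"
  shows "eventually (\<lambda>w. P (sc c w)) (tm.nb u)"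
proof -
  have "filterlim (\<lambda>\<xi>. sc c \<xi>) (nhds (sc c (tm.co u u))) (nhds (tm.co u u))"
    by (intro tendsto_intros filterlim_ident)
  from eventually_compose_filterlim[OF tm.ev_nbD[OF sc_slit[OF u c] assms, unfolded tchart_sc co_sc_self] this] ev_ci_sc
  have "eventually (\<lambda>\<xi>. P (sc c (tm.ci u \<xi>))) (nhds (tm.co u u))"
    by eventually_elim simp
  then show ?thesis using tm.ev_nb[OF u tm_mem[OF u]] by blast
qed

lemma hat_sc: "hat (sc c u) Y (sc c w) = hat u (\<lambda>w. Y (sc c w)) w"
  unfolding hat_def by simp

lemma pfs_sc:
  assumes "pfs (sc c u) Y"
  shows "pfs u (\<lambda>w. Y (sc c w))"
  using smn_sc[OF assms[unfolded pfs_alt]] unfolding pfs_alt hat_sc[abs_def] .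

end

end

section \<open>Smoothness, symmetry and homogeneity of the Finsler metric\<close>

locale finsler = tangent \<kappa>
  for \<kappa> :: "'m::{t2_space, second_countable_topology} \<Rightarrow> ('m, real ^ 'n::finite) chart" +
  fixes L :: "('m, 'n) tpoint \<Rightarrow> real"
  assumes finsler: "finsler_manifold \<kappa> L"
begin

lemma smn_L: "u \<in> slit \<Longrightarrow> tm.smn u L"
  using finsler unfolding finsler_manifold_def by blast

lemma smn_L2: "u \<in> slit \<Longrightarrow> tm.smn u (\<lambda>u. (L u)\<^sup>2)"
  using tm.smn_mult[of u L L] smn_L[of u] unfolding power2_eq_square by blast

lemma smooth_energy: "y \<noteq> 0 \<Longrightarrow> smooth_at y (\<lambda>z. (L (p, z))\<^sup>2)"
  using fibre_derivative(1)[OF _ smn_L2[of "(p, y)"]] by (simp add: slit_def)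

lemma energy_deriv_smooth:
  "y \<noteq> 0 \<Longrightarrow> smooth_at y (\<lambda>y. frechet_derivative (\<lambda>z. (L (p, z))\<^sup>2) (at y) v)"
  by (rule smooth_at_frechet_derivative[OF smooth_energy smooth_at_const])

context
  fixes u :: "('m, 'n) tpoint" assumes u: "u \<in> slit"
begin

lemma snd_ne: "snd u \<noteq> 0" using u by (simp add: slit_def)

lemma metric_sym: "fmetric L u v w = fmetric L u w v"
  unfolding fmetric_def using symmetric_second_derivative[OF smooth_energy[OF snd_ne]] by simp

lemma metric_linear1: "linear (\<lambda>v. fmetric L u v w)"
proof -
  have "linear (\<lambda>v. frechet_derivative (\<lambda>y. frechet_derivative (\<lambda>z. (L (fst u, z))\<^sup>2) (at y) w) (at (snd u)) v)"
    unfolding eta_contract_eq by (rule linear_frechet_smooth_at[OF energy_deriv_smooth[OF snd_ne]])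
  from linear_compose_scale_right[OF this, of "1/2"] show ?thesis
    unfolding fmetric_def by simp
qed

lemma metric_linear2: "linear (\<lambda>w. fmetric L u v w)"
  using metric_linear1 unfolding metric_sym[of v] .

lemma metric_pos: "v \<noteq> 0 \<Longrightarrow> fmetric L u v v > 0"
  using finsler u unfolding finsler_manifold_def by blast

text \<open>By this, a Koszul identity, which only prescribes inner products, determines a
  vector.\<close>

lemma metric_nondeg: "(\<And>z. fmetric L u v z = fmetric L u w z) \<Longrightarrow> v = w"
  using metric_pos[of "v - w"] linear_diff[OF metric_linear1, of v w "v - w"] by force

end

context
  fixes u :: "('m, 'n) tpoint" assumes u: "u \<in> slit"
begin

text \<open>The definition differentiates within a single fibre, in the components of that fibre's
  own chart. As a second derivative in one fixed bundle chart, the metric is seen to be smooth in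
  the base directions as well.\<close>

lemma metric_chart:
  assumes "w \<in> tm.dom u"
  shows "fmetric L w a b = frechet_derivative
    (\<lambda>\<eta>. frechet_derivative (\<lambda>\<xi>. (L (tm.ci u \<xi>))\<^sup>2) (at \<eta>) (0, base.tc (fst u) (fst w) b))
    (at (tm.co u w)) (0, base.tc (fst u) (fst w) a) / 2"
proof -
  have w: "w \<in> slit" "fst w \<in> base.dom (fst u)" using assms slit_dom by auto
  let ?x = "base.co (fst u) (fst w)" and ?J = "base.tc (fst u) (fst w)"
  let ?\<Phi> = "\<lambda>\<xi>. (L (tm.ci u \<xi>))\<^sup>2"
  have J: "bounded_linear ?J" using hat_linear[OF w(2)] linear_conv_bounded_linear by blast
  have dom: "(fst w, z) \<in> tm.dom u" "(fst w, z) \<in> slit" if "z \<noteq> 0" for z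
    using that w by (auto simp: slit_dom slit_def)
  have s: "smooth_at (?x, ?J z) ?\<Phi>" if "z \<noteq> 0" for z
    using smn_L2[OF dom(2)[OF that], unfolded tm.smn_chart[OF u dom(1)[OF that]]] by (simp add: tchart_map)
  have e: "eventually (\<lambda>z. (L (fst w, z))\<^sup>2 = ?\<Phi> (?x, ?J z)) (nhds y)" if "y \<noteq> 0" for y
    using eventually_nonzero[OF that]
  proof eventually_elim
    case (elim z)
    have "tm.ci u (tm.co u (fst w, z)) = (fst w, z)" by (rule tm.ci_co[OF u dom(1)[OF elim]])
    then show ?case by (simp add: tchart_map)
  qed
  have d1: "frechet_derivative (\<lambda>z. (L (fst w, z))\<^sup>2) (at y) b = frechet_derivative ?\<Phi> (at (?x, ?J y)) (0, ?J b)"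
    if "y \<noteq> 0" for y
    using fibre_chain(1)[OF s[OF that] J, of b] frechet_derivative_cong[OF e[OF that]] by simp
  have sw: "snd w \<noteq> 0" using w by (simp add: slit_def)
  have "frechet_derivative (\<lambda>y. frechet_derivative (\<lambda>z. (L (fst w, z))\<^sup>2) (at y) b) (at (snd w)) a
    = frechet_derivative (\<lambda>y. frechet_derivative ?\<Phi> (at (?x, ?J y)) (0, ?J b)) (at (snd w)) a"
    by (rule fun_cong[OF frechet_derivative_cong]) (rule eventually_mono[OF eventually_nonzero[OF sw] d1])
  also have "\<dots> = frechet_derivative (\<lambda>\<eta>. frechet_derivative ?\<Phi> (at \<eta>) (0, ?J b)) (at (?x, ?J (snd w))) (0, ?J a)"
    by (rule fibre_chain(1)[OF smooth_at_frechet_derivative[OF s[OF sw] smooth_at_const] J])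
  finally show ?thesis unfolding fmetric_def by (simp add: tchart_map)
qed

lemma smn_metric_frame:
  assumes "w \<in> tm.dom u"
  shows "tm.smn w (\<lambda>w. fmetric L w (ext \<kappa> u a w) (ext \<kappa> u b w))"
proof -
  note w = tm.dom_S[OF u assms]
  let ?\<Psi> = "\<lambda>\<eta>. frechet_derivative (\<lambda>\<eta>. frechet_derivative (\<lambda>\<xi>. (L (tm.ci u \<xi>))\<^sup>2) (at \<eta>) (0, b)) (at \<eta>) (0, a) / 2"
  have "smooth_at (tm.co u w) (\<lambda>\<xi>. (L (tm.ci u \<xi>))\<^sup>2)"
    using smn_L2[OF w, unfolded tm.smn_chart[OF u assms]] .
  then have "smooth_at (tm.co u w) ?\<Psi>"
    by (intro smooth_at_linear[OF bounded_linear_divide] smooth_at_frechet_derivative smooth_at_const)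
  from tm.smn_compose[OF w this tm.smn_co[OF u assms]]
  have "tm.smn w (\<lambda>z. ?\<Psi> (tm.co u z))" .
  moreover have "eventually (\<lambda>z. ?\<Psi> (tm.co u z) = fmetric L z (ext \<kappa> u a z) (ext \<kappa> u b z)) (tm.nb w)"
    using tm.ev_nb_dom[OF u assms]
  proof eventually_elim
    case (elim z)
    have "base.tc (fst u) (fst z) (ext \<kappa> u v z) = v" for v
      using hat_ext[of z u v] elim unfolding hat_def by (simp add: slit_dom)
    then show ?case unfolding metric_chart[OF elim] by simp
  qed
  ultimately show ?thesis by (rule tm.smn_eq[OF w, rotated])
qed

lemma smn_metric:
  assumes X: "pfs u X" and Y: "pfs u Y"
  shows "tm.smn u (\<lambda>w. fmetric L w (X w) (Y w))"
proof (rule tm.smn_eq[OF u])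
  let ?G = "\<lambda>w. \<Sum>j\<in>UNIV. \<Sum>i\<in>UNIV. hat u Y w $ j * (hat u X w $ i *
    fmetric L w (ext \<kappa> u (axis i 1) w) (ext \<kappa> u (axis j 1) w))"
  show "tm.smn u ?G"
    using X Y unfolding pfs_alt
    by (intro tm.smn_sum u tm.smn_mult tm.smn_nth smn_metric_frame tm_mem)
  show "eventually (\<lambda>w. ?G w = fmetric L w (X w) (Y w)) (tm.nb u)"
    using tm.ev_nb_self[OF u]
  proof eventually_elim
    case (elim w)
    have w: "w \<in> slit" "fst w \<in> base.dom (fst u)" using elim slit_dom by auto
    note l1 = metric_linear1[OF w(1)] and l2 = metric_linear2[OF w(1)]
    have "fmetric L w (X w) (Y w) = fmetric L w (\<Sum>i\<in>UNIV. (hat u X w $ i) *\<^sub>R ext \<kappa> u (axis i 1) w)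
        (\<Sum>j\<in>UNIV. (hat u Y w $ j) *\<^sub>R ext \<kappa> u (axis j 1) w)"
      by (simp add: frame_expand[OF w(2)])
    then show ?case
      by (simp add: linear_sum[OF l1] linear_sum[OF l2] linear_scale[OF l1] linear_scale[OF l2] sum_distrib_left)
  qed
qed

lemma dd_metric_gam:
  "dirT u (gam x) (\<lambda>w. fmetric L w (ext \<kappa> u y w) (ext \<kappa> u z w))
    = frechet_derivative (\<lambda>v. fmetric L (fst u, v) y z) (at (snd u)) x"
proof -
  have E: "ext \<kappa> u a (fst u, v) = a" for a v
    using ext_cong_fst[of u u "(fst u, v)" u a] by simp
  show ?thesis
    using fibre_derivative(2)[of "snd u" "fst u" "\<lambda>w. fmetric L w (ext \<kappa> u y w) (ext \<kappa> u z w)" x]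
      smn_metric_frame[OF tm_mem[OF u]] snd_ne[OF u] by (simp add: E)
qed

text \<open>Both sides are half a third fibre derivative of \<open>L\<^sup>2\<close>.\<close>

lemma cartan_sym:
  "dirT u (gam x) (\<lambda>w. fmetric L w (ext \<kappa> u y w) (ext \<kappa> u z w))
    = dirT u (gam y) (\<lambda>w. fmetric L w (ext \<kappa> u x w) (ext \<kappa> u z w))"
proof -
  let ?f = "\<lambda>y. frechet_derivative (\<lambda>v. (L (fst u, v))\<^sup>2) (at y) z"
  have s: "smooth_at (snd u) ?f" by (rule energy_deriv_smooth[OF snd_ne[OF u]])
  have h: "frechet_derivative (\<lambda>v. fmetric L (fst u, v) a z) (at (snd u)) b
      = frechet_derivative (\<lambda>v. frechet_derivative ?f (at v) a) (at (snd u)) b / 2" for a b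
    unfolding fmetric_def fst_conv snd_conv
    by (rule frechet_derivative_lin[OF bounded_linear_divide smooth_at_frechet_derivative[OF s smooth_at_const]])
  show ?thesis unfolding dd_metric_gam h using symmetric_second_derivative[OF s] by simp
qed

end

text \<open>\<open>L\<^sup>2\<close> is homogeneous of degree 2, and each of the two fibre
  derivatives lowers the degree by one.\<close>

lemma metric_sc:
  assumes u: "u \<in> slit" and c: "c > 0"
  shows "fmetric L (sc c u) v w = fmetric L u v w"
proof -
  let ?f = "\<lambda>z. (L (fst u, z))\<^sup>2"
  have bl: "bounded_linear (\<lambda>z::real ^ 'n. c *\<^sub>R z)" by (rule bounded_linear_scaleR_right)
  have hom: "?f (c *\<^sub>R z) = c\<^sup>2 *\<^sub>R ?f z" for z
    using finsler c unfolding finsler_manifold_def by (simp add: power_mult_distrib)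
  have chain: "frechet_derivative (\<lambda>z. h (c *\<^sub>R z)) (at y) a = c *\<^sub>R frechet_derivative h (at (c *\<^sub>R y)) a"
    if "smooth_at (c *\<^sub>R y) h" for h :: "real ^ 'n \<Rightarrow> real" and y a
    using frechet_derivative_chain[OF that smooth_at_bounded_linear[OF bl]]
    by (simp add: frechet_derivative_bounded_linear[OF bl] linear_scale[OF linear_frechet_smooth_at[OF that]])
  have d1: "frechet_derivative ?f (at (c *\<^sub>R y)) w = c *\<^sub>R frechet_derivative ?f (at y) w" if "y \<noteq> 0" for y
  proof -
    have "c *\<^sub>R frechet_derivative ?f (at (c *\<^sub>R y)) w = frechet_derivative (\<lambda>z. c\<^sup>2 *\<^sub>R ?f z) (at y) w"
      using chain[of y ?f w] smooth_energy[of "c *\<^sub>R y" "fst u"] that c unfolding hom by simp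
    also have "\<dots> = c\<^sup>2 *\<^sub>R frechet_derivative ?f (at y) w"
      by (rule frechet_derivative_lin[OF bounded_linear_scaleR_right smooth_energy[OF that]])
    finally show ?thesis using c by (simp add: power2_eq_square)
  qed
  let ?g = "\<lambda>y. frechet_derivative ?f (at y) w"
  have y: "snd u \<noteq> 0" using u by (simp add: slit_def)
  have sg: "smooth_at (c *\<^sub>R snd u) ?g" "smooth_at (snd u) ?g"
    using energy_deriv_smooth[of "c *\<^sub>R snd u"] energy_deriv_smooth[OF y] y c by auto
  have "c *\<^sub>R frechet_derivative ?g (at (c *\<^sub>R snd u)) v = frechet_derivative (\<lambda>y. ?g (c *\<^sub>R y)) (at (snd u)) v"
    using chain[OF sg(1)] by simp
  also have "\<dots> = frechet_derivative (\<lambda>y. c *\<^sub>R ?g y) (at (snd u)) v"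
    by (rule fun_cong[OF frechet_derivative_cong]) (rule eventually_mono[OF eventually_nonzero[OF y] d1])
  also have "\<dots> = c *\<^sub>R frechet_derivative ?g (at (snd u)) v"
    by (rule frechet_derivative_lin[OF bounded_linear_scaleR_right sg(2)])
  finally show ?thesis unfolding fmetric_def using c by simp
qed

text \<open>Euler's relation in degree 0: the metric is constant along the ray through
  \<open>snd u\<close>, so its derivative in the radial direction vanishes.\<close>

lemma cartan_eta:
  assumes u: "u \<in> slit"
  shows "dirT u (gam (snd u)) (\<lambda>w. fmetric L w (ext \<kappa> u y w) (ext \<kappa> u z w)) = 0"
proof -
  let ?h = "\<lambda>v. fmetric L (fst u, v) y z" and ?y = "snd u"
  have E: "ext \<kappa> u a (fst u, v) = a" for a v
    using ext_cong_fst[of u u "(fst u, v)" u a] by simp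
  have s: "smooth_at ?y ?h"
    using fibre_derivative(1)[of ?y "fst u" "\<lambda>w. fmetric L w (ext \<kappa> u y w) (ext \<kappa> u z w)"]
      smn_metric_frame[OF u tm_mem[OF u]] snd_ne[OF u] by (simp add: E)
  have bl: "bounded_linear (\<lambda>t. t *\<^sub>R ?y)" by (rule bounded_linear_scaleR_left)
  have "frechet_derivative (\<lambda>t. ?h (t *\<^sub>R ?y)) (at 1) 1 = frechet_derivative ?h (at ?y) ?y"
    using frechet_derivative_chain[of "\<lambda>t. t *\<^sub>R ?y" 1 ?h 1] s smooth_at_bounded_linear[OF bl, of 1]
    by (simp add: frechet_derivative_bounded_linear[OF bl])
  moreover have "frechet_derivative (\<lambda>t. ?h (t *\<^sub>R ?y)) (at 1) = frechet_derivative (\<lambda>t. ?h ?y) (at (1::real))"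
  proof (rule frechet_derivative_cong)
    have "eventually (\<lambda>t::real. t > 0) (nhds 1)"
      using eventually_nhds_in_open[of "{0<..}" "1::real"] by simp
    then show "\<forall>\<^sub>F t in nhds 1. ?h (t *\<^sub>R ?y) = ?h ?y"
      by eventually_elim (use metric_sc[OF u] in simp)
  qed
  ultimately show ?thesis unfolding dd_metric_gam[OF u] by simp
qed

end

section \<open>Homogeneity of the Cartan connection\<close>

locale cartan = finsler \<kappa> L + regular \<kappa> D
  for \<kappa> :: "'m::{t2_space, second_countable_topology} \<Rightarrow> ('m, real ^ 'n::finite) chart" and L and D +
  assumes cartan: "cartan_connection \<kappa> L D"
begin

lemma D_ext_linear:
  assumes u: "u \<in> slit"
  shows "linear (\<lambda>v. D u X (ext \<kappa> u v))"
proof (rule linearI)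
  note E = pfs_ext_self[OF u]
  show "D u X (ext \<kappa> u (a + b)) = D u X (ext \<kappa> u a) + D u X (ext \<kappa> u b)" for a b
    unfolding D_add[OF u E E, symmetric]
    by (rule D_cong[OF u E])
       (use tm.ev_nb_self[OF u] in \<open>eventually_elim, simp add: slit_dom linear_add[OF ext_linear]\<close>)
  show "D u X (ext \<kappa> u (c *\<^sub>R a)) = c *\<^sub>R D u X (ext \<kappa> u a)" for a c
    unfolding D_cmult[OF u E, symmetric]
    by (rule D_cong[OF u E])
       (use tm.ev_nb_self[OF u] in \<open>eventually_elim, simp add: slit_dom linear_scale[OF ext_linear]\<close>)
qed

text \<open>In the frame of \<open>u\<close> the coefficients of \<eta> are the fibre coordinates,
  whose derivatives along \<open>X\<close> are the entries of \<open>snd X\<close>. For horizontal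
  \<open>X\<close> this gives the fibre part of the horizontal lift.\<close>

lemma D_eta:
  assumes u: "u \<in> slit"
  shows "D u X eta = snd X + D u X (ext \<kappa> u (snd u))"
proof -
  have d: "dirT u X (\<lambda>w. hat u eta w $ i) = snd X $ i" for i
    using tm.dd_co[OF u tm_mem[OF u], of X "(0, axis i 1)"] u
    by (simp add: hat_eta inner_prod_def inner_axis)
  have "D u X eta = (\<Sum>i\<in>UNIV. (snd X $ i) *\<^sub>R axis i 1) + (\<Sum>i\<in>UNIV. (snd u $ i) *\<^sub>R D u X (ext \<kappa> u (axis i 1)))"
    using D_expand[OF u tm_mem[OF u] pfs_eta[OF u], of X] by (simp add: d sum.distrib eta_def)
  also have "(\<Sum>i\<in>UNIV. (snd X $ i) *\<^sub>R axis i 1) = snd X"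
    using basis_expansion[of "snd X"] by (simp add: scalar_mult_eq_scaleR)
  also have "(\<Sum>i\<in>UNIV. (snd u $ i) *\<^sub>R D u X (ext \<kappa> u (axis i 1)))
      = D u X (ext \<kappa> u (\<Sum>i\<in>UNIV. (snd u $ i) *\<^sub>R axis i 1))"
    by (simp add: linear_sum[OF D_ext_linear[OF u]] linear_scale[OF D_ext_linear[OF u]])
  also have "(\<Sum>i\<in>UNIV. (snd u $ i) *\<^sub>R axis i (1::real)) = snd u"
    using basis_expansion[of "snd u"] by (simp add: scalar_mult_eq_scaleR)
  finally show ?thesis .
qed

lemma dd_base:
  assumes "u \<in> slit" "w \<in> tm.dom u"
  shows "dirT w X (\<lambda>w. tm.co u w \<bullet> (b, 0)) = base.tc (fst u) (fst w) (fst X) \<bullet> b"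
  using tm.dd_co[OF assms, of X "(b, 0)"] tm_tc_fst[OF assms, of X]
  by (simp add: inner_prod_def)

text \<open>Fields projecting to coordinate fields with constant components have constant
  derivatives on the base coordinates. The commutator formula therefore leaves no base part, and the
  bracket terms drop out of every torsion used below.\<close>

lemma bracket_vertical:
  assumes u: "u \<in> slit" and XY: "tm.vfs u X" "tm.vfs u Y"
    and X: "eventually (\<lambda>w. fst (X w) = ext \<kappa> u a w) (tm.nb u)"
    and Y: "eventually (\<lambda>w. fst (Y w) = ext \<kappa> u b w) (tm.nb u)"
  shows "fst (lie_bracket (tchart \<kappa>) X Y u) = 0"
proof -
  have const: "dirT u V (\<lambda>w. dirT w (Z w) (\<lambda>w. tm.co u w \<bullet> (e, 0))) = 0"
    if "eventually (\<lambda>w. fst (Z w) = ext \<kappa> u d w) (tm.nb u)" for V Z d e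
  proof -
    have "eventually (\<lambda>w. dirT w (Z w) (\<lambda>w. tm.co u w \<bullet> (e, 0)) = d \<bullet> e) (tm.nb u)"
      using that tm.ev_nb_self[OF u]
    proof eventually_elim
      case (elim w)
      then show ?case
        using dd_base[OF u elim(2), of "Z w" e] hat_ext[of w u d] by (simp add: hat_def slit_dom)
    qed
    from tm.dd_cong[OF u this] show ?thesis using tm.dd_const[OF u] by simp
  qed
  have "fst (lie_bracket (tchart \<kappa>) X Y u) \<bullet> e = 0" for e
  proof -
    have "tm.smn u (\<lambda>w. tm.co u w \<bullet> (e, 0))"
      by (rule tm.smn_inner[OF u tm.smn_co[OF u tm_mem[OF u]]])
    from tm.lie_bracket_commutator[OF u XY this]
    show ?thesis unfolding const[OF X] const[OF Y] dd_base[OF u tm_mem[OF u]] by simp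
  qed
  then show ?thesis using inner_eq_zero_iff by blast
qed

context
  fixes u :: "('m, 'n) tpoint" assumes u: "u \<in> slit"
begin

lemma metric_compat:
  "pfs u Y \<Longrightarrow> pfs u Z \<Longrightarrow> dirT u X (\<lambda>w. fmetric L w (Y w) (Z w))
    = fmetric L u (D u X Y) (Z u) + fmetric L u (Y u) (D u X Z)"
  using cartan u unfolding cartan_connection_def by blast

text \<open>The vertical field is killed by \<rho>, and it projects to the coordinate field of the
  zero vector, so the bracket is vertical too. Of the three torsion terms only the first is
  left.\<close>

lemma torsion_vertical: "torsion \<kappa> D (vlift (ext \<kappa> u x)) (hlift D (ext \<kappa> u y)) u = D u (gam x) (ext \<kappa> u y)"
proof -
  note E = pfs_ext_self[OF u]
  have h: "eventually (\<lambda>w. fst (hlift D (ext \<kappa> u y) w) = ext \<kappa> u y w) (tm.nb u)"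
    using tm.ev_nb_S[OF u] by eventually_elim (simp add: hlift_def)
  have v: "eventually (\<lambda>w. fst (vlift (ext \<kappa> u x) w) = ext \<kappa> u 0 w) (tm.nb u)"
    using tm.ev_nb_self[OF u]
    by eventually_elim (simp add: vlift_def gam_def slit_dom linear_0[OF ext_linear])
  have "D u (gam x) (\<lambda>w. fst (hlift D (ext \<kappa> u y) w)) = D u (gam x) (ext \<kappa> u y)"
    by (rule D_cong[OF u E, symmetric]) (rule eventually_mono[OF h], simp)
  moreover have "tm.vfs u (vlift (ext \<kappa> u x))" unfolding vlift_def by (rule vfs_gam[OF u E])
  ultimately show ?thesis
    unfolding torsion_def rho_def bracket_vertical[OF u _ vfs_hlift[OF u E] v h]
    using u by (simp add: vlift_def gam_def bracket_vertical[OF u _ vfs_hlift[OF u E] v h, unfolded vlift_def gam_def])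
qed

lemma D_beta_sym: "D u (beta D u x) (ext \<kappa> u y) = D u (beta D u y) (ext \<kappa> u x)"
proof -
  note E = pfs_ext_self[OF u]
  have h: "eventually (\<lambda>w. fst (hlift D (ext \<kappa> u y) w) = ext \<kappa> u y w) (tm.nb u)" for y
    using tm.ev_nb_S[OF u] by eventually_elim (simp add: hlift_def)
  have d: "D u X (\<lambda>w. fst (hlift D (ext \<kappa> u y) w)) = D u X (ext \<kappa> u y)" for X y
    by (rule D_cong[OF u E, symmetric]) (rule eventually_mono[OF h[of y]], simp)
  have "torsion \<kappa> D (hlift D (ext \<kappa> u x)) (hlift D (ext \<kappa> u y)) u = 0"
    using cartan u E unfolding cartan_connection_def by blast
  then show ?thesis
    unfolding torsion_def rho_def d
      bracket_vertical[OF u vfs_hlift[OF u E] vfs_hlift[OF u E] h h]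
    by (simp add: hlift_def u)
qed

abbreviation gE :: "real ^ 'n \<Rightarrow> real ^ 'n \<Rightarrow> ('m, 'n) tpoint \<Rightarrow> real" where
  "gE y z \<equiv> (\<lambda>w. fmetric L w (ext \<kappa> u y w) (ext \<kappa> u z w))"

text \<open>Metric compatibility gives the right side as a sum of two terms, which the symmetry
  condition on the mixed torsion makes equal.\<close>

lemma vertical_koszul: "2 * fmetric L u (D u (gam x) (ext \<kappa> u y)) z = dirT u (gam x) (gE y z)"
proof -
  note E = pfs_ext_self[OF u]
  have "fmetric L u (torsion \<kappa> D (vlift (ext \<kappa> u x)) (hlift D (ext \<kappa> u y)) u) (ext \<kappa> u z u)
    = fmetric L u (torsion \<kappa> D (vlift (ext \<kappa> u x)) (hlift D (ext \<kappa> u z)) u) (ext \<kappa> u y u)"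
    using cartan u E unfolding cartan_connection_def by blast
  then show ?thesis
    unfolding torsion_vertical metric_compat[OF E E] by (simp add: metric_sym[OF u, of y])
qed

text \<open>The usual Koszul alternating sum. Vanishing horizontal torsion is the symmetry
  \<open>D_beta_sym\<close> on coordinate fields, so no bracket terms occur.\<close>

lemma horizontal_koszul:
  "2 * fmetric L u (D u (beta D u x) (ext \<kappa> u y)) z = dirT u (beta D u x) (gE y z)
    + dirT u (beta D u y) (gE x z) - dirT u (beta D u z) (gE x y)"
proof -
  note E = pfs_ext_self[OF u]
  note s = metric_sym[OF u] D_beta_sym
  show ?thesis
    unfolding metric_compat[OF E E] ext_self
    using s(1)[of y "D u (beta D u x) (ext \<kappa> u z)"] s(1)[of x "D u (beta D u y) (ext \<kappa> u z)"]
      s(1)[of x "D u (beta D u z) (ext \<kappa> u y)"] s(2)[of x y] s(2)[of x z] s(2)[of y z]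
    by simp
qed

lemma snd_beta: "snd (beta D u x) = - D u (beta D u x) (ext \<kappa> u (snd u))"
  using D_eta[OF u, of "beta D u x"] D_beta_eta[OF u, of x] by (simp add: eq_neg_iff_add_eq_0)

text \<open>Total symmetry of the Cartan tensor moves \<open>snd u\<close> from a metric slot to the
  direction of differentiation, where homogeneity makes the derivative zero.\<close>

lemma vertical_gE_eta: "dirT u (gam v) (gE (snd u) z) = 0"
  "dirT u (gam v) (gE z (snd u)) = 0"
proof -
  show 1: "dirT u (gam v) (gE (snd u) z) = 0" for z
    unfolding cartan_sym[OF u, of v] by (rule cartan_eta[OF u])
  have "dirT u (gam v) (gE z (snd u)) = dirT u (gam v) (gE (snd u) z)"
    by (rule tm.dd_cong[OF u]) (rule eventually_mono[OF tm.ev_nb_S[OF u]], rule metric_sym)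
  then show "dirT u (gam v) (gE z (snd u)) = 0" using 1 by simp
qed

end

text \<open>The nonlinear connection \<open>N\<close> is determined by the metric through the Koszul identity
  for \<open>y = snd u\<close>; the terms differentiating in the direction \<open>N x\<close> drop out because the
  Cartan tensor annihilates \<open>y\<close>.\<close>

lemma spray_unique:
  fixes N N' :: "real ^ 'n \<Rightarrow> real ^ 'n"
  assumes u: "u \<in> slit"
    and N: "\<And>x z. 2 * fmetric L u (N x) z = dirT u (x, - N x) (gE u (snd u) z)
      + dirT u (snd u, - N (snd u)) (gE u x z) - dirT u (z, - N z) (gE u x (snd u))"
    and N': "\<And>x z. 2 * fmetric L u (N' x) z = dirT u (x, - N' x) (gE u (snd u) z)
      + dirT u (snd u, - N' (snd u)) (gE u x z) - dirT u (z, - N' z) (gE u x (snd u))"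
  shows "N x = N' x"
proof -
  let ?y = "snd u" and ?dd = "dirT u"
  have split: "?dd (a, - b) (gE u y z) = ?dd (a, 0) (gE u y z) - ?dd (gam b) (gE u y z)" for a b y z
    using linear_diff[OF tm.dd_linear[OF u smn_metric_frame[OF u tm_mem[OF u]]], of "(a, 0)" "gam b"]
    by (simp add: gam_def)
  have M: "2 * fmetric L u (M x) z = ?dd (x, 0) (gE u ?y z)
      + (?dd (?y, 0) (gE u x z) - ?dd (gam (M ?y)) (gE u x z)) - ?dd (z, 0) (gE u x ?y)"
    if "\<And>x z. 2 * fmetric L u (M x) z = ?dd (x, - M x) (gE u ?y z)
      + ?dd (?y, - M ?y) (gE u x z) - ?dd (z, - M z) (gE u x ?y)" for M x z
    using that[of x z] unfolding split vertical_gE_eta[OF u] by simp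
  \<comment> \<open>In \<open>M\<close> the only unknown left on the right is the value at
    \<open>?y\<close>. For \<open>x = ?y\<close> its term vanishes too, so \<open>N ?y\<close> is
    determined first; after that the right side is known for every \<open>x\<close>.\<close>
  have y: "N ?y = N' ?y"
  proof (rule metric_nondeg[OF u])
    show "fmetric L u (N ?y) z = fmetric L u (N' ?y) z" for z
      using M[of N ?y z, OF N] M[of N' ?y z, OF N'] unfolding vertical_gE_eta[OF u] by simp
  qed
  show ?thesis
  proof (rule metric_nondeg[OF u])
    show "fmetric L u (N x) z = fmetric L u (N' x) z" for z
      using M[of N x z, OF N] M[of N' x z, OF N'] unfolding y by simp
  qed
qed

section \<open>Invariance of the connection and the curvature under fibre dilations\<close>

context
  fixes u :: "('m, 'n) tpoint" and c :: real assumes u: "u \<in> slit" and c: "c > 0"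
begin

lemma dd_gE_sc: "dirT (sc c u) (sc c X) (gE u y z) = dirT u X (gE u y z)"
proof -
  have s: "tm.smn (sc c u) (gE u y z)"
    by (rule smn_metric_frame[OF u sc_dom[OF tm_mem[OF u] c]])
  have "eventually (\<lambda>w. gE u y z (sc c w) = gE u y z w) (tm.nb u)"
    using tm.ev_nb_S[OF u] by eventually_elim (simp only: metric_sc[OF _ c] ext_sc)
  from tm.dd_cong[OF u this] show ?thesis using dd_sc[OF u c s] by simp
qed

lemma koszul_sc:
  "2 * fmetric L u (D (sc c u) (beta D (sc c u) x) (ext \<kappa> u y)) z
    = dirT (sc c u) (beta D (sc c u) x) (gE u y z)
    + dirT (sc c u) (beta D (sc c u) y) (gE u x z)
    - dirT (sc c u) (beta D (sc c u) z) (gE u x y)"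
  using horizontal_koszul[OF sc_slit[OF u c], of x y z] unfolding ext_sc metric_sc[OF u c] .

text \<open>The nonlinear connection at the dilated point, evaluated on \<open>snd u\<close> instead
  of \<open>c *\<^sub>R snd u\<close>, satisfies the same Koszul system as the one at
  \<open>u\<close>; uniqueness identifies them, and linearity in the field restores the factor
  \<open>c\<close>.\<close>

lemma beta_sc: "beta D (sc c u) x = sc c (beta D u x)"
proof -
  let ?N = "\<lambda>x. D u (beta D u x) (ext \<kappa> u (snd u))"
  let ?N' = "\<lambda>x. D (sc c u) (beta D (sc c u) x) (ext \<kappa> u (snd u))"
  have b: "beta D u x = (x, - ?N x)" for x
    using snd_beta[OF u, of x] fst_beta[OF u, of x] by (simp add: prod_eq_iff)
  have "snd (beta D (sc c u) x) = - D (sc c u) (beta D (sc c u) x) (ext \<kappa> u (c *\<^sub>R snd u))" for x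
    using snd_beta[OF sc_slit[OF u c], of x] unfolding ext_sc by simp
  moreover have "D (sc c u) X (ext \<kappa> u (c *\<^sub>R snd u)) = c *\<^sub>R D (sc c u) X (ext \<kappa> u (snd u))" for X
    using linear_scale[OF D_ext_linear[OF sc_slit[OF u c]]] unfolding ext_sc .
  ultimately have b': "beta D (sc c u) x = sc c (x, - ?N' x)" for x
    using fst_beta[OF sc_slit[OF u c], of x] by (simp add: prod_eq_iff)
  have "?N' x = ?N x" for x
  proof (rule spray_unique[OF u, of ?N' ?N])
    fix x z
    show "2 * fmetric L u (?N x) z = dirT u (x, - ?N x) (gE u (snd u) z)
      + dirT u (snd u, - ?N (snd u)) (gE u x z) - dirT u (z, - ?N z) (gE u x (snd u))"
      unfolding b[symmetric] by (rule horizontal_koszul[OF u])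
    show "2 * fmetric L u (?N' x) z = dirT u (x, - ?N' x) (gE u (snd u) z)
      + dirT u (snd u, - ?N' (snd u)) (gE u x z) - dirT u (z, - ?N' z) (gE u x (snd u))"
      unfolding dd_gE_sc[symmetric] b'[symmetric] by (rule koszul_sc)
  qed
  then show ?thesis using b[of x] b'[of x] by simp
qed

text \<open>With the horizontal lifts matched, both Koszul identities have dilation-invariant right
  sides. They settle the horizontal and the vertical directions, and every \<open>X\<close> is a sum
  of the two kinds.\<close>

lemma D_sc_ext: "D (sc c u) (sc c X) (ext \<kappa> u y) = D u X (ext \<kappa> u y)"
proof -
  note E = pfs_ext_self[OF u] and E' = pfs_ext[OF u sc_dom[OF tm_mem[OF u] c]]
  have h: "D (sc c u) (sc c (beta D u x)) (ext \<kappa> u y) = D u (beta D u x) (ext \<kappa> u y)" for x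
  proof (rule metric_nondeg[OF u])
    show "fmetric L u (D (sc c u) (sc c (beta D u x)) (ext \<kappa> u y)) z
      = fmetric L u (D u (beta D u x) (ext \<kappa> u y)) z" for z
      using koszul_sc[of x y z] horizontal_koszul[OF u, of x y z] unfolding beta_sc dd_gE_sc by simp
  qed
  have v: "D (sc c u) (sc c (gam x)) (ext \<kappa> u y) = D u (gam x) (ext \<kappa> u y)" for x
  proof (rule metric_nondeg[OF u])
    have g: "sc c (gam x) = gam (c *\<^sub>R x)" by (simp add: gam_def)
    show "fmetric L u (D (sc c u) (sc c (gam x)) (ext \<kappa> u y)) z
      = fmetric L u (D u (gam x) (ext \<kappa> u y)) z" for z
      using vertical_koszul[OF sc_slit[OF u c], of "c *\<^sub>R x" y z] vertical_koszul[OF u, of x y z]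
      unfolding ext_sc metric_sc[OF u c] g[symmetric] dd_gE_sc by simp
  qed
  have X: "X = beta D u (fst X) + gam (snd X - snd (beta D u (fst X)))"
    by (simp add: prod_eq_iff u gam_def)
  have scX: "sc c X = sc c (beta D u (fst X)) + sc c (gam (snd X - snd (beta D u (fst X))))"
    by (simp add: prod_eq_iff u gam_def algebra_simps)
  have "D (sc c u) (sc c X) (ext \<kappa> u y) = D u (beta D u (fst X)) (ext \<kappa> u y)
      + D u (gam (snd X - snd (beta D u (fst X)))) (ext \<kappa> u y)"
    unfolding scX linear_add[OF D_linear[OF sc_slit[OF u c] E']] h v ..
  also have "\<dots> = D u X (ext \<kappa> u y)"
    unfolding linear_add[OF D_linear[OF u E], symmetric] X[symmetric] ..
  finally show ?thesis .
qed

text \<open>The frame fields are unchanged by dilation and their derivatives agree by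
  \<open>D_sc_ext\<close>, so only the coefficient functions have to be transported.\<close>

lemma D_sc:
  assumes Y: "pfs (sc c u) Y"
  shows "D (sc c u) (sc c X) Y = D u X (\<lambda>w. Y (sc c w))"
proof -
  have Y': "pfs u (\<lambda>w. Y (sc c w))" by (rule pfs_sc[OF u c Y])
  have dom: "sc c u \<in> tm.dom u" by (rule sc_dom[OF tm_mem[OF u] c])
  have s: "tm.smn (sc c u) (\<lambda>z. hat u Y z $ i)" for i
    by (rule tm.smn_nth[OF sc_slit[OF u c] Y[unfolded pfs_chart[OF u dom]]])
  have d: "dirT (sc c u) (sc c X) (\<lambda>z. hat u Y z $ i)
    = dirT u X (\<lambda>z. hat u (\<lambda>w. Y (sc c w)) z $ i)" for i
    using dd_sc[OF u c s, of X i] by (simp add: hat_def)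
  show ?thesis
    unfolding D_expand[OF u dom Y] D_expand[OF u tm_mem[OF u] Y'] D_sc_ext d ext_sc
    by (simp add: hat_def)
qed

text \<open>Derivations along dilation-invariant fields commute with composing functions with the
  dilation. By the commutator formula both brackets act alike on functions, and coordinate functions
  separate tangent vectors.\<close>

lemma bracket_sc:
  assumes X: "tm.vfs (sc c u) X" "tm.vfs u X" "eventually (\<lambda>w. X (sc c w) = sc c (X w)) (tm.nb u)"
    and Y: "tm.vfs (sc c u) Y" "tm.vfs u Y" "eventually (\<lambda>w. Y (sc c w) = sc c (Y w)) (tm.nb u)"
  shows "lie_bracket (tchart \<kappa>) X Y (sc c u) = sc c (lie_bracket (tchart \<kappa>) X Y u)"
proof -
  let ?B = "lie_bracket (tchart \<kappa>) X Y"
  have dom: "sc c u \<in> tm.dom u" by (rule sc_dom[OF tm_mem[OF u] c])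
  have dd: "dirT (sc c u) (?B (sc c u)) f = dirT (sc c u) (sc c (?B u)) f"
    if f: "tm.smn (sc c u) f" for f :: "('m, 'n) tpoint \<Rightarrow> real"
  proof -
    let ?f = "\<lambda>w. f (sc c w)"
    have f': "tm.smn u ?f" by (rule smn_sc[OF u c f])
    have "dirT (sc c u) (Z (sc c u)) (\<lambda>w. dirT w (V w) f)
      = dirT u (Z u) (\<lambda>w. dirT w (V w) ?f)"
      if V: "tm.vfs (sc c u) V" "eventually (\<lambda>w. V (sc c w) = sc c (V w)) (tm.nb u)"
        and Z: "eventually (\<lambda>w. Z (sc c w) = sc c (Z w)) (tm.nb u)" for Z V
    proof -
      have "eventually (\<lambda>w. dirT (sc c w) (V (sc c w)) f = dirT w (V w) ?f) (tm.nb u)"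
        using V(2) tm.ev_nb_S[OF u] ev_sc[OF u c tm.smn_ev[OF sc_slit[OF u c] f]]
        by eventually_elim (simp only: dd_sc[OF _ c])
      from tm.dd_cong[OF u this]
      have "dirT u (Z u) (\<lambda>w. dirT (sc c w) (V (sc c w)) f)
        = dirT u (Z u) (\<lambda>w. dirT w (V w) ?f)" .
      then show ?thesis
        unfolding tm.ev_nb_at[OF u Z]
          dd_sc[OF u c tm.dd_field(1)[OF sc_slit[OF u c] V(1) f], of "Z u"] .
    qed
    note k = this
    show ?thesis
      unfolding tm.lie_bracket_commutator[OF sc_slit[OF u c] X(1) Y(1) f] dd_sc[OF u c f]
        tm.lie_bracket_commutator[OF u X(2) Y(2) f'] k[OF Y(1,3) X(3)] k[OF X(1,3) Y(3)] ..
  qed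
  have "?B (sc c u) \<bullet> b = sc c (?B u) \<bullet> b" for b
  proof -
    have s: "tm.smn (sc c u) (\<lambda>w. tm.co (sc c u) w \<bullet> b)"
      by (rule tm.smn_inner[OF sc_slit[OF u c] tm.smn_co[OF sc_slit[OF u c] tm_mem[OF sc_slit[OF u c]]]])
    show ?thesis
      using dd[OF s] unfolding tm.dd_co[OF sc_slit[OF u c] tm_mem[OF sc_slit[OF u c]]]
        tm.tc_self[OF sc_slit[OF u c]] .
  qed
  then show ?thesis using inner_commute by (metis vector_eq_ldot)
qed

end

lemma hcurv_sc:
  assumes u: "u \<in> slit" and c: "c > 0"
  shows "hcurv \<kappa> D (sc c u) x y z = hcurv \<kappa> D u x y z"
proof -
  let ?X = "hlift D (ext \<kappa> u x)" and ?Y = "hlift D (ext \<kappa> u y)" and ?Z = "ext \<kappa> u z"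
  note E = pfs_ext_self[OF u] and E' = pfs_ext[OF u sc_dom[OF tm_mem[OF u] c]] and u' = sc_slit[OF u c]
  have h: "hlift D (ext \<kappa> u x) (sc c w) = sc c (hlift D (ext \<kappa> u x) w)" if "w \<in> slit" for w x
    using that by (simp only: hlift_def beta_sc[OF _ c] ext_sc)
  have eh: "eventually (\<lambda>w. hlift D (ext \<kappa> u x) (sc c w) = sc c (hlift D (ext \<kappa> u x) w)) (tm.nb u)" for x
    using tm.ev_nb_S[OF u] by eventually_elim (rule h)
  have d: "D (sc c u) (hlift D (ext \<kappa> u x) (sc c u)) (\<lambda>w. D w (hlift D (ext \<kappa> u y) w) ?Z)
    = D u (hlift D (ext \<kappa> u x) u) (\<lambda>w. D w (hlift D (ext \<kappa> u y) w) ?Z)" for x y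
  proof -
    have "eventually (\<lambda>w. D w (hlift D (ext \<kappa> u y) w) ?Z = D (sc c w) (hlift D (ext \<kappa> u y) (sc c w)) ?Z) (tm.nb u)"
      using eh[of y] tm.ev_nb_S[OF u] tm.ev_nb_self[OF u]
    proof eventually_elim
      case (elim w)
      have "D (sc c w) (sc c (hlift D (ext \<kappa> u y) w)) ?Z = D w (hlift D (ext \<kappa> u y) w) (\<lambda>w. ?Z (sc c w))"
        by (rule D_sc[OF elim(2) c pfs_ext[OF u sc_dom[OF elim(3) c]]])
      then show ?case unfolding elim(1) ext_sc by simp
    qed
    from D_cong[OF u pfs_D_hlift[OF u E E] this]
    show ?thesis
      unfolding h[OF u] D_sc[OF u c pfs_D_hlift[OF u' E' E']] by simp
  qed
  have b: "lie_bracket (tchart \<kappa>) ?X ?Y (sc c u) = sc c (lie_bracket (tchart \<kappa>) ?X ?Y u)"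
    by (rule bracket_sc[OF u c vfs_hlift[OF u' E'] vfs_hlift[OF u E] eh vfs_hlift[OF u' E'] vfs_hlift[OF u E] eh])
  show ?thesis
    unfolding hcurv_def ext_sc curvature_def d b D_sc_ext[OF u c] ..
qed

end

section \<open>Ricci tensor and scalar curvature\<close>

lemma matrix_inv_unique:
  fixes A B :: "real ^ 'n ^ 'n"
  assumes "A ** B = mat 1"
  shows "matrix_inv A = B"
proof -
  have "det A \<noteq> 0" using assms invertible_right_inverse[of A] invertible_det_nz[of A] by blast
  then have "matrix_inv A = matrix_inv A ** (A ** B)" using assms by simp
  also have "\<dots> = B"
    by (simp add: matrix_mul_assoc matrix_inv_left_right[OF \<open>det A \<noteq> 0\<close>])
  finally show ?thesis .
qed

lemma bilinear_gram:
  fixes b :: "real ^ 'n \<Rightarrow> real ^ 'n \<Rightarrow> real"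
  assumes "\<And>y. linear (\<lambda>x. b x y)" "\<And>x. linear (b x)"
  shows "b x y = (\<Sum>i\<in>UNIV. \<Sum>j\<in>UNIV. x $ i * (gram b $ i $ j * y $ j))"
proof -
  have "b x y = b (\<Sum>i\<in>UNIV. (x $ i) *\<^sub>R axis i 1) (\<Sum>j\<in>UNIV. (y $ j) *\<^sub>R axis j 1)"
    using basis_expansion[of x] basis_expansion[of y] by (simp add: scalar_mult_eq_scaleR)
  also have "\<dots> = (\<Sum>j\<in>UNIV. y $ j * (\<Sum>i\<in>UNIV. x $ i * b (axis i 1) (axis j 1)))"
    by (simp only: linear_sum[OF assms(1)] linear_sum[OF assms(2)] linear_scale[OF assms(1)]
        linear_scale[OF assms(2)] real_scaleR_def)
  finally show ?thesis
    unfolding sum_distrib_left by (subst sum.swap) (simp add: gram_def mult.commute mult.left_commute)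
qed

lemma gram_compose:
  fixes b :: "real ^ 'n \<Rightarrow> real ^ 'n \<Rightarrow> real"
  assumes "\<And>y. linear (\<lambda>x. b x y)" "\<And>x. linear (b x)"
  shows "gram (\<lambda>x y. b (f x) (f y)) = transpose (matrix f) ** (gram b ** matrix f)"
proof -
  have "gram (\<lambda>x y. b (f x) (f y)) $ i $ j = (transpose (matrix f) ** (gram b ** matrix f)) $ i $ j" for i j
  proof -
    have "gram (\<lambda>x y. b (f x) (f y)) $ i $ j = b (f (axis i 1)) (f (axis j 1))"
      by (simp add: gram_def)
    then show ?thesis
      unfolding bilinear_gram[OF assms, of "f (axis i 1)"]
      by (simp add: matrix_matrix_mult_def transpose_def matrix_def sum_distrib_left)
  qed
  then show ?thesis by (simp add: vec_eq_iff)
qed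

lemma matrix_comp:
  fixes f g :: "real ^ 'n \<Rightarrow> real ^ 'n"
  assumes "linear f" "linear g"
  shows "matrix (\<lambda>x. f (g x)) = matrix f ** matrix g"
  using matrix_compose[of g f] assms by (simp add: o_def)

lemma matrix_ident: "matrix (\<lambda>x::real ^ 'n. x) = mat 1"
  using matrix_id_mat_1 unfolding id_def .

text \<open>The matrix on the right is conjugate to that of \<open>f\<close>. The lemma passes from
  the standard basis at a point, used in the definition of Ricci, to the smooth frame of a
  neighbouring point.\<close>

lemma trace_frame:
  fixes f J P :: "real ^ 'n \<Rightarrow> real ^ 'n"
  assumes "linear f" "linear J" "linear P" "\<And>x. P (J x) = x"
  shows "trace (matrix f) = (\<Sum>i\<in>UNIV. J (f (P (axis i 1))) $ i)"
proof -
  have PJ: "matrix P ** matrix J = mat 1"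
    using matrix_comp[OF assms(3,2)] unfolding assms(4) matrix_ident by (rule sym)
  have "(\<Sum>i\<in>UNIV. J (f (P (axis i 1))) $ i) = trace (matrix (\<lambda>x. J (f (P x))))"
    by (simp add: trace_def matrix_def)
  also have "matrix (\<lambda>x. J (f (P x))) = matrix J ** (matrix f ** matrix P)"
    using matrix_comp[OF assms(2) linear_compose[OF assms(3,1), unfolded o_def]] matrix_comp[OF assms(1,3)] by simp
  also have "trace \<dots> = trace (matrix f ** (matrix P ** matrix J))"
    by (subst trace_mul_sym) (simp add: matrix_mul_assoc)
  finally show ?thesis by (simp add: PJ)
qed

text \<open>A change of frame multiplies both Gram matrices by the same factors on the left and
  right; in the product with the inverse they combine into a conjugation, which the trace
  ignores.\<close>

lemma gram_trace_frame:
  fixes b r :: "real ^ 'n \<Rightarrow> real ^ 'n \<Rightarrow> real" and P J :: "real ^ 'n \<Rightarrow> real ^ 'n"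
  assumes b: "\<And>y. linear (\<lambda>x. b x y)" "\<And>x. linear (b x)"
    and r: "\<And>y. linear (\<lambda>x. r x y)" "\<And>x. linear (r x)"
    and PJ: "linear P" "linear J" "\<And>x. P (J x) = x" "\<And>x. J (P x) = x"
    and det: "det (gram b) \<noteq> 0"
  shows "trace (matrix_inv (gram (\<lambda>x y. b (P x) (P y))) ** gram (\<lambda>x y. r (P x) (P y)))
    = trace (matrix_inv (gram b) ** gram r)"
proof -
  let ?P = "matrix P" and ?J = "matrix J" and ?G = "gram b" and ?H = "matrix_inv (gram b)"
  have 1: "?P ** ?J = mat 1" "?J ** ?P = mat 1"
    by (rule matrix_comp[OF PJ(1,2), unfolded PJ(3) matrix_ident, symmetric]
        matrix_comp[OF PJ(2,1), unfolded PJ(4) matrix_ident, symmetric])+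
  note H = matrix_inv_left_right[OF det]
  have T: "transpose ?P ** transpose ?J = mat 1" "transpose ?J ** transpose ?P = mat 1"
    using arg_cong[OF 1(2), of transpose] arg_cong[OF 1(1), of transpose] by (simp_all add: matrix_transpose_mul)
  have "(transpose ?P ** (?G ** ?P)) ** (?J ** (?H ** transpose ?J))
    = transpose ?P ** (?G ** (?P ** ?J) ** ?H) ** transpose ?J" by (simp only: matrix_mul_assoc)
  also have "\<dots> = mat 1" by (simp add: 1 H T)
  finally have inv: "matrix_inv (transpose ?P ** (?G ** ?P)) = ?J ** (?H ** transpose ?J)"
    by (rule matrix_inv_unique)
  have "trace ((?J ** (?H ** transpose ?J)) ** (transpose ?P ** (gram r ** ?P)))
    = trace (?J ** (?H ** (transpose ?J ** transpose ?P) ** gram r ** ?P))" by (simp only: matrix_mul_assoc)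
  also have "\<dots> = trace (?H ** gram r ** (?P ** ?J))"
    unfolding T matrix_mul_rid trace_mul_sym[of ?J] by (simp only: matrix_mul_assoc)
  finally show ?thesis
    unfolding gram_compose[OF b, of P] gram_compose[OF r, of P] inv by (simp add: 1)
qed

context cartan
begin

lemma hRic_sum: "hRic \<kappa> D u x z = (\<Sum>i\<in>UNIV. hcurv \<kappa> D u x (axis i 1) z $ i)"
  unfolding hRic_def by (simp add: trace_def matrix_def)

lemma hRic_linear1: "u \<in> slit \<Longrightarrow> linear (\<lambda>x. hRic \<kappa> D u x z)"
  by (rule linearI)
     (simp_all add: hRic_sum linear_add[OF hcurv_linear1] linear_scale[OF hcurv_linear1] sum.distrib sum_distrib_left)

lemma hRic_linear2: "u \<in> slit \<Longrightarrow> linear (hRic \<kappa> D u x)"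
  by (rule linearI)
     (simp_all add: hRic_sum linear_add[OF hcurv_linear3] linear_scale[OF hcurv_linear3] sum.distrib sum_distrib_left)

lemma frame_inverse:
  assumes "w \<in> tm.dom u"
  shows "ext \<kappa> u (base.tc (fst u) (fst w) x) w = x" "base.tc (fst u) (fst w) (ext \<kappa> u x w) = x"
  using ext_hat[of w u "\<lambda>_. x"] hat_ext[of w u x] assms by (simp_all add: slit_dom hat_def)

lemma hRic_frame:
  assumes "w \<in> tm.dom u"
  shows "hRic \<kappa> D w x z = (\<Sum>i\<in>UNIV. base.tc (fst u) (fst w) (hcurv \<kappa> D w x (ext \<kappa> u (axis i 1) w) z) $ i)"
  unfolding hRic_def
  by (rule trace_frame) (use assms in \<open>auto simp: slit_dom frame_inverse intro: hcurv_linear2 hat_linear ext_linear\<close>)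

lemma smn_hRic:
  assumes u: "u \<in> slit" and "pfs u X" "pfs u Z"
  shows "tm.smn u (\<lambda>w. hRic \<kappa> D w (X w) (Z w))"
proof (rule tm.smn_eq[OF u])
  show "tm.smn u (\<lambda>w. \<Sum>i\<in>UNIV. hat u (\<lambda>w. hcurv \<kappa> D w (X w) (ext \<kappa> u (axis i 1) w) (Z w)) w $ i)"
    by (intro tm.smn_sum[OF u] tm.smn_nth[OF u] pfs_hcurv[unfolded pfs_alt] u)
       (use assms pfs_ext_self[OF u] in \<open>simp_all add: pfs_alt\<close>)
  show "\<forall>\<^sub>F w in tm.nb u. (\<Sum>i\<in>UNIV. hat u (\<lambda>w. hcurv \<kappa> D w (X w) (ext \<kappa> u (axis i 1) w) (Z w)) w $ i)
      = hRic \<kappa> D w (X w) (Z w)"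
    using tm.ev_nb_self[OF u] by eventually_elim (simp add: hRic_frame hat_def)
qed

lemma det_gram_metric:
  assumes u: "u \<in> slit" shows "det (gram (fmetric L u)) \<noteq> 0"
proof -
  have "c = 0" if "gram (fmetric L u) *v c = 0" for c
  proof (rule ccontr)
    assume "c \<noteq> 0"
    have "fmetric L u c c = (\<Sum>i\<in>UNIV. c $ i * (gram (fmetric L u) *v c) $ i)"
      unfolding bilinear_gram[OF metric_linear1[OF u] metric_linear2[OF u], of c c]
      by (simp add: matrix_vector_mult_def sum_distrib_left)
    then show False using metric_pos[OF u \<open>c \<noteq> 0\<close>] that by simp
  qed
  then show ?thesis
    using matrix_left_invertible_ker[of "gram (fmetric L u)"] invertible_left_inverse[of "gram (fmetric L u)"]
      invertible_det_nz[of "gram (fmetric L u)"] by blast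
qed

lemma hscal_frame:
  assumes "w \<in> tm.dom u"
  shows "hscal \<kappa> L D w = trace (matrix_inv (gram (\<lambda>x y. fmetric L w (ext \<kappa> u x w) (ext \<kappa> u y w)))
    ** gram (\<lambda>x y. hRic \<kappa> D w (ext \<kappa> u x w) (ext \<kappa> u y w)))"
proof -
  have w: "w \<in> slit" "fst w \<in> base.dom (fst u)" using assms slit_dom by auto
  show ?thesis
    unfolding hscal_def
    by (rule gram_trace_frame[symmetric, OF metric_linear1[OF w(1)] metric_linear2[OF w(1)]
          hRic_linear1[OF w(1)] hRic_linear2[OF w(1)] ext_linear[OF w(2)] hat_linear[OF w(2)]
          frame_inverse[OF assms] det_gram_metric[OF w(1)]])
qed

text \<open>In the frame of \<open>u\<close> both Gram matrices are smooth, which need not hold for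
  the standard bases in which the definition takes them; the metric Gram matrix is invertible by
  definiteness.\<close>

lemma smn_hscal:
  assumes u: "u \<in> slit" shows "tm.smn u (hscal \<kappa> L D)"
proof (rule tm.smn_eq[OF u])
  let ?G = "\<lambda>w. gram (\<lambda>x y. fmetric L w (ext \<kappa> u x w) (ext \<kappa> u y w))"
  let ?R = "\<lambda>w. gram (\<lambda>x y. hRic \<kappa> D w (ext \<kappa> u x w) (ext \<kappa> u y w))"
  note E = pfs_ext_self[OF u]
  have G: "tm.smn u ?G" and R: "tm.smn u ?R"
    by (intro tm.smn_vec u, simp add: gram_def smn_metric[OF u E E] smn_hRic[OF u E E])+
  have "tm.smn u (\<lambda>w. matrix_inv (?G w))"
    by (rule tm.smn_matrix_inv[OF u G]) (simp add: det_gram_metric[OF u])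
  then show "tm.smn u (\<lambda>w. trace (matrix_inv (?G w) ** ?R w))"
    unfolding trace_def matrix_matrix_mult_def
    by (simp, intro tm.smn_sum u tm.smn_mult tm.smn_nth R)
  show "\<forall>\<^sub>F w in tm.nb u. trace (matrix_inv (?G w) ** ?R w) = hscal \<kappa> L D w"
    using tm.ev_nb_self[OF u] by eventually_elim (simp add: hscal_frame)
qed

lemma hscal_sc: "u \<in> slit \<Longrightarrow> c > 0 \<Longrightarrow> hscal \<kappa> L D (sc c u) = hscal \<kappa> L D u"
  unfolding hscal_def gram_def by (simp add: hRic_def hcurv_sc metric_sc)

lemma hscal_eq_0: "(\<And>x z. hRic \<kappa> D u x z = 0) \<Longrightarrow> hscal \<kappa> L D u = 0"
  unfolding hscal_def by (simp add: gram_def trace_def matrix_matrix_mult_def)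


section \<open>Horizontal covariant derivatives\<close>

lemma hcov0_linear: "u \<in> slit \<Longrightarrow> tm.smn u f \<Longrightarrow> linear (hcov0 \<kappa> D f u)"
  using linear_compose[OF beta_linear tm.dd_linear] by (simp add: hcov0_def[abs_def] o_def)

lemma smn_hcov0: "u \<in> slit \<Longrightarrow> tm.smn u f \<Longrightarrow> pfs u X \<Longrightarrow> tm.smn u (\<lambda>w. hcov0 \<kappa> D f w (X w))"
  using tm.dd_field(1)[OF _ vfs_hlift] by (simp add: hcov0_def hlift_def)

lemma dd_beta_sc:
  assumes u: "u \<in> slit" and c: "c > 0" and f: "tm.smn (sc c u) f"
    and hom: "\<And>w. w \<in> slit \<Longrightarrow> f (sc c w) = f w"
  shows "dirT (sc c u) (beta D (sc c u) v) f = dirT u (beta D u v) f"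
proof -
  have "eventually (\<lambda>w. f (sc c w) = f w) (tm.nb u)"
    using tm.ev_nb_S[OF u] by eventually_elim (rule hom)
  from tm.dd_cong[OF u this] show ?thesis
    unfolding beta_sc[OF u c] dd_sc[OF u c f] .
qed

lemma Gtensor_linear:
  assumes u: "u \<in> slit"
  shows "linear (\<lambda>x. Gtensor L u x y z)" "linear (\<lambda>y. Gtensor L u x y z)" "linear (\<lambda>z. Gtensor L u x y z)"
  unfolding Gtensor_def
  by (rule linearI; simp add: linear_add[OF metric_linear1[OF u]] linear_scale[OF metric_linear1[OF u]]
      linear_add[OF metric_linear2[OF u]] linear_scale[OF metric_linear2[OF u]] algebra_simps)+

lemma pfs_Gtensor:
  assumes u: "u \<in> slit" and "pfs u X" "pfs u Y" "pfs u Z"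
  shows "pfs u (\<lambda>w. Gtensor L w (X w) (Y w) (Z w))"
  unfolding Gtensor_def by (intro pfs_diff pfs_scaleR smn_metric assms)

text \<open>Derivatives of the coefficients g(X,Z) and g(Y,Z) are absorbed by metric compatibility,
  so no further term appears: this is the parallelism of G, in arbitrary directions.\<close>

lemma D_Gtensor:
  assumes u: "u \<in> slit" and X: "pfs u X" and Y: "pfs u Y" and Z: "pfs u Z"
  shows "D u V (\<lambda>w. Gtensor L w (X w) (Y w) (Z w))
    = Gtensor L u (D u V X) (Y u) (Z u) + Gtensor L u (X u) (D u V Y) (Z u) + Gtensor L u (X u) (Y u) (D u V Z)"
  unfolding Gtensor_def
    D_diff[OF u pfs_scaleR[OF u smn_metric[OF u X Z] Y] pfs_scaleR[OF u smn_metric[OF u Y Z] X]]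
    D_scaleR[OF u smn_metric[OF u X Z] Y] D_scaleR[OF u smn_metric[OF u Y Z] X]
    metric_compat[OF u X Z] metric_compat[OF u Y Z]
  by (simp add: algebra_simps)

text \<open>The coefficient k r of G in the decomposition of the curvature.\<close>

definition hk :: "('m, 'n) tpoint \<Rightarrow> real" where
  "hk u = hscal \<kappa> L D u / (real CARD('n) * (real CARD('n) - 1))"

lemma hk_alt: "hk = (\<lambda>u. inverse (real CARD('n) * (real CARD('n) - 1)) * hscal \<kappa> L D u)"
  unfolding hk_def by (simp add: fun_eq_iff divide_inverse mult.commute)

lemma smn_hk: "u \<in> slit \<Longrightarrow> tm.smn u hk"
  unfolding hk_alt by (intro tm.smn_mult tm.smn_const smn_hscal)

lemma hcov0_hk: "u \<in> slit \<Longrightarrow> hcov0 \<kappa> D hk u w = inverse (real CARD('n) * (real CARD('n) - 1)) * hcov0 \<kappa> D (hscal \<kappa> L D) u w"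
  unfolding hk_alt hcov0_def by (rule tm.dd_cmult[OF _ smn_hscal])

lemma concircular_alt: "concircular \<kappa> L D u x y z = hcurv \<kappa> D u x y z - hk u *\<^sub>R Gtensor L u x y z"
  unfolding concircular_def hk_def ..

lemma hcurv_alt: "hcurv \<kappa> D = (\<lambda>u x y z. concircular \<kappa> L D u x y z + hk u *\<^sub>R Gtensor L u x y z)"
  unfolding concircular_alt by simp

lemma concircular_linear3: "u \<in> slit \<Longrightarrow> linear (\<lambda>z. concircular \<kappa> L D u x y z)"
  unfolding concircular_alt
  by (intro linear_compose_sub hcurv_linear3 linear_compose_scale_right Gtensor_linear)

lemma pfs_concircular:
  assumes u: "u \<in> slit" and "pfs u X" "pfs u Y" "pfs u Z"
  shows "pfs u (\<lambda>w. concircular \<kappa> L D w (X w) (Y w) (Z w))"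
  unfolding concircular_alt
  by (rule pfs_diff[OF u pfs_hcurv[OF assms] pfs_scaleR[OF u smn_hk[OF u] pfs_Gtensor[OF assms]]])

lemma hcov13_hcurv:
  assumes u: "u \<in> slit"
  shows "hcov13 \<kappa> D (hcurv \<kappa> D) u w x y z
    = hcov13 \<kappa> D (concircular \<kappa> L D) u w x y z + hcov0 \<kappa> D hk u w *\<^sub>R Gtensor L u x y z"
proof -
  note E = pfs_ext_self[OF u]
  have "D u V (\<lambda>q. concircular \<kappa> L D q (ext \<kappa> u x q) (ext \<kappa> u y q) (ext \<kappa> u z q) + hk q *\<^sub>R Gtensor L q (ext \<kappa> u x q) (ext \<kappa> u y q) (ext \<kappa> u z q))
    = D u V (\<lambda>q. concircular \<kappa> L D q (ext \<kappa> u x q) (ext \<kappa> u y q) (ext \<kappa> u z q)) + (dirT u V hk *\<^sub>R Gtensor L u x y z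
      + hk u *\<^sub>R (Gtensor L u (D u V (ext \<kappa> u x)) y z + Gtensor L u x (D u V (ext \<kappa> u y)) z + Gtensor L u x y (D u V (ext \<kappa> u z))))" for V
    unfolding D_add[OF u pfs_concircular[OF u E E E] pfs_scaleR[OF u smn_hk[OF u] pfs_Gtensor[OF u E E E]]]
      D_scaleR[OF u smn_hk[OF u] pfs_Gtensor[OF u E E E]] D_Gtensor[OF u E E E] by simp
  then show ?thesis
    unfolding hcov13_def Let_def hcov0_def hcurv_alt by (simp add: algebra_simps)
qed

text \<open>Contraction commutes with covariant differentiation. The derivatives of the frame enter
  once through the traced vector and once through the traced argument, with opposite signs.\<close>

lemma hcov2_hRic:
  assumes u: "u \<in> slit"
  shows "hcov2 \<kappa> D (hRic \<kappa> D) u w x z = (\<Sum>i\<in>UNIV. hcov13 \<kappa> D (hcurv \<kappa> D) u w x (axis i 1) z $ i)"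
proof -
  note E = pfs_ext_self[OF u]
  let ?N = "D u (beta D u w)" and ?X = "ext \<kappa> u x" and ?Z = "ext \<kappa> u z" and ?E = "\<lambda>i. ext \<kappa> u (axis i 1)"
  let ?R = "hcurv \<kappa> D u" and ?dd = "dirT u (beta D u w)"
  define V where "V i = (\<lambda>q. hcurv \<kappa> D q (?X q) (?E i q) (?Z q))" for i
  have V: "pfs u (V i)" for i unfolding V_def by (rule pfs_hcurv[OF u E E E])
  have s: "tm.smn u (\<lambda>q. hat u (V i) q $ j)" for i j
    by (rule tm.smn_nth[OF u V[unfolded pfs_alt]])
  have "eventually (\<lambda>q. hRic \<kappa> D q (?X q) (?Z q) = (\<Sum>i\<in>UNIV. hat u (V i) q $ i)) (tm.nb u)"
    using tm.ev_nb_self[OF u] by eventually_elim (simp add: hRic_frame hat_def V_def)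
  from tm.dd_cong[OF u this]
  have 1: "?dd (\<lambda>q. hRic \<kappa> D q (?X q) (?Z q)) = (\<Sum>i\<in>UNIV. ?dd (\<lambda>q. hat u (V i) q $ i))"
    using tm.dd_sum[OF u s] by simp
  have "?N (V i) $ k = ?dd (\<lambda>q. hat u (V i) q $ k) + (\<Sum>j\<in>UNIV. ?R x (axis i 1) z $ j * ?N (?E j) $ k)" for i k
    unfolding D_expand[OF u tm_mem[OF u] V]
    by (simp add: sum.distrib V_def axis_def if_distrib cong: if_cong)
  note 2 = this
  \<comment> \<open>The trace of a product of two endomorphisms, one given by the curvature and one
    by the connection coefficients, taken in both orders.\<close>
  have 3: "(\<Sum>i\<in>UNIV. \<Sum>j\<in>UNIV. ?R x (axis i 1) z $ j * ?N (?E j) $ i) = (\<Sum>i\<in>UNIV. ?R x (?N (?E i)) z $ i)"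
  proof -
    have "?R x (?N (?E i)) z = ?R x (\<Sum>j\<in>UNIV. (?N (?E i) $ j) *\<^sub>R axis j 1) z" for i
      using basis_expansion[of "?N (?E i)"] by (simp add: scalar_mult_eq_scaleR)
    then have "?R x (?N (?E i)) z $ i = (\<Sum>j\<in>UNIV. ?N (?E i) $ j * ?R x (axis j 1) z $ i)" for i
      by (simp add: linear_sum[OF hcurv_linear2[OF u]] linear_scale[OF hcurv_linear2[OF u]])
    then show ?thesis by (subst sum.swap) (simp add: mult.commute)
  qed
  have "(\<Sum>i\<in>UNIV. hcov13 \<kappa> D (hcurv \<kappa> D) u w x (axis i 1) z $ i)
    = (\<Sum>i\<in>UNIV. ?N (V i) $ i) - (\<Sum>i\<in>UNIV. ?R (?N ?X) (axis i 1) z $ i)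
      - (\<Sum>i\<in>UNIV. ?R x (?N (?E i)) z $ i) - (\<Sum>i\<in>UNIV. ?R x (axis i 1) (?N ?Z) $ i)"
    unfolding hcov13_def Let_def V_def by (simp add: sum_subtractf)
  also have "(\<Sum>i\<in>UNIV. ?N (V i) $ i) = (\<Sum>i\<in>UNIV. ?dd (\<lambda>q. hat u (V i) q $ i)) + (\<Sum>i\<in>UNIV. ?R x (?N (?E i)) z $ i)"
    by (simp add: 2 sum.distrib 3)
  finally show ?thesis unfolding hcov2_def Let_def 1 by (simp add: hRic_sum)
qed

text \<open>As an endomorphism in its second argument, G is g(x,z) times the identity minus a
  rank-one map of trace g(x,z).\<close>

lemma trace_Gtensor:
  assumes u: "u \<in> slit"
  shows "(\<Sum>i\<in>UNIV. Gtensor L u x (axis i 1) z $ i) = (real CARD('n) - 1) * fmetric L u x z"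
proof -
  have "fmetric L u x z = fmetric L u (\<Sum>i\<in>UNIV. (x $ i) *\<^sub>R axis i 1) z"
    using basis_expansion[of x] by (simp add: scalar_mult_eq_scaleR)
  also have "\<dots> = (\<Sum>i\<in>UNIV. x $ i * fmetric L u (axis i 1) z)"
    by (simp add: linear_sum[OF metric_linear1[OF u]] linear_scale[OF metric_linear1[OF u]])
  finally show ?thesis
    by (simp add: Gtensor_def sum_subtractf mult.commute left_diff_distrib)
qed


section \<open>Concircularly recurrent manifolds\<close>

context
  fixes A :: "('m, 'n) tpoint \<Rightarrow> real ^ 'n \<Rightarrow> real"
  assumes A: "recurrence_1form \<kappa> A"
begin

lemma A_linear: "u \<in> slit \<Longrightarrow> linear (A u)"
  and smn_A: "u \<in> slit \<Longrightarrow> pfs u X \<Longrightarrow> tm.smn u (\<lambda>q. A q (X q))"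
  using A unfolding recurrence_1form_def by blast+

lemma A_sc: "u \<in> slit \<Longrightarrow> c > 0 \<Longrightarrow> A (sc c u) = A u"
  using A unfolding recurrence_1form_def slit_def by (cases u) (auto simp: fun_eq_iff)

text \<open>The terms with the derivative of a factor \<open>f\<close> cancel between the two
  summands. The definition can thus be evaluated on any smooth field, which smoothness in the point
  requires.\<close>

lemma hcov1_tensorial:
  assumes u: "u \<in> slit"
  shows "pfs u V \<Longrightarrow> hcov1 \<kappa> D A u (V u) w
      = dirT u (beta D u w) (\<lambda>q. A q (V q)) - A u (D u (beta D u w) V)"
    and "linear (\<lambda>v. hcov1 \<kappa> D A u v w)"
proof -
  let ?F = "\<lambda>V. dirT u (beta D u w) (\<lambda>q. A q (V q)) - A u (D u (beta D u w) V)"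
  note l = A_linear[OF u]
  have F: "hcov1 \<kappa> D A u v w = ?F (ext \<kappa> u v)" for v unfolding hcov1_def Let_def ..
  have add: "?F (\<lambda>z. X z + Y z) = ?F X + ?F Y" if "pfs u X" "pfs u Y" for X Y
  proof -
    have "eventually (\<lambda>q. A q (X q + Y q) = A q (X q) + A q (Y q)) (tm.nb u)"
      using tm.ev_nb_S[OF u] by eventually_elim (rule linear_add[OF A_linear])
    from tm.dd_cong[OF u this] show ?thesis
      using that by (simp add: tm.dd_add[OF u] smn_A u D_add linear_add[OF l])
  qed
  have scale: "?F (\<lambda>z. f z *\<^sub>R X z) = f u *\<^sub>R ?F X" if f: "tm.smn u f" and X: "pfs u X" for f X
  proof -
    have "eventually (\<lambda>q. A q (f q *\<^sub>R X q) = f q * A q (X q)) (tm.nb u)"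
      using tm.ev_nb_S[OF u] by eventually_elim (simp add: linear_scale[OF A_linear])
    from tm.dd_cong[OF u this] show ?thesis
      unfolding D_scaleR[OF u f X] linear_add[OF l] linear_scale[OF l]
      using tm.dd_mult[OF u f smn_A[OF u X]] by (simp add: algebra_simps)
  qed
  have cong: "?F X = ?F Y" if "pfs u X" "pfs u Y" "eventually (\<lambda>z. X z = Y z) (tm.nb u)" for X Y
  proof -
    have "eventually (\<lambda>q. A q (X q) = A q (Y q)) (tm.nb u)"
      using that(3) by eventually_elim simp
    from tm.dd_cong[OF u this] show ?thesis using D_cong[OF u that(1,3)] by simp
  qed
  show "hcov1 \<kappa> D A u (V u) w = ?F V" if "pfs u V"
    unfolding F by (rule tensorial_eval(1)[of u ?F, OF u add scale cong that, symmetric])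
  show "linear (\<lambda>v. hcov1 \<kappa> D A u v w)"
    unfolding F by (rule tensorial_eval(2)[of u ?F, OF u add scale cong])
qed

lemma hcov1_linear2:
  assumes u: "u \<in> slit"
  shows "linear (\<lambda>w. hcov1 \<kappa> D A u v w)"
proof -
  note E = pfs_ext_self[OF u]
  have "linear (\<lambda>w. dirT u (beta D u w) (\<lambda>q. A q (ext \<kappa> u v q)))"
    using linear_compose[OF beta_linear[OF u] tm.dd_linear[OF u smn_A[OF u E]]] by (simp add: o_def)
  moreover have "linear (\<lambda>w. A u (D u (beta D u w) (ext \<kappa> u v)))"
    using linear_compose[OF linear_compose[OF beta_linear[OF u] D_linear[OF u E]] A_linear[OF u]] by (simp add: o_def)
  ultimately show ?thesis unfolding hcov1_def Let_def by (rule linear_compose_sub)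
qed

lemma smn_hcov1:
  assumes u: "u \<in> slit" and V: "pfs u V" and W: "pfs u W"
  shows "tm.smn u (\<lambda>q. hcov1 \<kappa> D A q (V q) (W q))"
proof (rule tm.smn_eq[OF u])
  show "tm.smn u (\<lambda>q. dirT q (hlift D W q) (\<lambda>q. A q (V q)) - A q (D q (hlift D W q) V))"
    by (intro tm.smn_diff[OF u] tm.dd_field(1)[OF u vfs_hlift[OF u W] smn_A[OF u V]]
        smn_A[OF u pfs_D_hlift[OF u W V]])
  show "\<forall>\<^sub>F q in tm.nb u. dirT q (hlift D W q) (\<lambda>q. A q (V q)) - A q (D q (hlift D W q) V)
      = hcov1 \<kappa> D A q (V q) (W q)"
    using tm.ev_nb_S[OF u] pfs_ev[OF u V]
    by eventually_elim (simp add: hcov1_tensorial(1) hlift_def)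
qed

lemma hcov1_sc:
  assumes u: "u \<in> slit" and c: "c > 0"
  shows "hcov1 \<kappa> D A (sc c u) v w = hcov1 \<kappa> D A u v w"
proof -
  have s: "tm.smn (sc c u) (\<lambda>q. A q (ext \<kappa> u v q))"
    by (rule smn_A[OF sc_slit[OF u c] pfs_ext[OF u sc_dom[OF tm_mem[OF u] c]]])
  have "dirT (sc c u) (beta D (sc c u) w) (\<lambda>q. A q (ext \<kappa> u v q))
      = dirT u (beta D u w) (\<lambda>q. A q (ext \<kappa> u v q))"
    by (rule dd_beta_sc[OF u c s]) (simp only: A_sc[OF _ c] ext_sc)
  then show ?thesis
    unfolding hcov1_def Let_def ext_sc by (simp only: A_sc[OF u c] beta_sc[OF u c] D_sc_ext[OF u c])
qed

lemma recurrence_2form_hcov1: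
  assumes "\<exists>u\<in>slit. \<exists>v w. hcov1 \<kappa> D A u v w + A u v * A u w \<noteq> 0"
  shows "recurrence_2form \<kappa> (\<lambda>u v w. hcov1 \<kappa> D A u v w + A u v * A u w)"
  unfolding recurrence_2form_def
proof (intro conjI ballI allI impI)
  fix u :: "('m, 'n) tpoint" assume u: "u \<in> slit"
  show "linear (\<lambda>v. hcov1 \<kappa> D A u v w + A u v * A u w)" for w
    using linear_compose_scale_right[OF A_linear[OF u], of "A u w"]
    by (intro linear_compose_add hcov1_tensorial(2) u) (simp add: mult.commute)
  show "linear (\<lambda>w. hcov1 \<kappa> D A u v w + A u v * A u w)" for v
    using linear_compose_scale_right[OF A_linear[OF u], of "A u v"]
    by (intro linear_compose_add hcov1_linear2 u) simp
  fix X Y assume "pfs u X" "pfs u Y"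
  then show "tm.smn u (\<lambda>q. hcov1 \<kappa> D A q (X q) (Y q) + A q (X q) * A q (Y q))"
    by (intro tm.smn_add[OF u] tm.smn_mult[OF u] smn_hcov1 smn_A u)
next
  fix p :: 'm and y v w :: "real ^ 'n" and c :: real assume "y \<noteq> 0" "c > 0"
  then show "hcov1 \<kappa> D A (p, c *\<^sub>R y) v w + A (p, c *\<^sub>R y) v * A (p, c *\<^sub>R y) w
      = hcov1 \<kappa> D A (p, y) v w + A (p, y) v * A (p, y) w"
    using hcov1_sc[of "(p, y)" c v w] A_sc[of "(p, y)" c] by (simp add: slit_def)
qed (use assms in blast)

text \<open>The factor \<open>a\<close> is left free because the curvature needs 1/(n(n-1)) and its
  trace, the Ricci tensor, needs 1/n.\<close>

lemma recurrence_1form_hscal: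
  assumes "a \<noteq> 0" "\<exists>u\<in>slit. \<exists>w. hcov0 \<kappa> D (hscal \<kappa> L D) u w - hscal \<kappa> L D u * A u w \<noteq> 0"
  shows "recurrence_1form \<kappa> (\<lambda>u w. a * (hcov0 \<kappa> D (hscal \<kappa> L D) u w - hscal \<kappa> L D u * A u w))"
  unfolding recurrence_1form_def
proof (intro conjI ballI allI impI)
  fix u :: "('m, 'n) tpoint" assume u: "u \<in> slit"
  have "linear (\<lambda>w. a *\<^sub>R (hcov0 \<kappa> D (hscal \<kappa> L D) u w - hscal \<kappa> L D u *\<^sub>R A u w))"
    by (intro linear_compose_scale_right linear_compose_sub A_linear u)
       (use hcov0_linear[OF u smn_hscal[OF u]] in simp)
  then show "linear (\<lambda>w. a * (hcov0 \<kappa> D (hscal \<kappa> L D) u w - hscal \<kappa> L D u * A u w))" by simp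
  fix X assume "pfs u X"
  then show "tm.smn u (\<lambda>q. a * (hcov0 \<kappa> D (hscal \<kappa> L D) q (X q) - hscal \<kappa> L D q * A q (X q)))"
    by (intro tm.smn_mult[OF u] tm.smn_diff[OF u] tm.smn_const u smn_hcov0 smn_hscal smn_A)
next
  fix p :: 'm and y w :: "real ^ 'n" and c :: real assume y: "y \<noteq> 0" and c: "c > 0"
  then have u: "(p, y) \<in> slit" by (simp add: slit_def)
  have "hcov0 \<kappa> D (hscal \<kappa> L D) (sc c (p, y)) w = hcov0 \<kappa> D (hscal \<kappa> L D) (p, y) w"
    unfolding hcov0_def
    using dd_beta_sc[OF u c smn_hscal[OF sc_slit[OF u c]], of w] hscal_sc[OF _ c] by blast
  then show "a * (hcov0 \<kappa> D (hscal \<kappa> L D) (p, c *\<^sub>R y) w - hscal \<kappa> L D (p, c *\<^sub>R y) * A (p, c *\<^sub>R y) w)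
      = a * (hcov0 \<kappa> D (hscal \<kappa> L D) (p, y) w - hscal \<kappa> L D (p, y) * A (p, y) w)"
    using hscal_sc[OF u c] A_sc[OF u c] by simp
qed (use assms in auto)

context
  assumes rec: "\<And>u w x y z. u \<in> slit \<Longrightarrow>
    hcov13 \<kappa> D (concircular \<kappa> L D) u w x y z = A u w *\<^sub>R concircular \<kappa> L D u x y z"
begin

text \<open>Leibniz rule for A \<otimes> C, with the recurrence used three times: as an identity
  near \<open>u\<close> before differentiating, at \<open>u\<close> in the correction terms, and for
  the remaining derivative of C.\<close>

lemma hcov_form13_concircular:
  assumes u: "u \<in> slit"
  shows "hcov_form13 \<kappa> D (hcov13 \<kappa> D (concircular \<kappa> L D)) u v w x y z
    = (hcov1 \<kappa> D A u v w + A u v * A u w) *\<^sub>R concircular \<kappa> L D u x y z"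
proof -
  note E = pfs_ext_self[OF u]
  let ?C = "\<lambda>q. concircular \<kappa> L D q (ext \<kappa> u x q) (ext \<kappa> u y q) (ext \<kappa> u z q)"
  have C: "pfs u ?C" by (rule pfs_concircular[OF u E E E])
  have a: "tm.smn u (\<lambda>q. A q (ext \<kappa> u v q))" by (rule smn_A[OF u E])
  have "eventually (\<lambda>q. A q (ext \<kappa> u v q) *\<^sub>R ?C q
      = hcov13 \<kappa> D (concircular \<kappa> L D) q (ext \<kappa> u v q) (ext \<kappa> u x q) (ext \<kappa> u y q) (ext \<kappa> u z q)) (tm.nb u)"
    using tm.ev_nb_S[OF u] by eventually_elim (simp add: rec)
  from D_cong[OF u pfs_scaleR[OF u a C] this, symmetric]
  have "D u (beta D u w) (\<lambda>q. hcov13 \<kappa> D (concircular \<kappa> L D) q (ext \<kappa> u v q) (ext \<kappa> u x q) (ext \<kappa> u y q) (ext \<kappa> u z q))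
    = dirT u (beta D u w) (\<lambda>q. A q (ext \<kappa> u v q)) *\<^sub>R concircular \<kappa> L D u x y z
      + A u v *\<^sub>R D u (beta D u w) ?C"
    unfolding D_scaleR[OF u a C] by simp
  then have "hcov_form13 \<kappa> D (hcov13 \<kappa> D (concircular \<kappa> L D)) u v w x y z
    = hcov1 \<kappa> D A u v w *\<^sub>R concircular \<kappa> L D u x y z + A u v *\<^sub>R hcov13 \<kappa> D (concircular \<kappa> L D) u w x y z"
    unfolding hcov_form13_def hcov1_def Let_def hcov13_def[of _ _ _ u w] rec[OF u] by (simp add: algebra_simps)
  then show ?thesis unfolding rec[OF u] by (simp add: algebra_simps)
qed

text \<open>Writing A \<otimes> C as A \<otimes> R minus k r A \<otimes> G moves the scalar
  curvature into the coefficient of G.\<close>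

lemma hcov13_hcurv_rec:
  assumes u: "u \<in> slit"
  shows "hcov13 \<kappa> D (hcurv \<kappa> D) u w x y z = A u w *\<^sub>R hcurv \<kappa> D u x y z
    + (inverse (real CARD('n) * (real CARD('n) - 1))
        * (hcov0 \<kappa> D (hscal \<kappa> L D) u w - hscal \<kappa> L D u * A u w)) *\<^sub>R Gtensor L u x y z"
  unfolding hcov13_hcurv[OF u] rec[OF u] concircular_alt hcov0_hk[OF u]
  by (simp add: hk_alt algebra_simps)

lemma hcov2_hRic_rec:
  assumes u: "u \<in> slit"
  shows "hcov2 \<kappa> D (hRic \<kappa> D) u w x z = A u w * hRic \<kappa> D u x z
    + (inverse (real CARD('n) * (real CARD('n) - 1)) * (real CARD('n) - 1)
        * (hcov0 \<kappa> D (hscal \<kappa> L D) u w - hscal \<kappa> L D u * A u w)) * fmetric L u x z"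
  unfolding hcov2_hRic[OF u] hcov13_hcurv_rec[OF u]
  by (simp add: sum.distrib sum_distrib_left[symmetric] trace_Gtensor[OF u] hRic_sum)

text \<open>Since \<open>\<nabla>\<^bsub>\<beta>w\<^esub> \<eta> = 0\<close>, the recurrence of \<open>C\<close> may be evaluated on the field \<open>\<eta>\<close>, on which \<open>C\<close>
  reduces to a multiple of the parallel tensor \<open>G\<close>.\<close>

lemma hscal_recurrent:
  assumes hat0: "\<And>u x y. u \<in> slit \<Longrightarrow> hcurv_hat \<kappa> D u x y = 0" and n: "CARD('n) \<ge> 3" and u: "u \<in> slit"
  shows "hcov0 \<kappa> D hk u w = A u w * hk u"
proof -
  note E = pfs_ext_self[OF u] and et = pfs_eta[OF u]
  let ?N = "D u (beta D u w)" and ?C = "concircular \<kappa> L D" and ?G = "Gtensor L"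
  have Ceta: "?C q a b (eta q) = - hk q *\<^sub>R ?G q a b (eta q)" if "q \<in> slit" for q a b
    using hat0[OF that] unfolding concircular_alt hcurv_hat_def by simp
  have main: "(hcov0 \<kappa> D hk u w - A u w * hk u) *\<^sub>R ?G u x y (eta u) = 0" for x y
  proof -
    let ?X = "ext \<kappa> u x" and ?Y = "ext \<kappa> u y"
    \<comment> \<open>The part of the covariant derivative of C that involves the third argument.
      The definition covers only chart-constant fields there, and \<eta> is not one; the
      tensoriality of \<open>?F\<close> justifies inserting \<eta>.\<close>
    let ?F = "\<lambda>Z. ?N (\<lambda>q. ?C q (?X q) (?Y q) (Z q)) - ?C u x y (?N Z)"
    note l = concircular_linear3[OF u]
    have add: "?F (\<lambda>q. Y q + Z q) = ?F Y + ?F Z" if "pfs u Y" "pfs u Z" for Y Z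
    proof -
      note CY = pfs_concircular[OF u E E that(1), of x y] and CZ = pfs_concircular[OF u E E that(2), of x y]
      have "eventually (\<lambda>q. ?C q (?X q) (?Y q) (Y q) + ?C q (?X q) (?Y q) (Z q) = ?C q (?X q) (?Y q) (Y q + Z q)) (tm.nb u)"
        using tm.ev_nb_S[OF u] by eventually_elim (simp add: linear_add[OF concircular_linear3])
      from D_cong[OF u pfs_add[OF u CY CZ] this, symmetric] show ?thesis
        using that by (simp add: D_add[OF u CY CZ] D_add[OF u] linear_add[OF l])
    qed
    have scale: "?F (\<lambda>q. f q *\<^sub>R Z q) = f u *\<^sub>R ?F Z" if f: "tm.smn u f" and Z: "pfs u Z" for f Z
    proof -
      note CZ = pfs_concircular[OF u E E Z, of x y]
      have "eventually (\<lambda>q. f q *\<^sub>R ?C q (?X q) (?Y q) (Z q) = ?C q (?X q) (?Y q) (f q *\<^sub>R Z q)) (tm.nb u)"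
        using tm.ev_nb_S[OF u] by eventually_elim (simp add: linear_scale[OF concircular_linear3])
      from D_cong[OF u pfs_scaleR[OF u f CZ] this, symmetric] show ?thesis
        by (simp add: D_scaleR[OF u f CZ] D_scaleR[OF u f Z] linear_add[OF l] linear_scale[OF l] algebra_simps)
    qed
    have cong: "?F Y = ?F Z" if "pfs u Y" "pfs u Z" "eventually (\<lambda>q. Y q = Z q) (tm.nb u)" for Y Z
    proof -
      have "eventually (\<lambda>q. ?C q (?X q) (?Y q) (Y q) = ?C q (?X q) (?Y q) (Z q)) (tm.nb u)"
        using that(3) by eventually_elim simp
      from D_cong[OF u pfs_concircular[OF u E E that(1)] this] show ?thesis
        using D_cong[OF u that(1,3)] by simp
    qed
    have F: "?F eta = ?F (ext \<kappa> u (eta u))"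
      by (rule tensorial_eval(1)[of u ?F, OF u add scale cong et])
    have s: "tm.smn u (\<lambda>q. - hk q)" by (rule tm.smn_minus[OF u smn_hk[OF u]])
    have "eventually (\<lambda>q. - hk q *\<^sub>R ?G q (?X q) (?Y q) (eta q) = ?C q (?X q) (?Y q) (eta q)) (tm.nb u)"
      using tm.ev_nb_S[OF u] by eventually_elim (rule Ceta[symmetric])
    from D_cong[OF u pfs_scaleR[OF u s pfs_Gtensor[OF u E E et]] this, symmetric]
    have "?N (\<lambda>q. ?C q (?X q) (?Y q) (eta q)) = dirT u (beta D u w) (\<lambda>q. - hk q) *\<^sub>R ?G u x y (eta u)
        - hk u *\<^sub>R (?G u (?N ?X) y (eta u) + ?G u x (?N ?Y) (eta u))"
      unfolding D_scaleR[OF u s pfs_Gtensor[OF u E E et]] D_Gtensor[OF u E E et]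
      by (simp add: D_beta_eta[OF u] linear_0[OF Gtensor_linear(3)[OF u]])
    moreover have "dirT u (beta D u w) (\<lambda>q. - hk q) = - hcov0 \<kappa> D hk u w"
      using tm.dd_cmult[OF u smn_hk[OF u], of _ "-1"] by (simp add: hcov0_def)
    moreover have "A u w *\<^sub>R ?C u x y (eta u) = ?F eta - ?C u (?N ?X) y (eta u) - ?C u x (?N ?Y) (eta u)"
      unfolding rec[OF u, symmetric] F hcov13_def Let_def by (simp add: algebra_simps)
    ultimately show ?thesis
      unfolding Ceta[OF u] by (auto simp: D_beta_eta[OF u] linear_0[OF l] algebra_simps)
  qed
  \<comment> \<open>Some \<open>x\<close> is independent of \<eta> because the dimension exceeds 1.
    For it G(x,\<eta>)\<eta> is nonzero, so the scalar factor in \<open>main\<close> must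
    vanish.\<close>
  have "\<exists>x. x \<notin> span {eta u}"
  proof (rule ccontr)
    assume "\<not> ?thesis"
    then have "dim (UNIV :: (real ^ 'n) set) \<le> card {eta u}" by (intro dim_le_card) auto
    then show False using n by simp
  qed
  then obtain x where x: "x \<notin> span {eta u}" by blast
  have e: "eta u \<noteq> 0" using u by (simp add: eta_def slit_def)
  have "?G u x (eta u) (eta u) \<noteq> 0"
  proof
    assume "?G u x (eta u) (eta u) = 0"
    then have eq: "fmetric L u (eta u) (eta u) *\<^sub>R x = fmetric L u x (eta u) *\<^sub>R eta u"
      unfolding Gtensor_def by simp
    have "x = inverse (fmetric L u (eta u) (eta u)) *\<^sub>R (fmetric L u (eta u) (eta u) *\<^sub>R x)"
      using metric_pos[OF u e] by simp
    then have "x \<in> span {eta u}" unfolding eq by (metis span_base span_scale singletonI)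
    then show False using x by simp
  qed
  then show ?thesis using main[of x "eta u"] by simp
qed

end

end

end

theorem theorem4p2:
  fixes \<kappa> :: "'m::{t2_space, second_countable_topology} \<Rightarrow> ('m, real ^ 'n::finite) chart"
    and L :: "('m, 'n) tpoint \<Rightarrow> real"
    and D :: "('m, 'n) connection"
    and A :: "('m, 'n) tpoint \<Rightarrow> real ^ 'n \<Rightarrow> real"
  assumes "CARD('n) \<ge> 3"
    and "finsler_manifold \<kappa> L"
    and "cartan_connection \<kappa> L D"
    and "concircularly_recurrent \<kappa> L D A"
  shows "((\<exists>u\<in>slit. \<exists>v w. hcov1 \<kappa> D A u v w + A u v * A u w \<noteq> 0)
            \<longrightarrow> two_concircularly_recurrent \<kappa> L D) \<and>
         ((\<exists>u\<in>slit. \<exists>w. hcov0 \<kappa> D (hscal \<kappa> L D) u w - hscal \<kappa> L D u * A u w \<noteq> 0)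
            \<longrightarrow> generalized_recurrent \<kappa> L D \<and> generalized_Ricci_recurrent \<kappa> L D) \<and>
         ((\<forall>u\<in>slit. \<forall>x y. hcurv_hat \<kappa> D u x y = 0)
            \<longrightarrow> recurrent \<kappa> D)"
proof -
  interpret cartan \<kappa> L D
    using assms(2,3)
    by unfold_locales (simp_all add: finsler_manifold_def cartan_connection_def)
  have A: "recurrence_1form \<kappa> A"
    and C0: "\<exists>u\<in>slit. \<exists>x y z. concircular \<kappa> L D u x y z \<noteq> 0"
    and rec: "\<And>u w x y z. u \<in> slit \<Longrightarrow>
      hcov13 \<kappa> D (concircular \<kappa> L D) u w x y z = A u w *\<^sub>R concircular \<kappa> L D u x y z"
    using assms(4) unfolding concircularly_recurrent_def by blast+
  let ?B = "\<lambda>u w. hcov0 \<kappa> D (hscal \<kappa> L D) u w - hscal \<kappa> L D u * A u w"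
  let ?c = "inverse (real CARD('n) * (real CARD('n) - 1))"
  have c: "?c \<noteq> 0" "?c * (real CARD('n) - 1) \<noteq> 0" using assms(1) by auto
  \<comment> \<open>Ricci is a trace of the curvature. Part (b) uses this directly; part (c) uses
    the contrapositive, that zero curvature forces zero Ricci.\<close>
  have R0: "\<exists>u\<in>slit. \<exists>x y z. hcurv \<kappa> D u x y z \<noteq> 0" if "\<exists>u\<in>slit. \<exists>x z. hRic \<kappa> D u x z \<noteq> 0"
  proof (rule ccontr)
    assume "\<not> ?thesis"
    then have "hRic \<kappa> D u x z = 0" if "u \<in> slit" for u x z
      unfolding hRic_sum using that by simp
    with that show False by blast
  qed
  show ?thesis
  proof (intro conjI impI)
    assume "\<exists>u\<in>slit. \<exists>v w. hcov1 \<kappa> D A u v w + A u v * A u w \<noteq> 0"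
    then show "two_concircularly_recurrent \<kappa> L D"
      unfolding two_concircularly_recurrent_def
      using assms(1) C0 recurrence_2form_hcov1[OF A] hcov_form13_concircular[OF A rec] by blast
  next
    assume B: "\<exists>u\<in>slit. \<exists>w. ?B u w \<noteq> 0"
    \<comment> \<open>Otherwise r would vanish on the whole slit bundle, and with it both its
      derivative and r A.\<close>
    have Ric0: "\<exists>u\<in>slit. \<exists>x z. hRic \<kappa> D u x z \<noteq> 0"
    proof (rule ccontr)
      assume "\<not> ?thesis"
      then have r: "hscal \<kappa> L D u = 0" if "u \<in> slit" for u using that by (intro hscal_eq_0) blast
      have "?B u w = 0" if u: "u \<in> slit" for u w
      proof -
        have "eventually (\<lambda>q. hscal \<kappa> L D q = 0) (tm.nb u)"
          using tm.ev_nb_S[OF u] by eventually_elim (rule r)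
        from tm.dd_cong[OF u this] show ?thesis
          unfolding hcov0_def r[OF u] using tm.dd_const[OF u] by simp
      qed
      then show False using B by blast
    qed
    show "generalized_recurrent \<kappa> L D"
      unfolding generalized_recurrent_def
      using assms(1) R0[OF Ric0] A recurrence_1form_hscal[OF A c(1) B] hcov13_hcurv_rec[OF A rec] by blast
    show "generalized_Ricci_recurrent \<kappa> L D"
      unfolding generalized_Ricci_recurrent_def
      using assms(1) Ric0 A recurrence_1form_hscal[OF A c(2) B] hcov2_hRic_rec[OF A rec] by blast
  next
    assume hat0: "\<forall>u\<in>slit. \<forall>x y. hcurv_hat \<kappa> D u x y = 0"
    have "hcov13 \<kappa> D (hcurv \<kappa> D) u w x y z = A u w *\<^sub>R hcurv \<kappa> D u x y z" if u: "u \<in> slit" for u w x y z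
      \<comment> \<open>Once \<nabla>(k r) = k r A, the G-terms on the two sides agree and the
        recurrence of C passes to R.\<close>
      unfolding hcov13_hcurv[OF u] rec[OF u] concircular_alt
      using hscal_recurrent[OF A rec _ assms(1) u, of w] hat0 by (simp add: algebra_simps)
    moreover have "\<exists>u\<in>slit. \<exists>x y z. hcurv \<kappa> D u x y z \<noteq> 0"
    proof (rule ccontr)
      assume n: "\<not> ?thesis"
      have "concircular \<kappa> L D u x y z = 0" if u: "u \<in> slit" for u x y z
      proof -
        \<comment> \<open>Zero curvature makes r vanish, so both parts of C are zero and the
          hypothesis that C is nonzero is violated.\<close>
        have "hscal \<kappa> L D u = 0" using R0 n u by (intro hscal_eq_0) blast
        then show ?thesis using n u by (simp add: concircular_def)
      qed
      then show False using C0 by blast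
    qed
    ultimately show "recurrent \<kappa> D"
      unfolding recurrent_def using assms(1) A by blast
  qed
qed

end
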